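(* Let $\boldsymbol\alpha^*=\arg\min_{\boldsymbol\alpha\in\mathcal A}I_{\boldsymbol\alpha}$. Assume that $$\max_{E\in\mathcal E}\mathbb E_{p_E}\left[\left(\log\frac{\overline p_{\boldsymbol\alpha^*}(\mathbf X)}{\mathbf g(\mathbf X)}\right)^2\right]<\infty.$$ Then: (i) For any $\gamma>1$, $\mathbb E_\infty[\tau_W(\boldsymbol\alpha^*,\log\gamma)]\ge\gamma$. (ii) As $\gamma\to\infty$, $$\inf_{\tau\in\mathcal C_\gamma}\mathrm{WADD}(\tau)\ \sim\ \mathrm{WADD}(\tau_W(\boldsymbol\alpha^*,\log\gamma))\ \sim\ \frac{\log\gamma}{I_{\boldsymbol\alpha^*}}.$$
   Context: Network and data. Let $L\ge1$, $[L]=\{1,\dots,L\}$ be the set of sensors, and $1\le m\le L$ a fixed known integer. For each $\ell\in[L]$, $g_\ell$ and $f_\ell$ are (known) probability density functions on $\mathbb R$ (non-anomalous and anomalous) defining different distributions. The observation at time $k\ge1$ is $\mathbf X[k]=(X_1[k],\dots,X_L[k])\in\mathbb R^L$. Let $\mathscr F_k=\sigma(\mathbf X[1],\dots,\mathbf X[k])$ ($\mathscr F_0$ trivial). Let $\mathcal E$ be the set of all $m$-element subsets of $[L]$ (equivalently, ordered vectors of $m$ distinct indices), so $|\mathcal E|=\binom Lm$. Let $\mathbf g(\mathbf x)=\prod_{\ell=1}^L g_\ell(x_\ell)$ and, for $E\in\mathcal E$, $p_E(\mathbf x)=\prod_{\ell\in E}f_\ell(x_\ell)\prod_{\ell\notin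 E}g_\ell(x_\ell)$; $\mathbb E_{p_E}$ denotes expectation when $\mathbf X\in\mathbb R^L$ has density $p_E$. Moving anomaly model. An anomaly path is a deterministic sequence $\mathbf S=\{\mathbf S[k]\}_{k\ge1}$ with $\mathbf S[k]\in\mathcal E$. For a changepoint $\nu\ge0$ (an integer) and path $\mathbf S$, under $\mathbb P_\nu^{\mathbf S}$ (expectation $\mathbb E_\nu^{\mathbf S}$) the $\mathbf X[k]$ are independent over $k$, with density $\mathbf g$ for $1\le k\le\nu$ and $p_{\mathbf S[k]}$ for $k>\nu$. Under $\mathbb P_\infty$ (expectation $\mathbb E_\infty$) all $\mathbf X[k]$ are i.i.d. with density $\mathbf g$. Mixtures and KL number. $\mathcal A$ is the simplex of probability vectors $\boldsymbol\alpha=\{\alpha_E:E\in\mathcal E\}$, and $\overline p_{\boldsymbol\alpha}(\mathbf x)=\sum_{E\in\mathcal E}\alpha_E p_E(\mathbf x)$. Let $I_{\boldsymbol\alpha}=\mathbb E_{\overline p_{\boldsymbol\alpha}}\left[\log\frac{\overline p_{\boldsymbol\alpha}(\mathbf X)}{\mathbf g(\mathbf X)}\right]$, the expectation being taken when $\mathbf X$ has density $\overline p_{\boldsymbol\alpha}$. The minimizer $\boldsymbol\alpha^*$ of $I_{\boldsymbol\alpha}$ over $\mathcal A$ is unique (by strict convexity of $I_{\boldsymbol\alpha}$ in $\boldsymbol\alpha$). Stopping times and metrics. A stopping time $\tau$ is a positive random variable with $\{\tau\le k\}\in\mathscr F_k$ for all $k\ge1$. Define $$\mathrm{WADD}(\tau)=\sup_{\mathbf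 S}\sup_{\nu\ge0}\operatorname{ess\,sup}\,\mathbb E_\nu^{\mathbf S}[\tau-\nu\mid\tau>\nu,\mathscr F_\nu],$$ where the conditional expectation is set equal to $1$ when $\mathbb P_\nu^{\mathbf S}(\tau>\nu)=0$. For $\gamma>1$, $\mathcal C_\gamma=\{\tau:\mathbb E_\infty[\tau]\ge\gamma\}$ (stopping times adapted to $\{\mathscr F_k\}$). M-CUSUM test. For $\boldsymbol\lambda\in\mathcal A$ let $\mathcal L_{\boldsymbol\lambda}(k,\nu)=\prod_{j=\nu+1}^k\frac{\overline p_{\boldsymbol\lambda}(\mathbf X[j])}{\mathbf g(\mathbf X[j])}$, $W_{\boldsymbol\lambda}[k]=\max_{1\le i\le k}\mathcal L_{\boldsymbol\lambda}(k,i-1)$ for $k\ge1$ and $W_{\boldsymbol\lambda}[0]=0$, and for $b>0$ let $\tau_W(\boldsymbol\lambda,b)=\inf\{k\ge1:W_{\boldsymbol\lambda}[k]\ge e^b\}$. Asymptotics. $u(x)\sim v(x)$ as $x\to\infty$ means $v(x)=u(x)(1+o(1))$, where $o(1)\to0$ as $x\to\infty$.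
   Formalization: Adds the assumption that I_α is finite for every α in the simplex A; without it the claim fails, e.g. L=2, m=1, f_1 Cauchy, g_1 normal, f_2 and g_2 normals with different means, where the test ignores sensor 1. *)

theory Defs
  imports "HOL-Probability.Probability"
begin

section \<open>Sensor network and observation densities\<close>

definition pdf :: "(real \<Rightarrow> real) \<Rightarrow> bool" where
  "pdf h \<longleftrightarrow> h \<in> borel_measurable borel \<and> (\<forall>x. 0 \<le> h x) \<and>
     (\<integral>\<^sup>+x. ennreal (h x) \<partial>lborel) = 1"

definition anomaly_sets :: "nat \<Rightarrow> nat \<Rightarrow> nat set set" where
  "anomaly_sets L m = {E. E \<subseteq> {1..L} \<and> card E = m}"

text \<open>An observation vector is a function on \<open>{1..L}\<close>, extended by \<^const>\<open>undefined\<close>;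
  the reference measure is Lebesgue measure on the \<open>L\<close>-fold product of the real line.\<close>

definition obs_space :: "nat \<Rightarrow> (nat \<Rightarrow> real) measure" where
  "obs_space L = (\<Pi>\<^sub>M l\<in>{1..L}. lborel)"

definition g_joint :: "nat \<Rightarrow> (nat \<Rightarrow> real \<Rightarrow> real) \<Rightarrow> (nat \<Rightarrow> real) \<Rightarrow> real" where
  "g_joint L g x = (\<Prod>l\<in>{1..L}. g l (x l))"

definition p_anom :: "nat \<Rightarrow> (nat \<Rightarrow> real \<Rightarrow> real) \<Rightarrow> (nat \<Rightarrow> real \<Rightarrow> real) \<Rightarrow>
    nat set \<Rightarrow> (nat \<Rightarrow> real) \<Rightarrow> real" where
  "p_anom L g f E x = (\<Prod>l\<in>E. f l (x l)) * (\<Prod>l\<in>{1..L} - E. g l (x l))"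

definition law :: "nat \<Rightarrow> ((nat \<Rightarrow> real) \<Rightarrow> real) \<Rightarrow> (nat \<Rightarrow> real) measure" where
  "law L h = density (obs_space L) (\<lambda>x. ennreal (h x))"

section \<open>Mixtures and Kullback-Leibler numbers\<close>

definition mixing_simplex :: "nat \<Rightarrow> nat \<Rightarrow> (nat set \<Rightarrow> real) set" where
  "mixing_simplex L m =
     {\<alpha> \<in> anomaly_sets L m \<rightarrow>\<^sub>E {0..}. (\<Sum>E\<in>anomaly_sets L m. \<alpha> E) = 1}"

definition p_mix :: "nat \<Rightarrow> nat \<Rightarrow> (nat \<Rightarrow> real \<Rightarrow> real) \<Rightarrow> (nat \<Rightarrow> real \<Rightarrow> real) \<Rightarrow>
    (nat set \<Rightarrow> real) \<Rightarrow> (nat \<Rightarrow> real) \<Rightarrow> real" where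
  "p_mix L m g f \<alpha> x = (\<Sum>E\<in>anomaly_sets L m. \<alpha> E * p_anom L g f E x)"

text \<open>Extended-real logarithm of a ratio of densities. The densities need not be positive, and
  the library's \<open>ln 0 = 0\<close> and \<open>a / 0 = 0\<close> would hide infinite values. The value at \<open>0/0\<close>
  is immaterial as soon as all Kullback-Leibler numbers below are finite: every anomalous
  law is then absolutely continuous with respect to the non-anomalous one.\<close>

definition log_ratio :: "real \<Rightarrow> real \<Rightarrow> ereal" where
  "log_ratio a b =
     (if a = 0 \<and> b = 0 then 0 else if b = 0 then \<infinity> else if a = 0 then - \<infinity>
      else ereal (ln (a / b)))"

text \<open>Expectation of an extended-real random variable, as the difference of the integrals of
  its positive and negative parts. The Bochner integral would return \<open>0\<close> when the
  expectation is infinite.\<close>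

definition ext_expectation :: "'a measure \<Rightarrow> ('a \<Rightarrow> ereal) \<Rightarrow> ereal" where
  "ext_expectation M Y =
     enn2ereal (\<integral>\<^sup>+x. e2ennreal (Y x) \<partial>M) - enn2ereal (\<integral>\<^sup>+x. e2ennreal (- Y x) \<partial>M)"

text \<open>This may be \<open>\<infinity>\<close>. Finiteness on the whole simplex has to be assumed where strict convexity or the
  optimality conditions at a minimizer are needed: a minimizer may otherwise put no weight on
  a set \<open>E\<close> only because every mixture that includes it has an infinite number.\<close>

definition KL_number :: "nat \<Rightarrow> nat \<Rightarrow> (nat \<Rightarrow> real \<Rightarrow> real) \<Rightarrow> (nat \<Rightarrow> real \<Rightarrow> real) \<Rightarrow>
    (nat set \<Rightarrow> real) \<Rightarrow> ereal" where
  "KL_number L m g f \<alpha> =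
     ext_expectation (law L (p_mix L m g f \<alpha>))
       (\<lambda>x. log_ratio (p_mix L m g f \<alpha> x) (g_joint L g x))"

definition log_ratio_second_moment :: "nat \<Rightarrow> nat \<Rightarrow> (nat \<Rightarrow> real \<Rightarrow> real) \<Rightarrow>
    (nat \<Rightarrow> real \<Rightarrow> real) \<Rightarrow> (nat set \<Rightarrow> real) \<Rightarrow> nat set \<Rightarrow> ennreal" where
  "log_ratio_second_moment L m g f \<alpha> E =
     (\<integral>\<^sup>+x. e2ennreal ((log_ratio (p_mix L m g f \<alpha> x) (g_joint L g x))\<^sup>2)
        \<partial>law L (p_anom L g f E))"

section \<open>The moving anomaly model\<close>

text \<open>Everything lives on the canonical space of observation sequences indexed by \<open>{1..}\<close>:
  an outcome \<open>\<omega>\<close> is the whole sequence and \<open>\<omega> k\<close> is the observation at time \<open>k\<close>.\<close>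

definition anomaly_paths :: "nat \<Rightarrow> nat \<Rightarrow> (nat \<Rightarrow> nat set) set" where
  "anomaly_paths L m = {S. \<forall>k\<ge>1. S k \<in> anomaly_sets L m}"

definition P_change :: "nat \<Rightarrow> (nat \<Rightarrow> real \<Rightarrow> real) \<Rightarrow> (nat \<Rightarrow> real \<Rightarrow> real) \<Rightarrow>
    nat \<Rightarrow> (nat \<Rightarrow> nat set) \<Rightarrow> (nat \<Rightarrow> nat \<Rightarrow> real) measure" where
  "P_change L g f \<nu> S =
     (\<Pi>\<^sub>M k\<in>{1..}. law L (if k \<le> \<nu> then g_joint L g else p_anom L g f (S k)))"

definition P_infty :: "nat \<Rightarrow> (nat \<Rightarrow> real \<Rightarrow> real) \<Rightarrow> (nat \<Rightarrow> nat \<Rightarrow> real) measure" where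
  "P_infty L g = (\<Pi>\<^sub>M k\<in>{1..}. law L (g_joint L g))"

definition seq_space :: "nat \<Rightarrow> (nat \<Rightarrow> nat \<Rightarrow> real) set" where
  "seq_space L = space (\<Pi>\<^sub>M k\<in>{1..}. obs_space L)"

text \<open>The filtration is indexed by \<^typ>\<open>enat\<close> so that the library's \<^const>\<open>stopping_time\<close>
  applies to stopping times that may be infinite.\<close>

definition obs_filtration :: "nat \<Rightarrow> enat \<Rightarrow> (nat \<Rightarrow> nat \<Rightarrow> real) measure" where
  "obs_filtration L k =
     sigma (seq_space L)
       {{\<omega> \<in> seq_space L. \<omega> j \<in> A} |j A. 1 \<le> j \<and> enat j \<le> k \<and> A \<in> sets (obs_space L)}"

definition stopping_times :: "nat \<Rightarrow> ((nat \<Rightarrow> nat \<Rightarrow> real) \<Rightarrow> enat) set" where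
  "stopping_times L =
     {\<tau>. stopping_time (obs_filtration L) \<tau> \<and> (\<forall>\<omega>\<in>seq_space L. 0 < \<tau> \<omega>)}"

section \<open>Detection delay and false alarms\<close>

text \<open>Essential supremum of the conditional expectation of \<open>\<tau> - \<nu>\<close> given the event
  \<open>\<tau> > \<nu>\<close> and the observations up to time \<open>\<nu>\<close>: the conditional expectation and the essential
  supremum are taken under the probability measure conditioned on \<open>\<tau> > \<nu>\<close>.\<close>

definition worst_cond_delay :: "nat \<Rightarrow> (nat \<Rightarrow> real \<Rightarrow> real) \<Rightarrow> (nat \<Rightarrow> real \<Rightarrow> real) \<Rightarrow>
    ((nat \<Rightarrow> nat \<Rightarrow> real) \<Rightarrow> enat) \<Rightarrow> nat \<Rightarrow> (nat \<Rightarrow> nat set) \<Rightarrow> ennreal" where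
  "worst_cond_delay L g f \<tau> \<nu> S =
     (let P = P_change L g f \<nu> S;
          A = {\<omega> \<in> space P. enat \<nu> < \<tau> \<omega>};
          Q = uniform_measure P A
      in if emeasure P A = 0 then 1
         else esssup Q (nn_cond_exp Q (obs_filtration L (enat \<nu>))
                (\<lambda>\<omega>. ennreal_of_enat (\<tau> \<omega> - enat \<nu>))))"

definition WADD :: "nat \<Rightarrow> nat \<Rightarrow> (nat \<Rightarrow> real \<Rightarrow> real) \<Rightarrow> (nat \<Rightarrow> real \<Rightarrow> real) \<Rightarrow>
    ((nat \<Rightarrow> nat \<Rightarrow> real) \<Rightarrow> enat) \<Rightarrow> ennreal" where
  "WADD L m g f \<tau> = (SUP S\<in>anomaly_paths L m. SUP \<nu>. worst_cond_delay L g f \<tau> \<nu> S)"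

definition mean_time_false_alarm :: "nat \<Rightarrow> (nat \<Rightarrow> real \<Rightarrow> real) \<Rightarrow>
    ((nat \<Rightarrow> nat \<Rightarrow> real) \<Rightarrow> enat) \<Rightarrow> ennreal" where
  "mean_time_false_alarm L g \<tau> = (\<integral>\<^sup>+\<omega>. ennreal_of_enat (\<tau> \<omega>) \<partial>P_infty L g)"

definition C_class :: "nat \<Rightarrow> (nat \<Rightarrow> real \<Rightarrow> real) \<Rightarrow> real \<Rightarrow>
    ((nat \<Rightarrow> nat \<Rightarrow> real) \<Rightarrow> enat) set" where
  "C_class L g \<gamma> = {\<tau> \<in> stopping_times L. ennreal \<gamma> \<le> mean_time_false_alarm L g \<tau>}"

section \<open>The M-CUSUM test\<close>

definition mix_lr :: "nat \<Rightarrow> nat \<Rightarrow> (nat \<Rightarrow> real \<Rightarrow> real) \<Rightarrow> (nat \<Rightarrow> real \<Rightarrow> real) \<Rightarrow>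
    (nat set \<Rightarrow> real) \<Rightarrow> nat \<Rightarrow> nat \<Rightarrow> (nat \<Rightarrow> nat \<Rightarrow> real) \<Rightarrow> real" where
  "mix_lr L m g f \<alpha> k \<nu> \<omega> = (\<Prod>j\<in>{\<nu>+1..k}. p_mix L m g f \<alpha> (\<omega> j) / g_joint L g (\<omega> j))"

definition W_stat :: "nat \<Rightarrow> nat \<Rightarrow> (nat \<Rightarrow> real \<Rightarrow> real) \<Rightarrow> (nat \<Rightarrow> real \<Rightarrow> real) \<Rightarrow>
    (nat set \<Rightarrow> real) \<Rightarrow> nat \<Rightarrow> (nat \<Rightarrow> nat \<Rightarrow> real) \<Rightarrow> real" where
  "W_stat L m g f \<alpha> k \<omega> =
     (if k = 0 then 0 else Max ((\<lambda>i. mix_lr L m g f \<alpha> k (i - 1) \<omega>) ` {1..k}))"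

definition M_CUSUM :: "nat \<Rightarrow> nat \<Rightarrow> (nat \<Rightarrow> real \<Rightarrow> real) \<Rightarrow> (nat \<Rightarrow> real \<Rightarrow> real) \<Rightarrow>
    (nat set \<Rightarrow> real) \<Rightarrow> real \<Rightarrow> (nat \<Rightarrow> nat \<Rightarrow> real) \<Rightarrow> enat" where
  "M_CUSUM L m g f \<alpha> b \<omega> = Inf {enat k |k. 1 \<le> k \<and> exp b \<le> W_stat L m g f \<alpha> k \<omega>}"

section \<open>Asymptotic equivalence\<close>

text \<open>\<open>v = u (1 + o(1))\<close> at infinity, for functions that may a priori take the value
  \<open>\<infinity>\<close>; the library's \<^const>\<open>asymp_equiv\<close> covers only field-valued functions.\<close>

definition ext_asymp_equiv :: "(real \<Rightarrow> ennreal) \<Rightarrow> (real \<Rightarrow> ennreal) \<Rightarrow> bool" where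
  "ext_asymp_equiv u v \<longleftrightarrow>
     (\<exists>\<epsilon>::real \<Rightarrow> real. (\<epsilon> \<longlongrightarrow> 0) at_top \<and>
        (\<forall>\<^sub>F x in at_top. v x = u x * ennreal (1 + \<epsilon> x)))"

end

theory Submission
  imports Defs
begin

text \<open>Let \<open>q\<close> be the mixture with weights \<open>\<alpha>s\<close> and \<open>I\<close> its Kullback-Leibler number. First-order optimality of
  \<open>\<alpha>s\<close> says that the log-likelihood ratio \<open>ln (q/g)\<close> has mean at least \<open>I\<close> under every \<open>p\<^sub>E\<close>. Hence, along any
  anomaly path, a block of slightly more than \<open>ln \<gamma> / I\<close> observations makes M-CUSUM stop with
  probability close to 1 by Chebyshev's inequality, independently of the past; this bounds the delay
  from above. Conversely, drawing the positions independently from \<open>\<alpha>s\<close> makes the post-change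
  observations i.i.d. with density \<open>q\<close>, so the worst path is at least as hard as the classical
  problem \<open>g \<rightarrow> q\<close>, where a change of measure on a window of slightly fewer than \<open>ln \<gamma> / I\<close>
  observations with a small false-alarm probability shows that no rule in the class can stop earlier.\<close>

section \<open>Finite changes of density and second moments in product spaces\<close>

text \<open>Only second moments are available, so a block of \<open>t\<close> observations can fail
  to stop the test with probability of order \<open>1 / t\<close>. This suffices because failures of
  successive blocks multiply: the mean delay is at most \<open>t / (1 - d)\<close> with
  \<open>d\<close> tending to 0. For the lower bound, the obstacle is that \<open>WADD\<close>
  treats one path at a time and contains a conditional expectation and an essential supremum, which
  do not commute with averaging over paths. It is therefore first reduced to
  \<open>w P(\<tau> > \<nu> + w) \<le> WADD P(\<tau> > \<nu>)\<close>. The left side is linear in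
  the post-change measure, and the right side is the same for all paths because \<tau> > \<nu> is
  decided before the change. The changepoint cannot be fixed in advance: a rule with large mean may
  have a high hazard at some times, so \<nu> is chosen for the rule, where the hazard is at most
  \<open>w / \<gamma>\<close>. A minimizer may give some \<open>E\<close> weight 0, so absolute
  continuity of \<open>pE E\<close> with respect to \<open>q\<close> is not automatic; it is
  extracted from the finite second moment.\<close>

lemma indep_vars_PiM_coordinates:
  assumes "\<And>i. prob_space (M i)" "I \<noteq> {}"
  shows "prob_space.indep_vars (PiM I M) M (\<lambda>i \<omega>. \<omega> i) I"
proof -
  interpret product_prob_space M I
    using assms(1) by (simp add: product_prob_space_def product_prob_space_axioms_def product_sigma_finite_def prob_space_imp_sigma_finite)
  have "distr (PiM I M) (PiM I M) (\<lambda>x. \<lambda>i\<in>I. x i) = distr (PiM I M) (PiM I M) (\<lambda>x. x)"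
    by (intro distr_cong) (auto simp: space_PiM PiE_def extensional_restrict)
  also have "\<dots> = PiM I (\<lambda>i. distr (PiM I M) (M i) (\<lambda>x. x i))"
    by (simp add: distr_id2 PiM_component cong: PiM_cong)
  finally show ?thesis
    using assms(2) by (subst indep_vars_iff_distr_eq_PiM') auto
qed

lemma nn_integral_PiM_prod:
  assumes "\<And>i. prob_space (M i)" "finite J" "J \<subseteq> I"
    and [measurable]: "\<And>j. j \<in> J \<Longrightarrow> h j \<in> borel_measurable (M j)"
  shows "(\<integral>\<^sup>+\<omega>. (\<Prod>j\<in>J. h j (\<omega> j)) \<partial>PiM I M) = (\<Prod>j\<in>J. \<integral>\<^sup>+x. h j x \<partial>M j)"
proof -
  interpret product_prob_space M I
    using assms(1) by (simp add: product_prob_space_def product_prob_space_axioms_def product_sigma_finite_def prob_space_imp_sigma_finite)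
  have "(\<integral>\<^sup>+\<omega>. (\<Prod>j\<in>J. h j (\<omega> j)) \<partial>PiM I M) = (\<integral>\<^sup>+\<omega>. (\<Prod>j\<in>J. h j (restrict \<omega> J j)) \<partial>PiM I M)"
    by (intro nn_integral_cong prod.cong) auto
  also have "\<dots> = (\<integral>\<^sup>+\<omega>. (\<Prod>j\<in>J. h j (\<omega> j)) \<partial>distr (PiM I M) (PiM J M) (\<lambda>\<omega>. restrict \<omega> J))"
    using assms(2,3) by (subst nn_integral_distr) (auto intro!: measurable_restrict_subset)
  also have "\<dots> = (\<Prod>j\<in>J. \<integral>\<^sup>+x. h j x \<partial>M j)"
    using assms by (simp add: distr_PiM_restrict_finite product_nn_integral_prod)
  finally show ?thesis .
qed

text \<open>Both sides agree on cylinder sets, where the integral of the density splits coordinate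
  by coordinate. \<open>J\<close> is finite because changing infinitely many marginals usually
  produces a mutually singular measure.\<close>

lemma density_PiM_finite:
  assumes K: "\<And>i. prob_space (K i)" and K': "\<And>i. prob_space (K' i)"
    and J: "finite J" "J \<subseteq> I"
    and r[measurable]: "\<And>j. j \<in> J \<Longrightarrow> r j \<in> borel_measurable (K j)"
    and eqJ: "\<And>j. j \<in> J \<Longrightarrow> K' j = density (K j) (r j)"
    and eqI: "\<And>j. j \<in> I - J \<Longrightarrow> K' j = K j"
  shows "density (PiM I K) (\<lambda>\<omega>. \<Prod>j\<in>J. r j (\<omega> j)) = PiM I K'"
proof -
  interpret K': product_prob_space K' I
    using K' by (simp add: product_prob_space_def product_prob_space_axioms_def product_sigma_finite_def prob_space_imp_sigma_finite)
  have sets: "sets (K' j) = sets (K j)" if "j \<in> I" for j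
    using eqJ eqI that by (cases "j \<in> J") auto
  have space: "space (K' j) = space (K j)" if "j \<in> I" for j
    using sets[OF that] by (rule sets_eq_imp_space_eq)
  show ?thesis
  proof (rule K'.PiM_eq)
    show "sets (density (PiM I K) (\<lambda>\<omega>. \<Prod>j\<in>J. r j (\<omega> j))) = sets (PiM I K')"
      using sets by (simp cong: sets_PiM_cong)
    fix H A assume H: "finite H" "H \<subseteq> I" and A: "\<And>j. j \<in> H \<Longrightarrow> A j \<in> sets (K' j)"
    \<comment> \<open>One factor per coordinate, combining the density on \<open>J\<close> with the
      constraint of the cylinder on \<open>H\<close>; a coordinate of \<open>J\<close> outside
      \<open>H\<close> then integrates to total mass 1.\<close>
    define h where "h j x = (if j \<in> J then r j x else 1) * (if j \<in> H then indicator (A j) x else 1)" for j x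
    have [measurable]: "A j \<in> sets (K j)" if "j \<in> H" for j using A[OF that] sets that H by auto
    have h_meas[measurable]: "h j \<in> borel_measurable (K j)" if "j \<in> J \<union> H" for j
      using that unfolding h_def[abs_def] by (cases "j \<in> J"; cases "j \<in> H") simp_all
    have emb: "prod_emb I K' H (Pi\<^sub>E H A) = prod_emb I K H (Pi\<^sub>E H A)"
      using space by (auto simp: prod_emb_def PiE_iff)
    have meas_r: "(\<lambda>\<omega>. \<Prod>j\<in>J. r j (\<omega> j)) \<in> borel_measurable (PiM I K)"
      using J by (intro borel_measurable_prod_ennreal) (auto intro!: measurable_PiM_component_rev r)
    have "emeasure (density (PiM I K) (\<lambda>\<omega>. \<Prod>j\<in>J. r j (\<omega> j))) (prod_emb I K' H (Pi\<^sub>E H A))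
       = (\<integral>\<^sup>+\<omega>. (\<Prod>j\<in>J. r j (\<omega> j)) * indicator (prod_emb I K H (Pi\<^sub>E H A)) \<omega> \<partial>PiM I K)"
      unfolding emb using H by (intro emeasure_density meas_r sets_PiM_I) auto
    also have "\<dots> = (\<integral>\<^sup>+\<omega>. (\<Prod>j\<in>J\<union>H. h j (\<omega> j)) \<partial>PiM I K)"
    proof (intro nn_integral_cong)
      fix \<omega> assume \<omega>: "\<omega> \<in> space (PiM I K)"
      have "indicator (prod_emb I K H (Pi\<^sub>E H A)) \<omega> = (\<Prod>j\<in>H. indicator (A j) (\<omega> j) :: ennreal)"
        using \<omega> H by (auto simp: indicator_def prod_emb_iff space_PiM PiE_iff intro!: prod.neutral[symmetric])
      also have "\<dots> = (\<Prod>j\<in>J\<union>H. if j \<in> H then indicator (A j) (\<omega> j) else 1)"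
        using H J by (intro prod.mono_neutral_cong_left) auto
      finally have 1: "indicator (prod_emb I K H (Pi\<^sub>E H A)) \<omega> = (\<Prod>j\<in>J\<union>H. if j \<in> H then indicator (A j) (\<omega> j) else 1 :: ennreal)" .
      have 2: "(\<Prod>j\<in>J. r j (\<omega> j)) = (\<Prod>j\<in>J\<union>H. if j \<in> J then r j (\<omega> j) else 1)"
        using H J by (intro prod.mono_neutral_cong_left) auto
      show "(\<Prod>j\<in>J. r j (\<omega> j)) * indicator (prod_emb I K H (Pi\<^sub>E H A)) \<omega> = (\<Prod>j\<in>J\<union>H. h j (\<omega> j))"
        unfolding 1 2 h_def by (rule prod.distrib[symmetric])
    qed
    also have "\<dots> = (\<Prod>j\<in>J\<union>H. \<integral>\<^sup>+x. h j x \<partial>K j)"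
      using J H K by (intro nn_integral_PiM_prod h_meas) auto
    also have "\<dots> = (\<Prod>j\<in>J\<union>H. emeasure (K' j) (if j \<in> H then A j else space (K' j)))"
    proof (intro prod.cong refl)
      fix j assume j: "j \<in> J \<union> H"
      then have jI: "j \<in> I" using J H by auto
      interpret Kj: prob_space "K j" by (rule K)
      interpret K'j: prob_space "K' j" by (rule K')
      show "(\<integral>\<^sup>+x. h j x \<partial>K j) = emeasure (K' j) (if j \<in> H then A j else space (K' j))"
      proof (cases "j \<in> J")
        case True
        have "(\<integral>\<^sup>+x. r j x \<partial>K j) = 1" 
          using prob_space.emeasure_space_1[OF K', of j] eqJ[OF True] r[OF True]
          by (simp add: emeasure_density)
        then show ?thesis
          using True eqJ[OF True] r[OF True] prob_space.emeasure_space_1[OF K', of j] by (simp add: h_def emeasure_density)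
      next
        case False
        then show ?thesis using j eqI[of j] jI by (simp add: h_def)
      qed
    qed
    also have "\<dots> = (\<Prod>j\<in>H. emeasure (K' j) (A j))"
      using H J prob_space.emeasure_space_1[OF K'] by (intro prod.mono_neutral_cong_right) auto
    finally show "emeasure (density (PiM I K) (\<lambda>\<omega>. \<Prod>j\<in>J. r j (\<omega> j))) (prod_emb I K' H (Pi\<^sub>E H A)) = \<dots>" .
  qed
qed

text \<open>Cross terms vanish because each variable is independent of the partial sum of the others
  and has mean zero. Integrability of that sum is carried through the induction since the product
  rule for expectations needs it.\<close>

lemma (in prob_space) second_moment_sum_indep:
  fixes X :: "'i \<Rightarrow> 'a \<Rightarrow> real"
  assumes "finite J" "indep_vars (\<lambda>_. borel) X J"
    and "\<And>j. j \<in> J \<Longrightarrow> integrable M (\<lambda>\<omega>. (X j \<omega>)\<^sup>2)" "\<And>j. j \<in> J \<Longrightarrow> expectation (X j) = 0"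
  shows "integrable M (\<lambda>\<omega>. (\<Sum>j\<in>J. X j \<omega>)\<^sup>2) \<and> integrable M (\<lambda>\<omega>. \<Sum>j\<in>J. X j \<omega>) \<and>
    expectation (\<lambda>\<omega>. (\<Sum>j\<in>J. X j \<omega>)\<^sup>2) = (\<Sum>j\<in>J. expectation (\<lambda>\<omega>. (X j \<omega>)\<^sup>2))"
  using assms
proof (induction J rule: finite_induct)
  case (insert i J)
  have ind: "indep_vars (\<lambda>_. borel) X J" using insert.prems(1) by (rule indep_vars_subset) auto
  have IH: "integrable M (\<lambda>\<omega>. (\<Sum>j\<in>J. X j \<omega>)\<^sup>2)" "integrable M (\<lambda>\<omega>. \<Sum>j\<in>J. X j \<omega>)"
    "expectation (\<lambda>\<omega>. (\<Sum>j\<in>J. X j \<omega>)\<^sup>2) = (\<Sum>j\<in>J. expectation (\<lambda>\<omega>. (X j \<omega>)\<^sup>2))"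
    using insert.IH[OF ind] insert.prems by auto
  have rv: "random_variable borel (X i)" using insert.prems(1) by (auto simp: indep_vars_def)
  have Xi: "integrable M (X i)" "integrable M (\<lambda>\<omega>. (X i \<omega>)\<^sup>2)"
    using square_integrable_imp_integrable[OF rv] insert.prems(2)[of i] by auto
  have iv: "indep_var borel (X i) borel (\<lambda>\<omega>. \<Sum>j\<in>J. X j \<omega>)"
    using insert by (intro indep_vars_sum) auto
  have cross: "integrable M (\<lambda>\<omega>. X i \<omega> * (\<Sum>j\<in>J. X j \<omega>))"
    "expectation (\<lambda>\<omega>. X i \<omega> * (\<Sum>j\<in>J. X j \<omega>)) = 0"
    using indep_var_integrable[OF iv Xi(1) IH(2)] indep_var_lebesgue_integral[OF iv Xi(1) IH(2)]
      insert.prems(3)[of i] by auto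
  have eq: "(\<lambda>\<omega>. (\<Sum>j\<in>insert i J. X j \<omega>)\<^sup>2) =
     (\<lambda>\<omega>. (X i \<omega>)\<^sup>2 + 2 * (X i \<omega> * (\<Sum>j\<in>J. X j \<omega>)) + (\<Sum>j\<in>J. X j \<omega>)\<^sup>2)"
    using insert.hyps by (auto simp: power2_sum fun_eq_iff algebra_simps)
  show ?case unfolding eq using Xi cross IH insert.hyps by simp
qed simp

text \<open>Chebyshev's inequality for centred independent terms that need not be identically
  distributed: a moving anomaly changes the law from one time to the next, so only the bound
  \<open>V\<close> is shared.\<close>

lemma prob_PiM_sum_ge:
  assumes K: "\<And>i. prob_space (K i)" and J: "finite J" "J \<subseteq> I" "J \<noteq> {}" and s: "0 < s"
    and Y: "\<And>j. j \<in> J \<Longrightarrow> Y j \<in> borel_measurable (K j)"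
    and sq: "\<And>j. j \<in> J \<Longrightarrow> integrable (K j) (\<lambda>x. (Y j x)\<^sup>2)"
    and V: "\<And>j. j \<in> J \<Longrightarrow> (\<integral>x. (Y j x)\<^sup>2 \<partial>K j) \<le> V"
    and mean: "\<And>j. j \<in> J \<Longrightarrow> (\<integral>x. Y j x \<partial>K j) = 0"
  shows "measure (PiM I K) {\<omega>\<in>space (PiM I K). s \<le> \<bar>\<Sum>j\<in>J. Y j (\<omega> j)\<bar>} \<le> real (card J) * V / s\<^sup>2"
proof -
  interpret product_prob_space K I
    using K by (simp add: product_prob_space_def product_prob_space_axioms_def product_sigma_finite_def prob_space_imp_sigma_finite)
  let ?X = "\<lambda>j \<omega>. Y j (\<omega> j)"
  have ind0: "indep_vars K (\<lambda>i \<omega>. \<omega> i) J"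
    by (rule P.indep_vars_subset[OF indep_vars_PiM_coordinates J(2)]) (use K J in auto)
  have ind: "indep_vars (\<lambda>_. borel) ?X J"
    by (rule indep_vars_compose2[OF ind0]) (use Y in auto)
  have rv: "?X j \<in> borel_measurable (PiM I K)" if "j \<in> J" for j
    using that J Y by (auto intro!: measurable_PiM_component_rev)
  have int: "(\<integral>\<omega>. F (\<omega> j) \<partial>PiM I K) = (\<integral>x. F x \<partial>K j)" 
      "integrable (PiM I K) (\<lambda>\<omega>. F (\<omega> j)) = integrable (K j) F"
    if "j \<in> J" "F \<in> borel_measurable (K j)" for j and F :: "'b \<Rightarrow> real"
  proof -
    have j: "j \<in> I" using that J by auto
    have F: "F \<in> borel_measurable (K j)" "(\<lambda>\<omega>. \<omega> j) \<in> measurable (PiM I K) (K j)"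
      using that j by auto
    show "(\<integral>\<omega>. F (\<omega> j) \<partial>PiM I K) = (\<integral>x. F x \<partial>K j)"
      using integral_distr[OF F(2,1)] by (simp only: PiM_component[OF j])
    show "integrable (PiM I K) (\<lambda>\<omega>. F (\<omega> j)) = integrable (K j) F"
      using integrable_distr_eq[OF F(2,1)] by (simp only: PiM_component[OF j])
  qed
  have mom: "integrable (PiM I K) (\<lambda>\<omega>. (\<Sum>j\<in>J. ?X j \<omega>)\<^sup>2) \<and> integrable (PiM I K) (\<lambda>\<omega>. \<Sum>j\<in>J. ?X j \<omega>) \<and>
    expectation (\<lambda>\<omega>. (\<Sum>j\<in>J. ?X j \<omega>)\<^sup>2) = (\<Sum>j\<in>J. expectation (\<lambda>\<omega>. (?X j \<omega>)\<^sup>2))"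
    by (rule second_moment_sum_indep[OF J(1) ind]) (use int[of _ "\<lambda>x. (Y _ x)\<^sup>2"] int[of _ "Y _"] sq mean Y in auto)
  have zero: "expectation (\<lambda>\<omega>. \<Sum>j\<in>J. ?X j \<omega>) = 0"
    using mean int(1)[of _ "Y _"] Y int(2)[of _ "Y _"] 
    by (subst Bochner_Integration.integral_sum)
      (auto intro!: finite_measure.square_integrable_imp_integrable[OF prob_space.finite_measure[OF K]] sq sum.neutral)
  have "prob {\<omega>\<in>space (PiM I K). s \<le> \<bar>(\<Sum>j\<in>J. ?X j \<omega>) - expectation (\<lambda>\<omega>. \<Sum>j\<in>J. ?X j \<omega>)\<bar>}
      \<le> expectation (\<lambda>\<omega>. ((\<Sum>j\<in>J. ?X j \<omega>) - expectation (\<lambda>\<omega>. \<Sum>j\<in>J. ?X j \<omega>))\<^sup>2) / s\<^sup>2"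
    using mom s rv by (intro Chebyshev_inequality) auto
  then have "prob {\<omega>\<in>space (PiM I K). s \<le> \<bar>\<Sum>j\<in>J. ?X j \<omega>\<bar>} \<le> (\<Sum>j\<in>J. expectation (\<lambda>\<omega>. (?X j \<omega>)\<^sup>2)) / s\<^sup>2"
    using mom by (simp add: zero)
  also have "\<dots> \<le> real (card J) * V / s\<^sup>2"
    using V int(1)[of _ "\<lambda>x. (Y _ x)\<^sup>2"] Y by (intro divide_right_mono sum_bounded_above) auto
  finally show ?thesis .
qed

section \<open>The observation filtration\<close>

lemma space_obs_filtration: "space (obs_filtration L k) = seq_space L"
  unfolding obs_filtration_def by (rule space_measure_of) auto

lemma sets_obs_filtration:
  "sets (obs_filtration L k) = sigma_sets (seq_space L)
     {{\<omega> \<in> seq_space L. \<omega> j \<in> A} |j A. 1 \<le> j \<and> enat j \<le> k \<and> A \<in> sets (obs_space L)}"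
  unfolding obs_filtration_def by (rule sets_measure_of) auto

lemma obs_filtration_mono: "k \<le> l \<Longrightarrow> sets (obs_filtration L k) \<subseteq> sets (obs_filtration L l)"
  unfolding sets_obs_filtration by (intro sigma_sets_mono') (auto intro: order_trans)

lemma measurable_obs_filtration:
  assumes "1 \<le> j" "enat j \<le> k"
  shows "(\<lambda>\<omega>. \<omega> j) \<in> measurable (obs_filtration L k) (obs_space L)"
proof (rule measurableI)
  fix \<omega> assume "\<omega> \<in> space (obs_filtration L k)"
  then show "\<omega> j \<in> space (obs_space L)"
    using assms by (auto simp: space_obs_filtration seq_space_def space_PiM PiE_iff)
next
  fix A assume "A \<in> sets (obs_space L)"
  moreover have "(\<lambda>\<omega>. \<omega> j) -` A \<inter> space (obs_filtration L k) = {\<omega> \<in> seq_space L. \<omega> j \<in> A}"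
    by (auto simp: space_obs_filtration)
  ultimately show "(\<lambda>\<omega>. \<omega> j) -` A \<inter> space (obs_filtration L k) \<in> sets (obs_filtration L k)"
    unfolding sets_obs_filtration using assms by (auto intro!: sigma_sets.Basic)
qed

lemma obs_filtration_le_PiM: "sets (obs_filtration L k) \<subseteq> sets (\<Pi>\<^sub>M j\<in>{1..}. obs_space L)"
  unfolding sets_obs_filtration seq_space_def
  by (intro sets.sigma_sets_subset) (auto intro!: sets_Collect_single)

text \<open>Preimages under restriction to \<open>{1..n}\<close> form a sigma-algebra containing the
  generators. This moves past events to a finite product, where measures and independence can be
  computed.\<close>

lemma obs_filtration_cylinder:
  assumes "A \<in> sets (obs_filtration L (enat n))"
  obtains C where "C \<in> sets (\<Pi>\<^sub>M j\<in>{1..n}. obs_space L)"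
    "A = {\<omega> \<in> seq_space L. restrict \<omega> {1..n} \<in> C}"
proof -
  let ?M = "\<Pi>\<^sub>M j\<in>{1..n}. obs_space L"
  let ?V = "vimage_algebra (seq_space L) (\<lambda>\<omega>. restrict \<omega> {1..n}) ?M"
  have map: "(\<lambda>\<omega>. restrict \<omega> {1..n}) \<in> seq_space L \<rightarrow> space ?M"
    by (auto simp: seq_space_def space_PiM PiE_iff)
  have "sets (obs_filtration L (enat n)) \<subseteq> sets ?V"
  proof -
    have "{\<omega> \<in> seq_space L. \<omega> j \<in> A} \<in> sets ?V"
      if j: "1 \<le> j" "j \<le> n" and A: "A \<in> sets (obs_space L)" for j A
    proof -
      have "{x\<in>space ?M. x j \<in> A} \<in> sets ?M"
        using that by (intro sets_Collect_single) auto
      moreover have "{\<omega> \<in> seq_space L. \<omega> j \<in> A} = (\<lambda>\<omega>. restrict \<omega> {1..n}) -` {x\<in>space ?M. x j \<in> A} \<inter> seq_space L"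
        using j map by auto
      ultimately show ?thesis unfolding sets_vimage_algebra2[OF map] by blast
    qed
    then have "sigma_sets (space ?V)
     {{\<omega> \<in> seq_space L. \<omega> j \<in> A} |j A. 1 \<le> j \<and> enat j \<le> enat n \<and> A \<in> sets (obs_space L)} \<subseteq> sets ?V"
      by (intro sets.sigma_sets_subset) auto
    then show ?thesis by (simp add: sets_obs_filtration)
  qed
  with assms obtain C where "C \<in> sets ?M" "A = (\<lambda>\<omega>. restrict \<omega> {1..n}) -` C \<inter> seq_space L"
    unfolding sets_vimage_algebra2[OF map] by blast
  then show thesis by (intro that[of C]) auto
qed

text \<open>One arbitrary marginal law per time, so that \<open>P_infty\<close>,
  \<open>P_change\<close> and the i.i.d. post-change measure \<open>Pq\<close> are all
  instances.\<close>

locale obs_process =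
  fixes L :: nat and K :: "nat \<Rightarrow> (nat \<Rightarrow> real) measure"
  assumes prob_space_K: "prob_space (K j)" and sets_K: "sets (K j) = sets (obs_space L)"
begin

abbreviation "P \<equiv> PiM {1..} K"

lemma product_prob: "product_prob_space K"
  using prob_space_K by (simp add: product_prob_space_def product_prob_space_axioms_def
    product_sigma_finite_def prob_space_imp_sigma_finite)

sublocale product_prob_space K "{1..}"
  by (rule product_prob)

lemma sets_P: "sets P = sets (\<Pi>\<^sub>M j\<in>{1..}. obs_space L)"
  by (intro sets_PiM_cong sets_K refl)

lemma space_P: "space P = seq_space L"
  using sets_eq_imp_space_eq[OF sets_P] by (simp add: seq_space_def)

lemma filtration_sets_P: "A \<in> sets (obs_filtration L k) \<Longrightarrow> A \<in> sets P"
  using obs_filtration_le_PiM sets_P by blast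

lemma sets_PiM_K: "sets (PiM J K) = sets (\<Pi>\<^sub>M j\<in>J. obs_space L)"
  by (intro sets_PiM_cong sets_K refl)

text \<open>Past events involve finitely many marginals only, so the laws at later times may be
  altered freely.\<close>

lemma emeasure_filtration_cong:
  assumes K': "obs_process L K'" and eq: "\<And>j. 1 \<le> j \<Longrightarrow> j \<le> n \<Longrightarrow> K' j = K j"
    and A: "A \<in> sets (obs_filtration L (enat n))"
  shows "emeasure (PiM {1..} K') A = emeasure P A"
proof -
  interpret K': obs_process L K' by fact
  obtain C where C: "C \<in> sets (\<Pi>\<^sub>M j\<in>{1..n}. obs_space L)"
    "A = {\<omega> \<in> seq_space L. restrict \<omega> {1..n} \<in> C}"
    by (rule obs_filtration_cylinder[OF A])
  have "emeasure P A = emeasure (PiM {1..n} K) C"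
    using emeasure_PiM_emb'[of "{1..n}" C] C
    by (simp add: sets_PiM_K prod_emb_def space_P[symmetric] space_PiM Collect_conj_eq Int_commute vimage_def)
  moreover have "emeasure (PiM {1..} K') A = emeasure (PiM {1..n} K') C"
    using K'.emeasure_PiM_emb'[of "{1..n}" C] C
    by (simp add: K'.sets_PiM_K prod_emb_def K'.space_P[symmetric] space_PiM Collect_conj_eq Int_commute vimage_def)
  moreover have "PiM {1..n} K' = PiM {1..n} K"
    using eq by (intro PiM_cong) auto
  ultimately show ?thesis by simp
qed

lemma prob_filtration_indep:
  assumes A: "A \<in> sets (obs_filtration L (enat n))" and J: "J \<subseteq> {n<..}"
    and B: "B \<in> sets (PiM J K)"
  shows "prob (A \<inter> {\<omega>\<in>space P. restrict \<omega> J \<in> B}) = prob A * prob {\<omega>\<in>space P. restrict \<omega> J \<in> B}"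
proof -
  obtain C where C: "C \<in> sets (\<Pi>\<^sub>M j\<in>{1..n}. obs_space L)"
    "A = {\<omega> \<in> seq_space L. restrict \<omega> {1..n} \<in> C}"
    by (rule obs_filtration_cylinder[OF A])
  have "indep_vars K (\<lambda>i \<omega>. \<omega> i) {1..}"
    by (rule indep_vars_PiM_coordinates[OF prob_space_K]) auto
  then have ind: "indep_var (PiM {1..n} K) (\<lambda>\<omega>. restrict (\<lambda>i. \<omega> i) {1..n}) (PiM J K) (\<lambda>\<omega>. restrict (\<lambda>i. \<omega> i) J)"
    using J by (intro indep_var_restrict[where I = "{1..}"]) auto
  have "C \<in> sets (PiM {1..n} K)" using C(1) by (simp add: sets_PiM_K)
  from indep_varD[OF ind this B]
  have "prob ((\<lambda>\<omega>. (restrict \<omega> {1..n}, restrict \<omega> J)) -` (C \<times> B) \<inter> space P) =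
    prob ((\<lambda>\<omega>. restrict \<omega> {1..n}) -` C \<inter> space P) * prob ((\<lambda>\<omega>. restrict \<omega> J) -` B \<inter> space P)"
    by simp
  also have "(\<lambda>\<omega>. restrict \<omega> {1..n}) -` C \<inter> space P = A"
    by (auto simp: C(2) simp flip: space_P)
  also have "(\<lambda>\<omega>. restrict \<omega> J) -` B \<inter> space P = {\<omega>\<in>space P. restrict \<omega> J \<in> B}"
    by auto
  also have "(\<lambda>\<omega>. (restrict \<omega> {1..n}, restrict \<omega> J)) -` (C \<times> B) \<inter> space P = A \<inter> {\<omega>\<in>space P. restrict \<omega> J \<in> B}"
    by (auto simp: C(2) simp flip: space_P)
  finally show ?thesis .
qed

text \<open>The factor \<open>prob A\<close> is the point: the Chebyshev bound holds given any past
  event \<open>A\<close>, which lets block failures multiply and makes the delay bound uniform in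
  the past.\<close>

lemma prob_block_deviation:
  assumes A: "A \<in> sets (obs_filtration L (enat n))" and J: "finite J" "J \<noteq> {}" "J \<subseteq> {n<..}" and s: "0 < s"
    and Y: "\<And>j. j \<in> J \<Longrightarrow> Y j \<in> borel_measurable (obs_space L)"
    and sq: "\<And>j. j \<in> J \<Longrightarrow> integrable (K j) (\<lambda>x. (Y j x)\<^sup>2)"
    and V: "\<And>j. j \<in> J \<Longrightarrow> (\<integral>x. (Y j x)\<^sup>2 \<partial>K j) \<le> V"
    and mean: "\<And>j. j \<in> J \<Longrightarrow> (\<integral>x. Y j x \<partial>K j) = 0"
  shows "prob (A \<inter> {\<omega>\<in>space P. s \<le> \<bar>\<Sum>j\<in>J. Y j (\<omega> j)\<bar>}) \<le> prob A * (real (card J) * V / s\<^sup>2)"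
proof -
  let ?B = "{x\<in>space (PiM J K). s \<le> \<bar>\<Sum>j\<in>J. Y j (x j)\<bar>}"
  have YK: "Y j \<in> borel_measurable (K j)" if "j \<in> J" for j
    using Y[OF that] sets_K by (simp cong: measurable_cong_sets)
  have [measurable]: "(\<lambda>x. Y j (x j)) \<in> borel_measurable (PiM J K)" if "j \<in> J" for j
    using that YK by (intro measurable_PiM_component_rev) auto
  have B: "?B \<in> sets (PiM J K)" by measurable
  have eq: "{\<omega>\<in>space P. restrict \<omega> J \<in> ?B} = {\<omega>\<in>space P. s \<le> \<bar>\<Sum>j\<in>J. Y j (\<omega> j)\<bar>}"
    using J by (auto simp: space_PiM PiE_iff subset_eq)
  have "prob (A \<inter> {\<omega>\<in>space P. s \<le> \<bar>\<Sum>j\<in>J. Y j (\<omega> j)\<bar>}) = prob A * prob {\<omega>\<in>space P. s \<le> \<bar>\<Sum>j\<in>J. Y j (\<omega> j)\<bar>}"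
    using prob_filtration_indep[OF A J(3) B] unfolding eq .
  also have "\<dots> \<le> prob A * (real (card J) * V / s\<^sup>2)"
    using J s YK sq V mean
    by (intro mult_left_mono prob_PiM_sum_ge) (auto simp: prob_space_K)
  finally show ?thesis .
qed

lemma emeasure_change_of_measure:
  assumes K': "obs_process L K'"
    and r: "\<And>j. \<nu> < j \<Longrightarrow> j \<le> n \<Longrightarrow> r j \<in> borel_measurable (obs_space L)"
    and dens: "\<And>j. \<nu> < j \<Longrightarrow> j \<le> n \<Longrightarrow> K' j = density (K j) (r j)"
    and eq: "\<And>j. 1 \<le> j \<Longrightarrow> j \<le> \<nu> \<Longrightarrow> K' j = K j"
    and A: "A \<in> sets (obs_filtration L (enat n))"
  shows "emeasure (PiM {1..} K') A = (\<integral>\<^sup>+\<omega>. (\<Prod>j\<in>{\<nu>+1..n}. r j (\<omega> j)) * indicator A \<omega> \<partial>P)"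
proof -
  interpret K': obs_process L K' by fact
  \<comment> \<open>Hybrid process with the new laws on the window only: finitely many marginals are
    altered, so a density exists, and \<open>A\<close> cannot tell it from
    \<open>K'\<close>.\<close>
  let ?K = "\<lambda>j. if \<nu> < j \<and> j \<le> n then K' j else K j"
  have meas: "r j \<in> borel_measurable (K j)" if "j \<in> {\<nu>+1..n}" for j
    using r[of j] that sets_K by (simp cong: measurable_cong_sets)
  have K: "obs_process L ?K"
    using prob_space_K K'.prob_space_K sets_K K'.sets_K by (simp add: obs_process_def)
  have "density P (\<lambda>\<omega>. \<Prod>j\<in>{\<nu>+1..n}. r j (\<omega> j)) = PiM {1..} ?K"
  proof (rule density_PiM_finite)
    show "prob_space (?K j)" for j using K by (simp only: obs_process_def)
  qed (use prob_space_K meas dens in auto)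
  moreover have "emeasure (PiM {1..} ?K) A = emeasure (PiM {1..} K') A"
    by (rule K'.emeasure_filtration_cong[OF K _ A]) (use eq in auto)
  moreover have "(\<lambda>\<omega>. \<Prod>j\<in>{\<nu>+1..n}. r j (\<omega> j)) \<in> borel_measurable P"
    using meas by (intro borel_measurable_prod_ennreal measurable_PiM_component_rev) auto
  ultimately show ?thesis
    using filtration_sets_P[OF A] by (metis emeasure_density)
qed

end

section \<open>Kullback-Leibler numbers\<close>

text \<open>Finiteness from above bounds the positive part, so \<open>p\<close> cannot charge the
  zeros of \<open>g\<close>. The negative part is at most the mass of \<open>g\<close>, because
  \<open>- p ln (p/g) \<le> g\<close> pointwise off a null set.\<close>

lemma ext_expectation_log_ratio:
  fixes p g :: "'a \<Rightarrow> real"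
  assumes [measurable]: "p \<in> borel_measurable M" "g \<in> borel_measurable M"
    and nn: "\<And>x. 0 \<le> p x" "\<And>x. 0 \<le> g x"
    and g1: "(\<integral>\<^sup>+x. ennreal (g x) \<partial>M) < \<infinity>"
    and fin: "ext_expectation (density M (\<lambda>x. ennreal (p x))) (\<lambda>x. log_ratio (p x) (g x)) < \<infinity>"
  shows "AE x in M. g x = 0 \<longrightarrow> p x = 0"
    and "integrable M (\<lambda>x. p x * ln (p x / g x))"
    and "ext_expectation (density M (\<lambda>x. ennreal (p x))) (\<lambda>x. log_ratio (p x) (g x))
      = ereal (\<integral>x. p x * ln (p x / g x) \<partial>M)"
proof -
  let ?lr = "\<lambda>x. log_ratio (p x) (g x)"
  have [measurable]: "?lr \<in> borel_measurable M"
    unfolding log_ratio_def[abs_def] by measurable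
  have d1: "(\<integral>\<^sup>+x. e2ennreal (?lr x) \<partial>density M (\<lambda>x. ennreal (p x))) = (\<integral>\<^sup>+x. ennreal (p x) * e2ennreal (?lr x) \<partial>M)"
    by (subst nn_integral_density) auto
  have d2: "(\<integral>\<^sup>+x. e2ennreal (- ?lr x) \<partial>density M (\<lambda>x. ennreal (p x))) = (\<integral>\<^sup>+x. ennreal (p x) * e2ennreal (- ?lr x) \<partial>M)"
    by (subst nn_integral_density) auto
  have pos: "(\<integral>\<^sup>+x. ennreal (p x) * e2ennreal (?lr x) \<partial>M) \<noteq> \<infinity>"
  proof
    assume inf: "(\<integral>\<^sup>+x. ennreal (p x) * e2ennreal (?lr x) \<partial>M) = \<infinity>"
    \<comment> \<open>In \<open>ereal\<close>, infinity minus anything, infinity included, is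
      infinity; hence the contradiction is available before the negative part is known to be
      finite.\<close>
    show False using fin unfolding ext_expectation_def d1 inf
      by (simp add: minus_ereal_def)
  qed
  have "AE x in M. ennreal (p x) * e2ennreal (?lr x) \<noteq> \<infinity>"
    using pos by (intro nn_integral_PInf_AE) auto
  then show ac: "AE x in M. g x = 0 \<longrightarrow> p x = 0"
    by eventually_elim (use nn in \<open>auto simp: log_ratio_def ennreal_mult_top split: if_splits\<close>)
  have sgn: "ennreal a * ennreal (- y) = ennreal (- (a * y))" if "0 \<le> a" for a y :: real
    using ennreal_mult'[OF that, of "- y"] by simp
  have lr: "p x = 0 \<or> ?lr x = ereal (ln (p x / g x))" if "g x = 0 \<longrightarrow> p x = 0" for x
    using that by (auto simp: log_ratio_def)
  have e1: "AE x in M. ennreal (p x) * e2ennreal (?lr x) = ennreal (p x * ln (p x / g x))"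
    using ac
  proof eventually_elim
    case (elim x)
    then show ?case using lr[OF elim] ennreal_mult'[OF nn(1), of x "ln (p x / g x)"] by (auto simp: ennreal.abs_eq)
  qed
  have e2: "AE x in M. ennreal (p x) * e2ennreal (- ?lr x) = ennreal (- (p x * ln (p x / g x)))"
    using ac
  proof eventually_elim
    case (elim x)
    then show ?case using lr[OF elim] sgn[OF nn(1), of x "ln (p x / g x)"] by (auto simp: ennreal.abs_eq)
  qed
  have "- (p x * ln (p x / g x)) \<le> g x" if "g x = 0 \<longrightarrow> p x = 0" for x
  proof (cases "p x = 0")
    case False
    with that nn[of x] have *: "p x > 0" "g x > 0" by (auto simp: less_le)
    have "- (p x * ln (p x / g x)) = p x * ln (g x / p x)"
      using * by (simp add: ln_div algebra_simps)
    also have "\<dots> \<le> p x * (g x / p x - 1)"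
      using * by (intro mult_left_mono ln_le_minus_one) auto
    also have "\<dots> \<le> g x" using * by (simp add: field_simps)
    finally show ?thesis .
  qed (use nn in auto)
  then have "AE x in M. ennreal (- (p x * ln (p x / g x))) \<le> ennreal (g x)"
    using ac by (auto intro: ennreal_leI elim!: eventually_mono)
  then have "(\<integral>\<^sup>+x. ennreal (- (p x * ln (p x / g x))) \<partial>M) \<le> (\<integral>\<^sup>+x. ennreal (g x) \<partial>M)"
    by (rule nn_integral_mono_AE)
  then have neg: "(\<integral>\<^sup>+x. ennreal (- (p x * ln (p x / g x))) \<partial>M) \<noteq> \<infinity>"
    using g1 by auto
  have i1: "(\<integral>\<^sup>+x. ennreal (p x) * e2ennreal (?lr x) \<partial>M) = (\<integral>\<^sup>+x. ennreal (p x * ln (p x / g x)) \<partial>M)"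
    by (rule nn_integral_cong_AE[OF e1])
  have i2: "(\<integral>\<^sup>+x. ennreal (p x) * e2ennreal (- ?lr x) \<partial>M) = (\<integral>\<^sup>+x. ennreal (- (p x * ln (p x / g x))) \<partial>M)"
    by (rule nn_integral_cong_AE[OF e2])
  show int: "integrable M (\<lambda>x. p x * ln (p x / g x))"
    unfolding real_integrable_def using pos neg by (auto simp: i1)
  show "ext_expectation (density M (\<lambda>x. ennreal (p x))) ?lr = ereal (\<integral>x. p x * ln (p x / g x) \<partial>M)"
    unfolding ext_expectation_def d1 d2 i1 i2 real_lebesgue_integral_def[OF int]
    using pos neg unfolding i1
    by (cases "\<integral>\<^sup>+x. ennreal (p x * ln (p x / g x)) \<partial>M"; cases "\<integral>\<^sup>+x. ennreal (- (p x * ln (p x / g x))) \<partial>M") (auto simp: enn2ereal_ennreal)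
qed

text \<open>Strict Gibbs inequality. Since the masses agree, subtracting \<open>p - g\<close> leaves
  the integral unchanged but makes the integrand nonnegative almost everywhere, with zeros only
  where \<open>p = g\<close>, by \<open>ln z \<le> z - 1\<close> and its equality case.\<close>

lemma KL_integral_pos:
  fixes p g :: "'a \<Rightarrow> real"
  assumes nn: "\<And>x. 0 \<le> p x" "\<And>x. 0 \<le> g x"
    and int: "integrable M p" "integrable M g" "integrable M (\<lambda>x. p x * ln (p x / g x))"
    and eq: "(\<integral>x. p x \<partial>M) = (\<integral>x. g x \<partial>M)"
    and ac: "AE x in M. g x = 0 \<longrightarrow> p x = 0"
    and ne: "\<not> (AE x in M. p x = g x)"
  shows "0 < (\<integral>x. p x * ln (p x / g x) \<partial>M)"
proof -
  let ?h = "\<lambda>x. p x * ln (p x / g x) - (p x - g x)"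
  have h: "0 \<le> ?h x \<and> (?h x = 0 \<longrightarrow> p x = g x)" if "g x = 0 \<longrightarrow> p x = 0" for x
  proof (cases "p x = 0")
    case False
    with that nn[of x] have *: "p x > 0" "g x > 0" by (auto simp: less_le)
    have h: "?h x = p x * ((g x / p x - 1) - ln (g x / p x))"
      using * by (simp add: ln_div algebra_simps)
    have "ln (g x / p x) \<le> g x / p x - 1" using * by (intro ln_le_minus_one) auto
    moreover have "p x = g x" if "ln (g x / p x) = g x / p x - 1"
      using ln_eq_minus_one[OF _ that] * by simp
    ultimately show ?thesis unfolding h using * by (auto simp: zero_le_mult_iff)
  qed (use nn that in auto)
  have nnAE: "AE x in M. 0 \<le> ?h x" using ac by eventually_elim (use h in blast)
  have inth: "integrable M ?h" using int by auto
  have "(\<integral>x. ?h x \<partial>M) \<noteq> 0"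
  proof
    assume "(\<integral>x. ?h x \<partial>M) = 0"
    then have "AE x in M. ?h x = 0" using integral_nonneg_eq_0_iff_AE[OF inth nnAE] by simp
    then have "AE x in M. p x = g x" using ac by eventually_elim (use h in blast)
    with ne show False by simp
  qed
  moreover have "0 \<le> (\<integral>x. ?h x \<partial>M)" by (rule integral_nonneg_AE[OF nnAE])
  moreover have "(\<integral>x. ?h x \<partial>M) = (\<integral>x. p x * ln (p x / g x) \<partial>M)" using int eq by simp
  ultimately show ?thesis by linarith
qed

text \<open>Convexity of x ln x between 1, where it vanishes, and \<open>a\<close>: the bound
  \<open>ln y \<le> y - 1\<close>, applied at \<open>?x\<close> and at \<open>?x / a\<close>, leaves
  remainders that cancel.\<close>

lemma xlnx_mix_le:
  fixes a t :: real
  assumes "0 \<le> a" "0 < t" "t < 1"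
  shows "(1 - t + t * a) * ln (1 - t + t * a) \<le> t * (a * ln a)"
proof -
  let ?x = "1 - t + t * a"
  have x: "?x > 0" using assms by (intro add_pos_nonneg) auto
  have "ln ?x \<le> ?x - 1" using x by (rule ln_le_minus_one)
  then have 1: "(1 - t) * ln ?x \<le> (1 - t) * (t * (a - 1))"
    using assms by (intro mult_left_mono) (auto simp: algebra_simps)
  have 2: "t * (a * (ln ?x - ln a)) \<le> t * ((1 - t) * (1 - a))"
  proof (cases "a = 0")
    case False
    then have "a > 0" using assms by simp
    have "ln ?x - ln a = ln (?x / a)" using x \<open>a > 0\<close> by (simp add: ln_div)
    also have "\<dots> \<le> ?x / a - 1" using x \<open>a > 0\<close> by (intro ln_le_minus_one) auto
    finally have "a * (ln ?x - ln a) \<le> a * (?x / a - 1)" using \<open>a > 0\<close> by (intro mult_left_mono) auto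
    also have "\<dots> = (1 - t) * (1 - a)" using \<open>a > 0\<close> by (simp add: field_simps)
    finally show ?thesis using assms by (intro mult_left_mono) auto
  qed (use assms in auto)
  have "?x * ln ?x - t * (a * ln a) = (1 - t) * ln ?x + t * (a * (ln ?x - ln a))"
    by (simp add: algebra_simps)
  also have "\<dots> \<le> (1 - t) * (t * (a - 1)) + t * ((1 - t) * (1 - a))" using 1 2 by (rule add_mono)
  also have "\<dots> = 0" by (simp add: algebra_simps)
  finally show ?thesis by simp
qed

text \<open>The tangent line of x ln x at 1.\<close>

lemma xlnx_ge:
  fixes x :: real
  assumes "0 \<le> x"
  shows "x - 1 \<le> x * ln x"
proof (cases "x = 0")
  case False
  then have "x > 0" using assms by simp
  have "- ln x = ln (1 / x)" using \<open>x > 0\<close> by (simp add: ln_div)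
  also have "\<dots> \<le> 1 / x - 1" using \<open>x > 0\<close> by (intro ln_le_minus_one) auto
  finally have "x * (- ln x) \<le> x * (1 / x - 1)" using \<open>x > 0\<close> by (intro mult_left_mono) auto
  then show ?thesis using \<open>x > 0\<close> by (simp add: algebra_simps)
qed simp

text \<open>The derivative of x ln x at 1 is 1. The step sizes \<open>1 / (n + 2)\<close> stay
  strictly below 1, which keeps the argument of the logarithm positive even when
  \<open>a = 0\<close>.\<close>

lemma xlnx_quotient_tendsto:
  fixes a :: real
  assumes "0 \<le> a"
  shows "(\<lambda>n. (1 - 1 / real (n + 2) + 1 / real (n + 2) * a) * ln (1 - 1 / real (n + 2) + 1 / real (n + 2) * a) * real (n + 2))
     \<longlonglongrightarrow> a - 1"
proof -
  define t where "t n = 1 / real (n + 2)" for n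
  have t: "0 < t n" "t n < 1" for n by (auto simp: t_def)
  have t0: "t \<longlonglongrightarrow> 0" unfolding t_def
    by (rule LIMSEQ_ignore_initial_segment[OF lim_1_over_n])
  have lo: "a - 1 \<le> (1 - t n + t n * a) * ln (1 - t n + t n * a) / t n" for n
  proof -
    have "t n * (a - 1) \<le> (1 - t n + t n * a) * ln (1 - t n + t n * a)"
    proof -
      have "0 \<le> 1 - t n + t n * a" using t[of n] assms by (intro add_nonneg_nonneg) auto
      from xlnx_ge[OF this] show ?thesis by (simp add: right_diff_distrib)
    qed
    then show ?thesis using t[of n] by (simp add: pos_le_divide_eq mult.commute[of "t n"])
  qed
  have hi: "(1 - t n + t n * a) * ln (1 - t n + t n * a) / t n \<le> (1 - t n + t n * a) * (a - 1)" for n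
  proof -
    have x: "0 < 1 - t n + t n * a" using t[of n] assms by (intro add_pos_nonneg) auto
    have "(1 - t n + t n * a) * ln (1 - t n + t n * a) \<le> (1 - t n + t n * a) * (t n * (a - 1))"
      using x ln_le_minus_one[OF x] by (intro mult_left_mono) (auto simp: algebra_simps)
    then show ?thesis using t[of n] by (simp only: pos_divide_le_eq mult.assoc mult.commute[of "t n"])
  qed
  have "(\<lambda>n. (1 - t n + t n * a) * (a - 1)) \<longlonglongrightarrow> (1 - 0 + 0 * a) * (a - 1)"
    by (intro tendsto_intros t0)
  then have lim: "(\<lambda>n. (1 - t n + t n * a) * (a - 1)) \<longlonglongrightarrow> a - 1" by simp
  have "(\<lambda>n. (1 - t n + t n * a) * ln (1 - t n + t n * a) / t n) \<longlonglongrightarrow> a - 1"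
    by (rule real_tendsto_sandwich[OF always_eventually[OF allI[OF lo]] always_eventually[OF allI[OF hi]] tendsto_const lim])
  then show ?thesis by (simp add: t_def)
qed

text \<open>First-order optimality: the directional derivative at \<open>q\<close> of the Kullback-Leibler number towards
  \<open>p\<close> is \<open>\<integral>(p - q) ln (q/g)\<close>; the second-order term is the Kullback-Leibler number of the
  mixture relative to \<open>q\<close>, which is \<open>o(t)\<close> by dominated convergence.\<close>

lemma KL_directional_minimum:
  fixes p q g :: "'a \<Rightarrow> real"
  assumes nn: "\<And>x. 0 \<le> p x" "\<And>x. 0 \<le> q x" "\<And>x. 0 \<le> g x"
    and [measurable]: "g \<in> borel_measurable M"
    and int: "integrable M p" "integrable M q"
    and eq: "(\<integral>x. p x \<partial>M) = (\<integral>x. q x \<partial>M)"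
    and ac: "AE x in M. g x = 0 \<longrightarrow> q x = 0" "AE x in M. q x = 0 \<longrightarrow> p x = 0"
    and pp: "integrable M (\<lambda>x. p x * ln (p x / g x))"
    and qq: "integrable M (\<lambda>x. q x * ln (q x / g x))"
    and pq: "integrable M (\<lambda>x. p x * ln (q x / g x))"
    and mix: "\<And>t. 0 < t \<Longrightarrow> t < 1 \<Longrightarrow>
      integrable M (\<lambda>x. ((1 - t) * q x + t * p x) * ln (((1 - t) * q x + t * p x) / g x))"
    and min: "\<And>t. 0 < t \<Longrightarrow> t < 1 \<Longrightarrow>
      (\<integral>x. q x * ln (q x / g x) \<partial>M) \<le>
      (\<integral>x. ((1 - t) * q x + t * p x) * ln (((1 - t) * q x + t * p x) / g x) \<partial>M)"
  shows "(\<integral>x. q x * ln (q x / g x) \<partial>M) \<le> (\<integral>x. p x * ln (q x / g x) \<partial>M)"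
proof -
  have [measurable]: "p \<in> borel_measurable M" "q \<in> borel_measurable M" using int by auto
  define t where "t n = 1 / real (n + 2)" for n
  have t: "0 < t n" "t n < 1" for n by (auto simp: t_def)
  \<comment> \<open>What remains of the integrand for the mixture after removing its part that is
    affine in \<open>t n\<close>, divided by \<open>t n\<close>. It equals \<open>q\<close> times
    the quotient of x ln x along the segment from 1 to \<open>p / q\<close>.\<close>
  define F where "F n x = (((1 - t n) * q x + t n * p x) * ln (((1 - t n) * q x + t n * p x) / g x)
     - (1 - t n) * (q x * ln (q x / g x)) - t n * (p x * ln (q x / g x))) / t n" for n x
  have F: "F n x = q x * ((1 - t n + t n * (p x / q x)) * ln (1 - t n + t n * (p x / q x))) / t n"
    "F n x = 0 \<or> q x > 0 \<and> g x > 0" "q x = 0 \<longrightarrow> F n x = 0"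
    if "g x = 0 \<longrightarrow> q x = 0" "q x = 0 \<longrightarrow> p x = 0" for n x
  proof -
    show "F n x = q x * ((1 - t n + t n * (p x / q x)) * ln (1 - t n + t n * (p x / q x))) / t n"
    proof (cases "q x = 0")
      case False
      with that nn(2,3)[of x] have *: "q x > 0" "g x > 0" by (auto simp: less_le)
      let ?a = "p x / q x" and ?t = "t n"
      have a: "p x = q x * ?a" using * by simp
      have y: "0 < 1 - ?t + ?t * ?a" using t[of n] nn(1)[of x] * by (intro add_pos_nonneg) auto
      have e: "(1 - ?t) * q x + ?t * p x = q x * (1 - ?t + ?t * ?a)"
        using * by (simp add: field_simps)
      have l: "ln (q x * (1 - ?t + ?t * ?a) / g x) = ln (1 - ?t + ?t * ?a) + ln (q x / g x)"
        using y * by (simp add: ln_mult ln_div)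
      have "((1 - ?t) * q x + ?t * p x) * ln (((1 - ?t) * q x + ?t * p x) / g x)
        - (1 - ?t) * (q x * ln (q x / g x)) - ?t * (p x * ln (q x / g x))
        = q x * (1 - ?t + ?t * ?a) * (ln (1 - ?t + ?t * ?a) + ln (q x / g x))
          - ((1 - ?t) * q x + ?t * p x) * ln (q x / g x)"
        unfolding e l by (simp add: algebra_simps)
      also have "\<dots> = q x * (1 - ?t + ?t * ?a) * ln (1 - ?t + ?t * ?a)"
        unfolding e by (simp add: algebra_simps)
      finally show ?thesis unfolding F_def by (simp add: mult.assoc)
    qed (use that in \<open>auto simp: F_def\<close>)
    then show "F n x = 0 \<or> q x > 0 \<and> g x > 0" "q x = 0 \<longrightarrow> F n x = 0"
      using that nn(2,3)[of x] by (auto simp: less_le)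
  qed
  have lim: "(\<lambda>n. F n x) \<longlonglongrightarrow> p x - q x" if "g x = 0 \<longrightarrow> q x = 0" "q x = 0 \<longrightarrow> p x = 0" for x
  proof (cases "q x = 0")
    case True
    then show ?thesis using F[OF that] that by simp
  next
    case False
    have "(\<lambda>n. q x * ((1 - t n + t n * (p x / q x)) * ln (1 - t n + t n * (p x / q x)) * real (n + 2)))
       \<longlonglongrightarrow> q x * (p x / q x - 1)"
      unfolding t_def using nn by (intro tendsto_mult_left xlnx_quotient_tendsto) auto
    moreover have "F n x = q x * ((1 - t n + t n * (p x / q x)) * ln (1 - t n + t n * (p x / q x)) * real (n + 2))" for n
      unfolding F(1)[OF that] by (simp add: t_def)
    moreover have "q x * (p x / q x - 1) = p x - q x" using False by (simp add: field_simps)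
    ultimately show ?thesis by (simp only:)
  qed
  \<comment> \<open>An integrable bound uniform in \<open>n\<close>: from above, convexity gives
    \<open>p ln (p/q)\<close>, split through \<open>g\<close> into two integrable terms; from below,
    the tangent line gives \<open>p - q\<close>.\<close>
  have bound: "\<bar>F n x\<bar> \<le> \<bar>p x\<bar> + \<bar>q x\<bar> + \<bar>p x * ln (p x / g x)\<bar> + \<bar>p x * ln (q x / g x)\<bar>"
    if "g x = 0 \<longrightarrow> q x = 0" "q x = 0 \<longrightarrow> p x = 0" for n x
  proof (cases "q x = 0")
    case False
    with that nn(2,3)[of x] have *: "q x > 0" "g x > 0" by (auto simp: less_le)
    let ?a = "p x / q x" and ?t = "t n"
    have a0: "0 \<le> ?a" using nn * by auto
    have "(1 - ?t + ?t * ?a) * ln (1 - ?t + ?t * ?a) \<le> ?t * (?a * ln ?a)"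
      using t a0 by (intro xlnx_mix_le) auto
    then have "F n x \<le> q x * (?t * (?a * ln ?a)) / ?t"
      unfolding F(1)[OF that] using * t[of n] by (intro divide_right_mono mult_left_mono) auto
    also have "\<dots> = p x * ln ?a" using t[of n] * by simp
    also have "\<dots> = p x * ln (p x / g x) - p x * ln (q x / g x)"
      using * nn(1)[of x] by (cases "p x = 0") (auto simp: ln_div algebra_simps less_le)
    finally have up: "F n x \<le> p x * ln (p x / g x) - p x * ln (q x / g x)" .
    have "?t * (?a - 1) \<le> (1 - ?t + ?t * ?a) * ln (1 - ?t + ?t * ?a)"
    proof -
      have "0 \<le> 1 - ?t + ?t * ?a" using t[of n] a0 by (intro add_nonneg_nonneg mult_nonneg_nonneg) auto
      from xlnx_ge[OF this] show ?thesis by (simp add: right_diff_distrib)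
    qed
    then have "q x * (?t * (?a - 1)) / ?t \<le> F n x"
      unfolding F(1)[OF that] using * t[of n] by (intro divide_right_mono mult_left_mono) auto
    moreover have "q x * (?t * (?a - 1)) / ?t = p x - q x"
      using * t[of n] by (simp add: field_simps)
    ultimately show ?thesis using up nn[of x] by linarith
  qed (use F(3)[OF that] in auto)
  have "(\<lambda>n. \<integral>x. F n x \<partial>M) \<longlonglongrightarrow> (\<integral>x. p x - q x \<partial>M)"
  proof (rule integral_dominated_convergence)
    show "integrable M (\<lambda>x. \<bar>p x\<bar> + \<bar>q x\<bar> + \<bar>p x * ln (p x / g x)\<bar> + \<bar>p x * ln (q x / g x)\<bar>)"
      using int pp pq by auto
    show "AE x in M. (\<lambda>n. F n x) \<longlonglongrightarrow> p x - q x"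
      using ac by eventually_elim (rule lim)
    show "AE x in M. norm (F n x) \<le> \<bar>p x\<bar> + \<bar>q x\<bar> + \<bar>p x * ln (p x / g x)\<bar> + \<bar>p x * ln (q x / g x)\<bar>" for n
      using ac by eventually_elim (use bound in simp)
  qed (auto simp: F_def[abs_def])
  then have lim0: "(\<lambda>n. \<integral>x. F n x \<partial>M) \<longlonglongrightarrow> 0" using int eq by simp
  \<comment> \<open>Minimality bounds the difference of the two integrals by that of
    \<open>F n\<close> for every step size; the limit 0 then decides its sign.\<close>
  have "(\<integral>x. q x * ln (q x / g x) \<partial>M) - (\<integral>x. p x * ln (q x / g x) \<partial>M) \<le> (\<integral>x. F n x \<partial>M)" for n
  proof -
    have "(\<integral>x. F n x \<partial>M) = ((\<integral>x. ((1 - t n) * q x + t n * p x) * ln (((1 - t n) * q x + t n * p x) / g x) \<partial>M)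
      - (1 - t n) * (\<integral>x. q x * ln (q x / g x) \<partial>M) - t n * (\<integral>x. p x * ln (q x / g x) \<partial>M)) / t n"
      unfolding F_def using mix[OF t, of n] qq pq by simp
    also have "\<dots> \<ge> ((\<integral>x. q x * ln (q x / g x) \<partial>M)
      - (1 - t n) * (\<integral>x. q x * ln (q x / g x) \<partial>M) - t n * (\<integral>x. p x * ln (q x / g x) \<partial>M)) / t n"
      using t[of n] min[OF t, of n] by (intro divide_right_mono) auto
    also have "((\<integral>x. q x * ln (q x / g x) \<partial>M)
      - (1 - t n) * (\<integral>x. q x * ln (q x / g x) \<partial>M) - t n * (\<integral>x. p x * ln (q x / g x) \<partial>M)) / t n
      = (\<integral>x. q x * ln (q x / g x) \<partial>M) - (\<integral>x. p x * ln (q x / g x) \<partial>M)"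
      using t[of n] by (simp add: field_simps)
    finally show ?thesis .
  qed
  then have "(\<integral>x. q x * ln (q x / g x) \<partial>M) - (\<integral>x. p x * ln (q x / g x) \<partial>M) \<le> 0"
    using lim0 by (intro LIMSEQ_le_const) auto
  then show ?thesis by simp
qed

section \<open>Densities of the sensor network\<close>

locale sensor_network =
  fixes L m :: nat and g f :: "nat \<Rightarrow> real \<Rightarrow> real"
  assumes m_pos: "1 \<le> m" and m_le: "m \<le> L"
    and pdf_g: "\<And>l. l \<in> {1..L} \<Longrightarrow> pdf (g l)"
    and pdf_f: "\<And>l. l \<in> {1..L} \<Longrightarrow> pdf (f l)"
begin

abbreviation "\<E> \<equiv> anomaly_sets L m"
abbreviation "g0 \<equiv> g_joint L g"
abbreviation "pE \<equiv> p_anom L g f"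

lemma finite_anomaly_sets: "finite \<E>"
  by (rule finite_subset[of _ "Pow {1..L}"]) (auto simp: anomaly_sets_def)

lemma anomaly_sets_subset: "E \<in> \<E> \<Longrightarrow> E \<subseteq> {1..L}"
  by (auto simp: anomaly_sets_def)

lemma anomaly_sets_nonempty: "\<E> \<noteq> {}"
proof -
  have "{1..m} \<in> \<E>" using m_le by (auto simp: anomaly_sets_def)
  then show ?thesis by blast
qed

lemma p_anom_eq_prod: "E \<in> \<E> \<Longrightarrow> pE E x = (\<Prod>l\<in>{1..L}. (if l \<in> E then f l else g l) (x l))"
  using anomaly_sets_subset[of E] unfolding p_anom_def
  by (subst prod.subset_diff[of E "{1..L}"]) (auto simp: mult.commute intro!: arg_cong2[where f="(*)"] prod.cong)

text \<open>Stated for arbitrary marginals so that it serves \<open>g0\<close> and every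
  \<open>pE E\<close> alike. In the marginal formula the other factors integrate to 1.\<close>

lemma pdf_product:
  assumes h: "\<And>l. l \<in> {1..L} \<Longrightarrow> pdf (h l)"
  shows measurable_pdf_product: "(\<lambda>x. \<Prod>l\<in>{1..L}. h l (x l)) \<in> borel_measurable (obs_space L)"
    and pdf_product_nonneg: "0 \<le> (\<Prod>l\<in>{1..L}. h l (x l))"
    and nn_integral_pdf_product: "(\<integral>\<^sup>+x. ennreal (\<Prod>l\<in>{1..L}. h l (x l)) \<partial>obs_space L) = 1"
    and nn_integral_pdf_product_marginal: "l \<in> {1..L} \<Longrightarrow> B \<in> sets borel \<Longrightarrow>
      (\<integral>\<^sup>+x. ennreal (\<Prod>l\<in>{1..L}. h l (x l)) * indicator B (x l) \<partial>obs_space L) = (\<integral>\<^sup>+y. ennreal (h l y) * indicator B y \<partial>lborel)"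
proof -
  have hm: "h l \<in> borel_measurable borel" "\<And>x. 0 \<le> h l x" "(\<integral>\<^sup>+y. ennreal (h l y) \<partial>lborel) = 1"
    if "l \<in> {1..L}" for l using h[OF that] by (auto simp: pdf_def)
  have comp: "(\<lambda>x. x l) \<in> measurable (obs_space L) borel" if "l \<in> {1..L}" for l
    using that unfolding obs_space_def by (auto intro: measurable_PiM_component_rev)
  show "(\<lambda>x. \<Prod>l\<in>{1..L}. h l (x l)) \<in> borel_measurable (obs_space L)"
    by (intro borel_measurable_prod measurable_compose[OF comp hm(1)])
  show "0 \<le> (\<Prod>l\<in>{1..L}. h l (x l))" for x
    using hm(2) by (intro prod_nonneg) auto
  interpret product_sigma_finite "\<lambda>_::nat. lborel :: real measure" ..
  have gen: "(\<integral>\<^sup>+x. (\<Prod>l\<in>{1..L}. ennreal (h l (x l)) * k l (x l)) \<partial>obs_space L) = (\<Prod>l\<in>{1..L}. \<integral>\<^sup>+y. ennreal (h l y) * k l y \<partial>lborel)"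
    if "\<And>l. k l \<in> borel_measurable borel" for k :: "nat \<Rightarrow> real \<Rightarrow> ennreal"
    unfolding obs_space_def using hm(1) that by (intro product_nn_integral_prod) auto
  have e: "ennreal (\<Prod>l\<in>{1..L}. h l (x l)) = (\<Prod>l\<in>{1..L}. ennreal (h l (x l)))" for x
    using hm(2) by (intro prod_ennreal[symmetric]) auto
  show "(\<integral>\<^sup>+x. ennreal (\<Prod>l\<in>{1..L}. h l (x l)) \<partial>obs_space L) = 1"
    unfolding e using gen[of "\<lambda>_ _. 1"] hm(3) by simp
  assume l: "l \<in> {1..L}" and B: "B \<in> sets borel"
  define k where "k j y = (if j = l then indicator B y else 1 :: ennreal)" for j y
  have "(\<Prod>j\<in>{1..L}. ennreal (h j (x j))) * indicator B (x l) = (\<Prod>j\<in>{1..L}. ennreal (h j (x j)) * k j (x j))" for x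
    using l by (simp add: prod.distrib k_def prod.delta)
  then have "(\<integral>\<^sup>+x. ennreal (\<Prod>l\<in>{1..L}. h l (x l)) * indicator B (x l) \<partial>obs_space L) = (\<Prod>j\<in>{1..L}. \<integral>\<^sup>+y. ennreal (h j y) * k j y \<partial>lborel)"
    unfolding e using gen[of k] B by (simp add: k_def[abs_def])
  also have "\<dots> = (\<Prod>j\<in>{1..L}. if j = l then (\<integral>\<^sup>+y. ennreal (h l y) * indicator B y \<partial>lborel) else 1)"
    using hm(3) by (intro prod.cong) (auto simp: k_def)
  also have "\<dots> = (\<integral>\<^sup>+y. ennreal (h l y) * indicator B y \<partial>lborel)"
    using l by (simp add: prod.delta)
  finally show "(\<integral>\<^sup>+x. ennreal (\<Prod>l\<in>{1..L}. h l (x l)) * indicator B (x l) \<partial>obs_space L) = (\<integral>\<^sup>+y. ennreal (h l y) * indicator B y \<partial>lborel)" .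
qed

lemma pdf_anom: "E \<in> \<E> \<Longrightarrow> l \<in> {1..L} \<Longrightarrow> pdf (if l \<in> E then f l else g l)"
  using pdf_f pdf_g by auto

lemma g_joint_eq: "g0 = (\<lambda>x. \<Prod>l\<in>{1..L}. g l (x l))"
  by (simp add: g_joint_def[abs_def])

lemma p_anom_eq: "E \<in> \<E> \<Longrightarrow> pE E = (\<lambda>x. \<Prod>l\<in>{1..L}. (if l \<in> E then f l else g l) (x l))"
  using p_anom_eq_prod by auto

lemma measurable_g_joint[measurable]: "g0 \<in> borel_measurable (obs_space L)"
  unfolding g_joint_eq by (rule measurable_pdf_product[OF pdf_g])

lemma g_joint_nonneg: "0 \<le> g0 x"
  unfolding g_joint_eq by (rule pdf_product_nonneg[OF pdf_g])

lemma nn_integral_g_joint: "(\<integral>\<^sup>+x. ennreal (g0 x) \<partial>obs_space L) = 1"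
  unfolding g_joint_eq by (rule nn_integral_pdf_product[OF pdf_g])

lemma measurable_p_anom[measurable]: "E \<in> \<E> \<Longrightarrow> pE E \<in> borel_measurable (obs_space L)"
  by (simp only: p_anom_eq) (rule measurable_pdf_product[OF pdf_anom])

lemma p_anom_nonneg: "E \<in> \<E> \<Longrightarrow> 0 \<le> pE E x"
  by (simp only: p_anom_eq) (rule pdf_product_nonneg[OF pdf_anom])

lemma nn_integral_p_anom: "E \<in> \<E> \<Longrightarrow> (\<integral>\<^sup>+x. ennreal (pE E x) \<partial>obs_space L) = 1"
  by (simp only: p_anom_eq) (rule nn_integral_pdf_product[OF pdf_anom])

lemma measurable_p_mix[measurable]: "p_mix L m g f \<alpha> \<in> borel_measurable (obs_space L)"
  unfolding p_mix_def[abs_def] by (intro borel_measurable_sum borel_measurable_times) auto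

lemma simplex_nonneg: "\<alpha> \<in> mixing_simplex L m \<Longrightarrow> E \<in> \<E> \<Longrightarrow> 0 \<le> \<alpha> E"
  by (auto simp: mixing_simplex_def PiE_iff)

lemma p_mix_nonneg: "\<alpha> \<in> mixing_simplex L m \<Longrightarrow> 0 \<le> p_mix L m g f \<alpha> x"
  unfolding p_mix_def by (intro sum_nonneg mult_nonneg_nonneg simplex_nonneg p_anom_nonneg)

lemma integrable_g_joint: "integrable (obs_space L) g0" "(\<integral>x. g0 x \<partial>obs_space L) = 1"
  using nn_integral_g_joint g_joint_nonneg
  by (auto simp: integrable_iff_bounded integral_eq_nn_integral)

lemma integrable_p_anom: assumes "E \<in> \<E>"
  shows "integrable (obs_space L) (pE E)" "(\<integral>x. pE E x \<partial>obs_space L) = 1"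
  using nn_integral_p_anom[OF assms] p_anom_nonneg[OF assms] assms
  by (auto simp: integrable_iff_bounded integral_eq_nn_integral)

lemma integrable_p_mix: assumes "\<alpha> \<in> mixing_simplex L m"
  shows "integrable (obs_space L) (p_mix L m g f \<alpha>)" "(\<integral>x. p_mix L m g f \<alpha> x \<partial>obs_space L) = 1"
  using assms integrable_p_anom unfolding p_mix_def[abs_def] by (auto simp: mixing_simplex_def)

lemma nn_integral_p_mix: assumes "\<alpha> \<in> mixing_simplex L m"
  shows "(\<integral>\<^sup>+x. ennreal (p_mix L m g f \<alpha> x) \<partial>obs_space L) = 1"
  using nn_integral_eq_integral[OF integrable_p_mix(1)[OF assms]] integrable_p_mix(2)[OF assms] p_mix_nonneg[OF assms]
  by simp

lemma KL_number_integral: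
  assumes "\<alpha> \<in> mixing_simplex L m" "KL_number L m g f \<alpha> < \<infinity>"
  shows "AE x in obs_space L. g0 x = 0 \<longrightarrow> p_mix L m g f \<alpha> x = 0"
    and "integrable (obs_space L) (\<lambda>x. p_mix L m g f \<alpha> x * ln (p_mix L m g f \<alpha> x / g0 x))"
    and "KL_number L m g f \<alpha> = ereal (\<integral>x. p_mix L m g f \<alpha> x * ln (p_mix L m g f \<alpha> x / g0 x) \<partial>obs_space L)"
  using ext_expectation_log_ratio[of "p_mix L m g f \<alpha>" "obs_space L" g0]
    p_mix_nonneg[OF assms(1)] g_joint_nonneg nn_integral_g_joint assms(2)
  unfolding KL_number_def law_def by auto

text \<open>A mixture equal to \<open>g0\<close> would, in a coordinate \<open>l\<close> belonging to some \<open>E\<close> of positive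
  weight, force the marginals \<open>f l\<close> and \<open>g l\<close> to agree.\<close>

lemma p_mix_neq_g_joint:
  assumes \<alpha>: "\<alpha> \<in> mixing_simplex L m"
    and distinct: "\<And>l. l \<in> {1..L} \<Longrightarrow>
      density lborel (\<lambda>x. ennreal (g l x)) \<noteq> density lborel (\<lambda>x. ennreal (f l x))"
  shows "\<not> (AE x in obs_space L. p_mix L m g f \<alpha> x = g0 x)"
proof
  assume AE: "AE x in obs_space L. p_mix L m g f \<alpha> x = g0 x"
  have "\<exists>E\<in>\<E>. \<alpha> E \<noteq> 0"
  proof (rule ccontr)
    assume "\<not> ?thesis"
    then have "(\<Sum>E\<in>\<E>. \<alpha> E) = 0" by simp
    then show False using \<alpha> by (simp add: mixing_simplex_def)
  qed
  then obtain E where E: "E \<in> \<E>" "\<alpha> E \<noteq> 0" by blast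
  then have "E \<noteq> {}" using m_pos by (auto simp: anomaly_sets_def)
  then obtain l where l: "l \<in> E" by blast
  have lL: "l \<in> {1..L}" using l E anomaly_sets_subset by blast
  \<comment> \<open>\<open>c\<close> and \<open>d\<close> are the total weights of the sets
    containing and avoiding \<open>l\<close>. The \<open>l\<close>-th marginal of the mixture is
    \<open>c f l + d g l\<close>; equality with \<open>g l\<close>, together with
    \<open>c + d = 1\<close> and \<open>c > 0\<close>, identifies the two laws.\<close>
  define c where "c = (\<Sum>E\<in>{E\<in>\<E>. l \<in> E}. \<alpha> E)"
  define d where "d = (\<Sum>E\<in>{E\<in>\<E>. l \<notin> E}. \<alpha> E)"
  have nn: "\<And>E. E \<in> \<E> \<Longrightarrow> 0 \<le> \<alpha> E" using simplex_nonneg[OF \<alpha>] by auto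
  have "\<alpha> E \<le> c" unfolding c_def using E l nn finite_anomaly_sets by (intro member_le_sum) auto
  then have c: "c > 0" using E nn[of E] by simp
  have cd: "c + d = 1"
  proof -
    have "\<E> = {E\<in>\<E>. l \<in> E} \<union> {E\<in>\<E>. l \<notin> E}" by auto
    then have "(\<Sum>E\<in>\<E>. \<alpha> E) = c + d" unfolding c_def d_def
      using finite_anomaly_sets by (subst sum.union_disjoint[symmetric]) auto
    then show ?thesis using \<alpha> by (simp add: mixing_simplex_def)
  qed
  have d: "d \<ge> 0" unfolding d_def using nn by (intro sum_nonneg) auto
  have meas: "(\<lambda>x. x l) \<in> measurable (obs_space L) borel"
    using lL unfolding obs_space_def by (auto intro: measurable_PiM_component_rev)
  have "density lborel (\<lambda>x. ennreal (g l x)) = density lborel (\<lambda>x. ennreal (f l x))"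
  proof (rule measure_eqI)
    fix B assume "B \<in> sets (density lborel (\<lambda>x. ennreal (g l x)))"
    then have B: "B \<in> sets borel" by simp
    have [measurable]: "(\<lambda>x. indicator B (x l) :: ennreal) \<in> borel_measurable (obs_space L)"
      by (rule measurable_compose[OF meas borel_measurable_indicator[OF B]])
    define G where "G = (\<integral>\<^sup>+y. ennreal (g l y) * indicator B y \<partial>lborel)"
    define F where "F = (\<integral>\<^sup>+y. ennreal (f l y) * indicator B y \<partial>lborel)"
    have G: "G = (\<integral>\<^sup>+x. ennreal (g0 x) * indicator B (x l) \<partial>obs_space L)"
      unfolding G_def g_joint_eq using nn_integral_pdf_product_marginal[OF pdf_g lL B] by simp
    have "F \<le> (\<integral>\<^sup>+y. ennreal (f l y) \<partial>lborel)" unfolding F_def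
      by (intro nn_integral_mono) (auto simp: indicator_def)
    then have F1: "F \<le> 1" using pdf_f[OF lL] by (simp add: pdf_def)
    have "G \<le> (\<integral>\<^sup>+y. ennreal (g l y) \<partial>lborel)" unfolding G_def
      by (intro nn_integral_mono) (auto simp: indicator_def)
    then have G1: "G \<le> 1" using pdf_g[OF lL] by (simp add: pdf_def)
    have pm: "(\<integral>\<^sup>+x. ennreal (pE E x) * indicator B (x l) \<partial>obs_space L) = (if l \<in> E then F else G)"
      if E: "E \<in> \<E>" for E
      using nn_integral_pdf_product_marginal[OF pdf_anom[OF E] lL B]
      unfolding p_anom_eq[OF E] F_def G_def by (simp add: if_distrib cong: if_cong)
    have "G = (\<integral>\<^sup>+x. ennreal (p_mix L m g f \<alpha> x) * indicator B (x l) \<partial>obs_space L)"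
      unfolding G using AE by (intro nn_integral_cong_AE) auto
    also have "\<dots> = (\<integral>\<^sup>+x. (\<Sum>E\<in>\<E>. ennreal (\<alpha> E) * (ennreal (pE E x) * indicator B (x l))) \<partial>obs_space L)"
      unfolding p_mix_def using nn p_anom_nonneg
      by (intro nn_integral_cong) (simp add: sum_ennreal[symmetric] ennreal_mult sum_distrib_right mult.assoc)
    also have "\<dots> = (\<Sum>E\<in>\<E>. ennreal (\<alpha> E) * (if l \<in> E then F else G))"
      by (subst nn_integral_sum) (auto simp: nn_integral_cmult pm cong: sum.cong)
    also have "\<dots> = (\<Sum>E\<in>{E\<in>\<E>. l \<in> E}. ennreal (\<alpha> E) * F) + (\<Sum>E\<in>{E\<in>\<E>. l \<notin> E}. ennreal (\<alpha> E) * G)"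
      unfolding sum.Int_Diff[OF finite_anomaly_sets, of _ "{E. l \<in> E}"]
      by (intro arg_cong2[where f = "(+)"] sum.cong) auto
    also have "\<dots> = ennreal c * F + ennreal d * G"
    proof -
      have "(\<Sum>E\<in>{E\<in>\<E>. l \<in> E}. ennreal (\<alpha> E)) = ennreal c" "(\<Sum>E\<in>{E\<in>\<E>. l \<notin> E}. ennreal (\<alpha> E)) = ennreal d"
        unfolding c_def d_def by (rule sum_ennreal, use nn in blast)+
      then show ?thesis by (simp flip: sum_distrib_right)
    qed
    finally have eq: "G = ennreal c * F + ennreal d * G" .
    \<comment> \<open>Both masses are at most 1, so the common term can be cancelled in the
      reals.\<close>
    obtain Fr Gr where FG: "F = ennreal Fr" "G = ennreal Gr" "0 \<le> Fr" "0 \<le> Gr"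
      using F1 G1 by (cases F; cases G) (auto simp: top_unique)
    have "Gr = c * Fr + d * Gr"
      using eq c d FG by (simp add: ennreal_mult[symmetric] ennreal_plus[symmetric] del: ennreal_plus)
    then have "c * Gr = c * Fr" using cd by (metis add_diff_cancel_right' add_right_cancel distrib_right mult_1)
    then have "F = G" using c FG by simp
    then show "emeasure (density lborel (\<lambda>x. ennreal (g l x))) B = emeasure (density lborel (\<lambda>x. ennreal (f l x))) B"
      using B pdf_f[OF lL] pdf_g[OF lL] unfolding F_def G_def by (simp add: emeasure_density pdf_def)
  qed simp
  then show False using distinct[OF lL] by simp
qed

end

section \<open>The optimal mixture\<close>

locale optimal_mixture = sensor_network +
  fixes \<alpha>s :: "nat set \<Rightarrow> real"
  assumes distinct: "\<And>l. l \<in> {1..L} \<Longrightarrow>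
      density lborel (\<lambda>x. ennreal (g l x)) \<noteq> density lborel (\<lambda>x. ennreal (f l x))"
    and KL_finite: "\<And>\<alpha>. \<alpha> \<in> mixing_simplex L m \<Longrightarrow> KL_number L m g f \<alpha> < \<infinity>"
    and minimizer: "is_arg_min (KL_number L m g f) (\<lambda>\<alpha>. \<alpha> \<in> mixing_simplex L m) \<alpha>s"
    and second_moment: "\<And>E. E \<in> anomaly_sets L m \<Longrightarrow> log_ratio_second_moment L m g f \<alpha>s E < \<infinity>"
begin

abbreviation "q \<equiv> p_mix L m g f \<alpha>s"

text \<open>Real-valued log-likelihood ratio. Where \<open>q\<close> or \<open>g0\<close> vanishes
  it takes the default value 0; such points form null sets of all post-change laws.\<close>

definition "\<phi> x = ln (q x / g0 x)"

definition "I = (\<integral>x. q x * \<phi> x \<partial>obs_space L)"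

lemma \<alpha>s_simplex: "\<alpha>s \<in> mixing_simplex L m"
  using minimizer by (simp add: is_arg_min_def)

lemma KL_minimal: "\<alpha> \<in> mixing_simplex L m \<Longrightarrow> KL_number L m g f \<alpha>s \<le> KL_number L m g f \<alpha>"
  using minimizer by (simp add: is_arg_min_linorder)

lemma measurable_\<phi>[measurable]: "\<phi> \<in> borel_measurable (obs_space L)"
  unfolding \<phi>_def[abs_def] by measurable

lemmas q_nonneg = p_mix_nonneg[OF \<alpha>s_simplex]
lemmas q_integrable = integrable_p_mix[OF \<alpha>s_simplex]

lemma q_ac: "AE x in obs_space L. g0 x = 0 \<longrightarrow> q x = 0"
  by (rule KL_number_integral(1)[OF \<alpha>s_simplex KL_finite[OF \<alpha>s_simplex]])

lemma KL_eq_I: "KL_number L m g f \<alpha>s = ereal I"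
  unfolding I_def \<phi>_def by (rule KL_number_integral(3)[OF \<alpha>s_simplex KL_finite[OF \<alpha>s_simplex]])

lemma integrable_q_\<phi>: "integrable (obs_space L) (\<lambda>x. q x * \<phi> x)"
  unfolding \<phi>_def by (rule KL_number_integral(2)[OF \<alpha>s_simplex KL_finite[OF \<alpha>s_simplex]])

text \<open>Strict Gibbs inequality, since the distinctness of \<open>f l\<close> and
  \<open>g l\<close> keeps \<open>q\<close> away from \<open>g0\<close>. This is what makes
  \<open>ln \<gamma> / I\<close> a finite delay.\<close>

lemma I_pos: "0 < I"
  unfolding I_def \<phi>_def using q_nonneg g_joint_nonneg q_integrable integrable_g_joint integrable_q_\<phi>[unfolded \<phi>_def]
    q_ac p_mix_neq_g_joint[OF \<alpha>s_simplex distinct]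
  by (intro KL_integral_pos) auto

text \<open>Segments towards vertices are the directions in which optimality is tested.
  \<open>restrict\<close> is there because members of the simplex are extensional;
  \<open>t = 1\<close> gives the vertex itself.\<close>

lemma move_towards_vertex:
  assumes E: "E \<in> \<E>" and t: "0 \<le> t" "t \<le> 1"
  defines "\<beta> \<equiv> restrict (\<lambda>E'. (1 - t) * \<alpha>s E' + (if E' = E then t else 0)) \<E>"
  shows "\<beta> \<in> mixing_simplex L m" "p_mix L m g f \<beta> x = (1 - t) * q x + t * pE E x"
proof -
  have 1: "(\<Sum>E'\<in>\<E>. \<beta> E' * h E') = (1 - t) * (\<Sum>E'\<in>\<E>. \<alpha>s E' * h E') + t * h E" for h :: "nat set \<Rightarrow> real"
  proof -
    have "(\<Sum>E'\<in>\<E>. \<beta> E' * h E') = (\<Sum>E'\<in>\<E>. (1 - t) * (\<alpha>s E' * h E') + (if E' = E then t * h E else 0))"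
      unfolding \<beta>_def by (intro sum.cong) (auto simp: algebra_simps)
    also have "\<dots> = (1 - t) * (\<Sum>E'\<in>\<E>. \<alpha>s E' * h E') + t * h E"
      using E finite_anomaly_sets by (simp add: sum.distrib sum_distrib_left sum.delta)
    finally show ?thesis .
  qed
  have "(\<Sum>E'\<in>\<E>. \<beta> E') = 1"
    using 1[of "\<lambda>_. 1"] \<alpha>s_simplex by (simp add: mixing_simplex_def)
  moreover have "\<beta> \<in> \<E> \<rightarrow>\<^sub>E {0..}"
    unfolding \<beta>_def using t simplex_nonneg[OF \<alpha>s_simplex] by auto
  ultimately show "\<beta> \<in> mixing_simplex L m" by (simp add: mixing_simplex_def)
  show "p_mix L m g f \<beta> x = (1 - t) * q x + t * pE E x"
    unfolding p_mix_def by (rule 1)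
qed

text \<open>\<open>pE E\<close> is itself a mixture, the case \<open>t = 1\<close> of the segment,
  so finiteness of the Kullback-Leibler numbers on the simplex applies to it.\<close>

lemma p_anom_KL:
  assumes "E \<in> \<E>"
  shows "AE x in obs_space L. g0 x = 0 \<longrightarrow> pE E x = 0"
    and "integrable (obs_space L) (\<lambda>x. pE E x * ln (pE E x / g0 x))"
  using KL_number_integral(1,2)[OF move_towards_vertex(1)[OF assms, of 1] KL_finite[OF move_towards_vertex(1)[OF assms, of 1]]]
    move_towards_vertex(2)[OF assms, of 1] by simp_all

text \<open>Where \<open>q = 0 < g0\<close> the log-ratio is minus infinity and its square infinite,
  so a finite second moment forbids \<open>pE E\<close> to charge that set, even if
  \<open>\<alpha>s E = 0\<close>. The first moment is dominated through
  \<open>|y| \<le> 1 + y^2\<close>.\<close>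

lemma p_anom_second_moment:
  assumes E: "E \<in> \<E>"
  shows "AE x in obs_space L. q x = 0 \<longrightarrow> pE E x = 0"
    and "integrable (obs_space L) (\<lambda>x. pE E x * (\<phi> x)\<^sup>2)"
    and "integrable (obs_space L) (\<lambda>x. pE E x * \<phi> x)"
proof -
  note [measurable] = measurable_p_anom[OF E]
  let ?lr = "\<lambda>x. log_ratio (q x) (g0 x)"
  have [measurable]: "?lr \<in> borel_measurable (obs_space L)"
    unfolding log_ratio_def[abs_def] by measurable
  have fin: "(\<integral>\<^sup>+x. ennreal (pE E x) * e2ennreal ((?lr x)\<^sup>2) \<partial>obs_space L) < \<infinity>"
    using second_moment[OF E] unfolding log_ratio_second_moment_def law_def
    by (subst (asm) nn_integral_density) (auto simp: power2_eq_square)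
  have "AE x in obs_space L. ennreal (pE E x) * e2ennreal ((?lr x)\<^sup>2) \<noteq> \<infinity>"
    using fin by (intro nn_integral_PInf_AE) (auto simp: power2_eq_square)
  then show ac: "AE x in obs_space L. q x = 0 \<longrightarrow> pE E x = 0"
    using p_anom_KL(1)[OF E]
    by eventually_elim (use p_anom_nonneg[OF E] in \<open>auto simp: log_ratio_def ennreal_mult_top power2_eq_square split: if_splits\<close>)
  have "AE x in obs_space L. ennreal (pE E x) * e2ennreal ((?lr x)\<^sup>2) = ennreal (pE E x * (\<phi> x)\<^sup>2)"
    using ac p_anom_KL(1)[OF E]
  proof eventually_elim
    case (elim x)
    show ?case
    proof (cases "pE E x = 0")
      case False
      then have "?lr x = ereal (\<phi> x)" using elim by (auto simp: log_ratio_def \<phi>_def)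
      then have "(?lr x)\<^sup>2 = ereal ((\<phi> x)\<^sup>2)" by (simp add: power2_eq_square)
      then show ?thesis
        by (simp only: e2ennreal_ereal ennreal_mult'[OF p_anom_nonneg[OF E]])
    qed simp
  qed
  then have "(\<integral>\<^sup>+x. ennreal (pE E x * (\<phi> x)\<^sup>2) \<partial>obs_space L) < \<infinity>"
    using fin by (simp only: nn_integral_cong_AE)
  then show sq: "integrable (obs_space L) (\<lambda>x. pE E x * (\<phi> x)\<^sup>2)"
    using p_anom_nonneg[OF E] by (simp add: integrable_iff_bounded abs_mult)
  have "integrable (obs_space L) (\<lambda>x. pE E x + pE E x * (\<phi> x)\<^sup>2)"
    using sq integrable_p_anom(1)[OF E] by auto
  then show "integrable (obs_space L) (\<lambda>x. pE E x * \<phi> x)"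
  proof (rule Bochner_Integration.integrable_bound)
    have "\<bar>y\<bar> \<le> 1 + y\<^sup>2" for y :: real
    proof -
      have "0 \<le> (\<bar>y\<bar> - 1)\<^sup>2" by simp
      then have "2 * \<bar>y\<bar> \<le> 1 + y\<^sup>2" by (simp add: power2_diff)
      then show ?thesis by simp
    qed
    then have "\<bar>pE E x * \<phi> x\<bar> \<le> pE E x * (1 + (\<phi> x)\<^sup>2)" for x
      using p_anom_nonneg[OF E, of x] by (auto simp: abs_mult intro!: mult_left_mono)
    then show "AE x in obs_space L. norm (pE E x * \<phi> x) \<le> norm (pE E x + pE E x * (\<phi> x)\<^sup>2)"
      using p_anom_nonneg[OF E] by (intro always_eventually) (auto simp: algebra_simps)
  qed auto
qed

text \<open>First-order optimality towards the vertex \<open>E\<close>. It gives the log-likelihood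
  a drift of at least \<open>I\<close> at every post-change time, whichever set is
  anomalous.\<close>

lemma I_le_mean_\<phi>:
  assumes E: "E \<in> \<E>"
  shows "I \<le> (\<integral>x. pE E x * \<phi> x \<partial>obs_space L)"
  unfolding I_def \<phi>_def
proof (rule KL_directional_minimum)
  fix t :: real assume t: "0 < t" "t < 1"
  let ?\<beta> = "restrict (\<lambda>E'. (1 - t) * \<alpha>s E' + (if E' = E then t else 0)) \<E>"
  have \<beta>: "?\<beta> \<in> mixing_simplex L m" "\<And>x. p_mix L m g f ?\<beta> x = (1 - t) * q x + t * pE E x"
    using move_towards_vertex[OF E, of t] t by auto
  show "integrable (obs_space L) (\<lambda>x. ((1 - t) * q x + t * pE E x) * ln (((1 - t) * q x + t * pE E x) / g0 x))"
    using KL_number_integral(2)[OF \<beta>(1) KL_finite[OF \<beta>(1)]] by (simp only: \<beta>(2))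
  show "(\<integral>x. q x * ln (q x / g0 x) \<partial>obs_space L) \<le>
    (\<integral>x. ((1 - t) * q x + t * pE E x) * ln (((1 - t) * q x + t * pE E x) / g0 x) \<partial>obs_space L)"
    using KL_minimal[OF \<beta>(1)] KL_number_integral(3)[OF \<beta>(1) KL_finite[OF \<beta>(1)]]
    by (simp add: \<beta>(2) KL_eq_I I_def \<phi>_def)
qed (use p_anom_nonneg[OF E] q_nonneg g_joint_nonneg integrable_p_anom[OF E] q_integrable q_ac
  p_anom_second_moment[OF E] p_anom_KL(2)[OF E] integrable_q_\<phi> in \<open>auto simp: \<phi>_def\<close>)

text \<open>A bound common to all second moments: a sum of nonnegative terms dominates each of
  them.\<close>

definition "V = (\<Sum>E\<in>\<E>. \<integral>x. pE E x * (\<phi> x)\<^sup>2 \<partial>obs_space L)"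

lemma V_nonneg: "0 \<le> V"
  unfolding V_def by (intro sum_nonneg integral_nonneg_AE) (auto simp: p_anom_nonneg)

lemma p_anom_second_moment_le:
  assumes E: "E \<in> \<E>" shows "(\<integral>x. pE E x * (\<phi> x)\<^sup>2 \<partial>obs_space L) \<le> V"
  unfolding V_def using E finite_anomaly_sets
  by (intro member_le_sum[of E \<E> "\<lambda>E. \<integral>x. pE E x * (\<phi> x)\<^sup>2 \<partial>obs_space L"] integral_nonneg_AE) (auto simp: p_anom_nonneg)

lemma q_second_moment:
  shows "integrable (obs_space L) (\<lambda>x. q x * (\<phi> x)\<^sup>2)"
    and "(\<integral>x. q x * (\<phi> x)\<^sup>2 \<partial>obs_space L) \<le> V"
proof -
  have e: "q x * (\<phi> x)\<^sup>2 = (\<Sum>E\<in>\<E>. \<alpha>s E * (pE E x * (\<phi> x)\<^sup>2))" for x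
    by (simp add: p_mix_def sum_distrib_right mult.assoc)
  show "integrable (obs_space L) (\<lambda>x. q x * (\<phi> x)\<^sup>2)"
    unfolding e using p_anom_second_moment(2) by auto
  have "(\<integral>x. q x * (\<phi> x)\<^sup>2 \<partial>obs_space L) = (\<Sum>E\<in>\<E>. \<alpha>s E * (\<integral>x. pE E x * (\<phi> x)\<^sup>2 \<partial>obs_space L))"
    unfolding e using p_anom_second_moment(2) by (subst Bochner_Integration.integral_sum) auto
  also have "\<dots> \<le> (\<Sum>E\<in>\<E>. \<alpha>s E * V)"
    using simplex_nonneg[OF \<alpha>s_simplex] p_anom_second_moment_le by (intro sum_mono mult_left_mono) auto
  also have "\<dots> = V" using \<alpha>s_simplex by (simp add: mixing_simplex_def flip: sum_distrib_right)
  finally show "(\<integral>x. q x * (\<phi> x)\<^sup>2 \<partial>obs_space L) \<le> V" .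
qed

end

section \<open>False alarms\<close>

lemma Inf_enat_le_iff: "Inf A \<le> enat n \<longleftrightarrow> (\<exists>x\<in>A. x \<le> enat n)"
proof
  assume le: "Inf A \<le> enat n"
  show "\<exists>x\<in>A. x \<le> enat n"
  proof (cases "A = {}")
    case True
    then show ?thesis using le by (simp add: Inf_enat_def)
  next
    case False
    then obtain x where "x \<in> A" by blast
    then have "Inf A \<in> A" unfolding Inf_enat_def using False by (simp add: LeastI[of "\<lambda>x. x \<in> A" x])
    then show ?thesis using le by blast
  qed
next
  assume "\<exists>x\<in>A. x \<le> enat n"
  then show "Inf A \<le> enat n" by (blast intro: Inf_lower2)
qed

text \<open>A finite infimum in \<open>enat\<close> is attained, and the maximum runs over the
  starts \<open>i = \<nu> + 1\<close>. Both the false-alarm and the delay bound use this form: any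
  single window above the threshold stops the test.\<close>

lemma M_CUSUM_le_iff:
  "M_CUSUM L m g f \<alpha> b \<omega> \<le> enat n \<longleftrightarrow> (\<exists>k \<nu>. \<nu> < k \<and> k \<le> n \<and> exp b \<le> mix_lr L m g f \<alpha> k \<nu> \<omega>)"
proof -
  let ?A = "{enat k |k. 1 \<le> k \<and> exp b \<le> W_stat L m g f \<alpha> k \<omega>}"
  have W: "exp b \<le> W_stat L m g f \<alpha> k \<omega> \<longleftrightarrow> (\<exists>\<nu><k. exp b \<le> mix_lr L m g f \<alpha> k \<nu> \<omega>)" if "1 \<le> k" for k
  proof -
    have "exp b \<le> W_stat L m g f \<alpha> k \<omega> \<longleftrightarrow> (\<exists>i\<in>{1..k}. exp b \<le> mix_lr L m g f \<alpha> k (i - 1) \<omega>)"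
      using that by (auto simp: W_stat_def Max_ge_iff)
    also have "\<dots> \<longleftrightarrow> (\<exists>\<nu><k. exp b \<le> mix_lr L m g f \<alpha> k \<nu> \<omega>)"
    proof safe
      fix i assume "i \<in> {1..k}" "exp b \<le> mix_lr L m g f \<alpha> k (i - 1) \<omega>"
      then show "\<exists>\<nu><k. exp b \<le> mix_lr L m g f \<alpha> k \<nu> \<omega>" by (intro exI[of _ "i - 1"]) auto
    next
      fix \<nu> assume "\<nu> < k" "exp b \<le> mix_lr L m g f \<alpha> k \<nu> \<omega>"
      then show "\<exists>i\<in>{1..k}. exp b \<le> mix_lr L m g f \<alpha> k (i - 1) \<omega>" by (intro bexI[of _ "Suc \<nu>"]) auto
    qed
    finally show ?thesis .
  qed
  have "Inf ?A \<le> enat n \<longleftrightarrow> (\<exists>x\<in>?A. x \<le> enat n)"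
    by (rule Inf_enat_le_iff)
  also have "\<dots> \<longleftrightarrow> (\<exists>k. 1 \<le> k \<and> k \<le> n \<and> exp b \<le> W_stat L m g f \<alpha> k \<omega>)" by auto
  also have "\<dots> \<longleftrightarrow> (\<exists>k \<nu>. \<nu> < k \<and> k \<le> n \<and> exp b \<le> mix_lr L m g f \<alpha> k \<nu> \<omega>)"
    using W by (metis One_nat_def Suc_leI gr_zeroI less_nat_zero_code)
  finally show ?thesis by (simp add: M_CUSUM_def)
qed

lemma stopping_times_sets:
  assumes "\<tau> \<in> stopping_times L"
  shows stopping_times_le_sets: "{\<omega>\<in>seq_space L. \<tau> \<omega> \<le> enat n} \<in> sets (obs_filtration L (enat n))"
    and stopping_times_gt_sets: "{\<omega>\<in>seq_space L. enat n < \<tau> \<omega>} \<in> sets (obs_filtration L (enat n))"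
proof -
  have st: "stopping_time (obs_filtration L) \<tau>" using assms by (simp add: stopping_times_def)
  show "{\<omega>\<in>seq_space L. \<tau> \<omega> \<le> enat n} \<in> sets (obs_filtration L (enat n))"
    using stopping_timeD[OF st, of "enat n"] by (simp add: pred_def space_obs_filtration)
  show "{\<omega>\<in>seq_space L. enat n < \<tau> \<omega>} \<in> sets (obs_filtration L (enat n))"
    using stopping_timeD2[OF st, of "enat n"] by (simp add: pred_def space_obs_filtration)
qed

context obs_process
begin

lemma measurable_stopping_times:
  assumes "\<tau> \<in> stopping_times L"
  shows "\<tau> \<in> measurable P (count_space UNIV)"
proof -
  have "\<tau> \<in> borel_measurable P"
  proof (rule measurable_stopping_time)
    show "stopping_time (obs_filtration L) \<tau>" using assms by (simp add: stopping_times_def)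
    show "sets (obs_filtration L t) \<subseteq> sets P" for t
      using filtration_sets_P by blast
    show "space (obs_filtration L t) = space P" for t
      by (simp only: space_obs_filtration space_P)
  qed
  then show ?thesis
    by (subst (asm) measurable_cong_sets[OF refl sets_borel_eq_count_space])
qed

lemma nn_integral_stopping_time:
  assumes "\<tau> \<in> stopping_times L"
  shows "(\<integral>\<^sup>+\<omega>. ennreal_of_enat (\<tau> \<omega>) \<partial>P) = (\<Sum>n. emeasure P {\<omega>\<in>seq_space L. enat n < \<tau> \<omega>})"
  using nn_integral_enat_function[OF measurable_stopping_times[OF assms]] by (simp only: space_P)

end

context sensor_network
begin

lemma law_simps:
  "sets (law L h) = sets (obs_space L)" "space (law L h) = space (obs_space L)"
  by (auto simp: law_def)

lemma prob_space_law:
  assumes "h \<in> borel_measurable (obs_space L)" "(\<integral>\<^sup>+x. ennreal (h x) \<partial>obs_space L) = 1"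
  shows "prob_space (law L h)"
proof (rule prob_spaceI)
  have "emeasure (law L h) (space (law L h)) = (\<integral>\<^sup>+x. ennreal (h x) * indicator (space (obs_space L)) x \<partial>obs_space L)"
    unfolding law_simps unfolding law_def using assms by (intro emeasure_density) auto
  also have "\<dots> = (\<integral>\<^sup>+x. ennreal (h x) \<partial>obs_space L)"
    by (intro nn_integral_cong) (simp add: indicator_def)
  finally show "emeasure (law L h) (space (law L h)) = 1" using assms by simp
qed

lemma prob_space_law_g: "prob_space (law L g0)"
  by (rule prob_space_law[OF measurable_g_joint nn_integral_g_joint])

lemma prob_space_law_anom: "E \<in> \<E> \<Longrightarrow> prob_space (law L (pE E))"
  by (rule prob_space_law[OF measurable_p_anom nn_integral_p_anom])

text \<open>Where \<open>g0\<close> vanishes the quotient is 0 by convention, so \<open>h\<close>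
  has to vanish there almost everywhere.\<close>

lemma law_eq_density_g:
  assumes h[measurable]: "h \<in> borel_measurable (obs_space L)" and nn: "\<And>x. 0 \<le> h x"
    and ac: "AE x in obs_space L. g0 x = 0 \<longrightarrow> h x = 0"
  shows "law L h = density (law L g0) (\<lambda>x. ennreal (h x / g0 x))"
proof -
  have "density (law L g0) (\<lambda>x. ennreal (h x / g0 x)) = density (obs_space L) (\<lambda>x. ennreal (g0 x) * ennreal (h x / g0 x))"
    unfolding law_def by (intro density_density_eq) auto
  also have "\<dots> = law L h"
    unfolding law_def
  proof (intro density_cong)
    show "AE x in obs_space L. ennreal (g0 x) * ennreal (h x / g0 x) = ennreal (h x)"
      using ac
    proof eventually_elim
      case (elim x)
      then show ?case
        using ennreal_mult'[OF g_joint_nonneg, of x "h x / g0 x"] by (cases "g0 x = 0") auto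
    qed
  qed auto
  finally show ?thesis ..
qed

lemma obs_process_infty: "obs_process L (\<lambda>_. law L g0)"
  using prob_space_law_g by (simp add: obs_process_def law_simps)

lemma obs_process_change:
  assumes "S \<in> anomaly_paths L m"
  shows "obs_process L (\<lambda>k. law L (if k \<le> \<nu> then g0 else pE (S k)))"
proof -
  \<comment> \<open>A time after \<nu> is at least 1, so the unconstrained value \<open>S 0\<close>
    never enters.\<close>
  have "S k \<in> \<E>" if "\<not> k \<le> \<nu>" for k
    using assms that by (auto simp: anomaly_paths_def)
  then show ?thesis
    using prob_space_law_g prob_space_law_anom by (auto simp: obs_process_def law_simps)
qed

lemma measurable_mix_lr:
  assumes "k \<le> n"
  shows "mix_lr L m g f \<alpha> k \<nu> \<in> borel_measurable (obs_filtration L (enat n))"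
  unfolding mix_lr_def[abs_def] using assms
  by (intro borel_measurable_prod borel_measurable_divide measurable_compose[OF measurable_obs_filtration measurable_p_mix]
    measurable_compose[OF measurable_obs_filtration measurable_g_joint]) auto

lemma M_CUSUM_stopping_time: "M_CUSUM L m g f \<alpha> b \<in> stopping_times L"
proof -
  have "stopping_time (obs_filtration L) (M_CUSUM L m g f \<alpha> b)"
  proof
    fix t :: enat
    show "Measurable.pred (obs_filtration L t) (\<lambda>\<omega>. M_CUSUM L m g f \<alpha> b \<omega> \<le> t)"
    proof (cases t)
      case (enat n)
      have "Measurable.pred (obs_filtration L t) (\<lambda>\<omega>. \<exists>k\<in>{..n}. \<exists>\<nu>\<in>{..<k}. exp b \<le> mix_lr L m g f \<alpha> k \<nu> \<omega>)"
      proof (intro pred_intros_finite)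
        fix k \<nu> assume "k \<in> {..n}"
        then have "mix_lr L m g f \<alpha> k \<nu> \<in> borel_measurable (obs_filtration L t)"
          unfolding enat by (intro measurable_mix_lr) simp
        then show "Measurable.pred (obs_filtration L t) (\<lambda>\<omega>. exp b \<le> mix_lr L m g f \<alpha> k \<nu> \<omega>)"
          by measurable
      qed auto
      moreover have "(\<exists>k\<in>{..n}. \<exists>\<nu>\<in>{..<k}. exp b \<le> mix_lr L m g f \<alpha> k \<nu> \<omega>) \<longleftrightarrow> M_CUSUM L m g f \<alpha> b \<omega> \<le> t" for \<omega>
        unfolding enat M_CUSUM_le_iff by auto
      ultimately show ?thesis by simp
    qed simp
  qed
  moreover have "0 < M_CUSUM L m g f \<alpha> b \<omega>" for \<omega>
    using M_CUSUM_le_iff[of L m g f \<alpha> b \<omega> 0] by (simp add: zero_enat_def not_le[symmetric])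
  ultimately show ?thesis by (simp add: stopping_times_def)
qed

end

section \<open>Change of measure from the non-anomalous law and the mean time to false alarm\<close>

context optimal_mixture
begin

definition "Pq \<nu> = PiM {1..} (\<lambda>k. law L (if k \<le> \<nu> then g0 else q))"

lemma prob_space_law_q: "prob_space (law L q)"
  by (rule prob_space_law[OF measurable_p_mix nn_integral_p_mix[OF \<alpha>s_simplex]])

lemma obs_process_q: "obs_process L (\<lambda>k. law L (if k \<le> \<nu> then g0 else q))"
  using prob_space_law_g prob_space_law_q by (auto simp: obs_process_def law_simps)

lemma emeasure_Pq:
  assumes A: "A \<in> sets (obs_filtration L (enat n))"
  shows "emeasure (Pq \<nu>) A = (\<integral>\<^sup>+\<omega>. ennreal (mix_lr L m g f \<alpha>s n \<nu> \<omega>) * indicator A \<omega> \<partial>P_infty L g)"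
proof -
  have "emeasure (Pq \<nu>) A = (\<integral>\<^sup>+\<omega>. (\<Prod>j\<in>{\<nu>+1..n}. ennreal (q (\<omega> j) / g0 (\<omega> j))) * indicator A \<omega> \<partial>P_infty L g)"
    unfolding Pq_def P_infty_def
    by (rule obs_process.emeasure_change_of_measure[OF obs_process_infty obs_process_q])
      (use A law_eq_density_g[OF measurable_p_mix q_nonneg q_ac] in auto)
  also have "\<dots> = (\<integral>\<^sup>+\<omega>. ennreal (mix_lr L m g f \<alpha>s n \<nu> \<omega>) * indicator A \<omega> \<partial>P_infty L g)"
    unfolding mix_lr_def using q_nonneg g_joint_nonneg by (simp add: prod_ennreal)
  finally show ?thesis .
qed

lemma emeasure_P_change:
  assumes S: "S \<in> anomaly_paths L m" and A: "A \<in> sets (obs_filtration L (enat n))"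
  shows "emeasure (P_change L g f \<nu> S) A =
    (\<integral>\<^sup>+\<omega>. ennreal (\<Prod>j\<in>{\<nu>+1..n}. pE (S j) (\<omega> j) / g0 (\<omega> j)) * indicator A \<omega> \<partial>P_infty L g)"
proof -
  have SE: "S j \<in> \<E>" if "\<nu> < j" for j using S that by (auto simp: anomaly_paths_def)
  have "emeasure (P_change L g f \<nu> S) A = (\<integral>\<^sup>+\<omega>. (\<Prod>j\<in>{\<nu>+1..n}. ennreal (pE (S j) (\<omega> j) / g0 (\<omega> j))) * indicator A \<omega> \<partial>P_infty L g)"
    unfolding P_change_def P_infty_def
    by (rule obs_process.emeasure_change_of_measure[OF obs_process_infty obs_process_change[OF S]])
      (use A law_eq_density_g[OF measurable_p_anom p_anom_nonneg p_anom_KL(1), OF SE SE SE] SE in auto)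
  also have "\<dots> = (\<integral>\<^sup>+\<omega>. ennreal (\<Prod>j\<in>{\<nu>+1..n}. pE (S j) (\<omega> j) / g0 (\<omega> j)) * indicator A \<omega> \<partial>P_infty L g)"
    using SE p_anom_nonneg g_joint_nonneg by (subst prod_ennreal[symmetric]) auto
  finally show ?thesis .
qed

text \<open>For \<open>n = \<nu>\<close> the likelihood ratio is an empty product. Hence \<tau> >
  \<nu> has the same probability under all paths, which later gives the lower bound a common
  denominator.\<close>

lemma emeasure_pre_change:
  assumes A: "A \<in> sets (obs_filtration L (enat \<nu>))"
  shows "emeasure (Pq \<nu>) A = emeasure (P_infty L g) A"
    and "S \<in> anomaly_paths L m \<Longrightarrow> emeasure (P_change L g f \<nu> S) A = emeasure (P_infty L g) A"
  using A obs_process.filtration_sets_P[OF obs_process_infty A, folded P_infty_def]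
  by (simp_all add: emeasure_Pq emeasure_P_change mix_lr_def)

text \<open>If \<open>\<tau> = k\<close> then one of the likelihood ratios started at \<open>\<nu> < k\<close> is at least \<open>\<gamma>\<close>, so a change of
  measure turns \<open>\<gamma> P\<^sub>\<infinity>(\<tau> \<le> n)\<close> into at most \<open>\<Sum>\<^sub>\<nu> Pq \<nu> (\<tau> > \<nu>) = \<Sum>\<^sub>\<nu> P\<^sub>\<infinity>(\<tau> > \<nu>)\<close>, the mean of \<open>\<tau>\<close>.\<close>

lemma M_CUSUM_false_alarm_finite:
  assumes \<gamma>: "1 < \<gamma>"
  defines "\<tau> \<equiv> M_CUSUM L m g f \<alpha>s (ln \<gamma>)"
  shows "ennreal \<gamma> * emeasure (P_infty L g) {\<omega>\<in>seq_space L. \<tau> \<omega> \<le> enat n} \<le> mean_time_false_alarm L g \<tau>"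
proof -
  interpret obs_process L "\<lambda>_. law L g0" by (rule obs_process_infty)
  have st: "\<tau> \<in> stopping_times L" unfolding \<tau>_def by (rule M_CUSUM_stopping_time)
  let ?P = "P_infty L g" and ?lr = "\<lambda>k \<nu> \<omega>. mix_lr L m g f \<alpha>s k \<nu> \<omega>"
  define H where "H k = {\<omega>\<in>seq_space L. \<tau> \<omega> = enat k}" for k
  have H_F: "H k \<in> sets (obs_filtration L (enat k))" for k
  proof -
    have nat: "(n = k) = (n \<le> k \<and> (\<forall>j\<in>{..<k}. \<not> n \<le> j))" for n :: nat
      by (metis le_refl le_neq_implies_less lessThan_iff not_le)
    have "H k = {\<omega>\<in>seq_space L. \<tau> \<omega> \<le> enat k} - (\<Union>j\<in>{..<k}. {\<omega>\<in>seq_space L. \<tau> \<omega> \<le> enat j})"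
    proof (rule set_eqI)
      fix \<omega> show "\<omega> \<in> H k \<longleftrightarrow> \<omega> \<in> {\<omega>\<in>seq_space L. \<tau> \<omega> \<le> enat k} - (\<Union>j\<in>{..<k}. {\<omega>\<in>seq_space L. \<tau> \<omega> \<le> enat j})"
        by (cases "\<tau> \<omega>") (auto simp: H_def nat)
    qed
    moreover have "{\<omega>\<in>seq_space L. \<tau> \<omega> \<le> enat j} \<in> sets (obs_filtration L (enat k))" if "j < k" for j
      using stopping_times_le_sets[OF st, of j] obs_filtration_mono[of "enat j" "enat k" L] that by auto
    ultimately show ?thesis using stopping_times_le_sets[OF st, of k] by auto
  qed
  have H_P: "H k \<in> sets ?P" for k
    using filtration_sets_P[OF H_F[of k]] by (simp add: P_infty_def)
  have H_Q: "H k \<in> sets (Pq \<nu>)" for k \<nu>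
    unfolding Pq_def by (rule obs_process.filtration_sets_P[OF obs_process_q H_F])
  have dH: "disjoint_family H" by (auto simp: disjoint_family_on_def H_def)
  have mlr[measurable]: "?lr k \<nu> \<in> borel_measurable ?P" for k \<nu>
    unfolding mix_lr_def P_infty_def
    by (intro borel_measurable_prod borel_measurable_divide measurable_PiM_component_rev)
      (auto simp: law_def)
  have step: "ennreal \<gamma> * emeasure ?P (H k) \<le> (\<Sum>\<nu><k. emeasure (Pq \<nu>) (H k))" for k
  proof -
    have "ennreal \<gamma> * emeasure ?P (H k) = (\<integral>\<^sup>+\<omega>. ennreal \<gamma> * indicator (H k) \<omega> \<partial>?P)"
      using H_P by (simp add: nn_integral_cmult)
    also have "\<dots> \<le> (\<integral>\<^sup>+\<omega>. (\<Sum>\<nu><k. ennreal (?lr k \<nu> \<omega>) * indicator (H k) \<omega>) \<partial>?P)"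
    proof (rule nn_integral_mono)
      fix \<omega>
      show "ennreal \<gamma> * indicator (H k) \<omega> \<le> (\<Sum>\<nu><k. ennreal (?lr k \<nu> \<omega>) * indicator (H k) \<omega>)"
      proof (cases "\<omega> \<in> H k")
        case True
        then have \<tau>k: "\<tau> \<omega> = enat k" by (simp add: H_def)
        then have "\<tau> \<omega> \<le> enat k" by simp
        then obtain k' \<nu> where k': "\<nu> < k'" "k' \<le> k" "\<gamma> \<le> ?lr k' \<nu> \<omega>"
          unfolding \<tau>_def M_CUSUM_le_iff using \<gamma> by auto
        \<comment> \<open>A crossing at \<open>k'\<close> already stops the test by then, so
          \<open>k'\<close> cannot be smaller than \<open>k\<close>: the ratio found ends at the
          stopping time itself.\<close>
        then have "\<tau> \<omega> \<le> enat k'" unfolding \<tau>_def M_CUSUM_le_iff using \<gamma> by auto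
        then have "k' = k" using \<tau>k k' by simp
        then have \<nu>: "\<nu> < k" "\<gamma> \<le> ?lr k \<nu> \<omega>" using k' by auto
        have "ennreal \<gamma> \<le> ennreal (?lr k \<nu> \<omega>)" using \<nu> by (rule_tac ennreal_leI) auto
        \<comment> \<open>The maximum over starts is bounded by the sum over starts, which is the
          Shiryaev-Roberts statistic.\<close>
        also have "\<dots> \<le> (\<Sum>\<nu><k. ennreal (?lr k \<nu> \<omega>))"
          using \<nu> by (intro member_le_sum) auto
        finally show ?thesis using True by simp
      qed simp
    qed
    also have "\<dots> = (\<Sum>\<nu><k. emeasure (Pq \<nu>) (H k))"
      using H_P by (subst nn_integral_sum) (auto simp: emeasure_Pq[OF H_F])
    finally show ?thesis .
  qed
  have "{\<omega>\<in>seq_space L. \<tau> \<omega> \<le> enat n} = (\<Union>k\<in>{..n}. H k)"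
  proof (rule set_eqI)
    fix \<omega> show "\<omega> \<in> {\<omega>\<in>seq_space L. \<tau> \<omega> \<le> enat n} \<longleftrightarrow> \<omega> \<in> (\<Union>k\<in>{..n}. H k)"
      by (cases "\<tau> \<omega>") (auto simp: H_def)
  qed
  then have "emeasure ?P {\<omega>\<in>seq_space L. \<tau> \<omega> \<le> enat n} = (\<Sum>k\<le>n. emeasure ?P (H k))"
  proof -
    have "H ` {..n} \<subseteq> sets ?P" using H_P by blast
    from sum_emeasure[OF this disjoint_family_on_mono[OF _ dH]] show ?thesis
      by (simp add: \<open>{\<omega>\<in>seq_space L. \<tau> \<omega> \<le> enat n} = (\<Union>k\<in>{..n}. H k)\<close>)
  qed
  then have "ennreal \<gamma> * emeasure ?P {\<omega>\<in>seq_space L. \<tau> \<omega> \<le> enat n} = (\<Sum>k\<le>n. ennreal \<gamma> * emeasure ?P (H k))"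
    by (simp add: sum_distrib_left)
  also have "\<dots> \<le> (\<Sum>k\<le>n. \<Sum>\<nu><k. emeasure (Pq \<nu>) (H k))"
    by (rule sum_mono[OF step])
  \<comment> \<open>Padding the triangle to a rectangle allows the exchange of sums; for fixed \<nu>
    the sets \<open>H k\<close> with \<open>k > \<nu>\<close> are disjoint parts of \<tau> >
    \<nu>.\<close>
  also have "\<dots> = (\<Sum>k\<le>n. \<Sum>\<nu><n. if \<nu> < k then emeasure (Pq \<nu>) (H k) else 0)"
    by (intro sum.cong refl sum.mono_neutral_cong_left) auto
  also have "\<dots> = (\<Sum>\<nu><n. \<Sum>k\<le>n. if \<nu> < k then emeasure (Pq \<nu>) (H k) else 0)"
    by (rule sum.swap)
  also have "\<dots> \<le> (\<Sum>\<nu><n. emeasure ?P {\<omega>\<in>seq_space L. enat \<nu> < \<tau> \<omega>})"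
  proof (rule sum_mono)
    fix \<nu> assume "\<nu> \<in> {..<n}"
    have D: "{\<omega>\<in>seq_space L. enat \<nu> < \<tau> \<omega>} \<in> sets (Pq \<nu>)"
      unfolding Pq_def by (rule obs_process.filtration_sets_P[OF obs_process_q stopping_times_gt_sets[OF st]])
    have "(\<Sum>k\<le>n. if \<nu> < k then emeasure (Pq \<nu>) (H k) else 0) = (\<Sum>k\<in>{\<nu><..n}. emeasure (Pq \<nu>) (H k))"
      by (intro sum.mono_neutral_cong_right) auto
    also have "\<dots> = emeasure (Pq \<nu>) (\<Union>k\<in>{\<nu><..n}. H k)"
      using H_Q dH by (intro sum_emeasure) (auto intro: disjoint_family_on_mono)
    also have "\<dots> \<le> emeasure (Pq \<nu>) {\<omega>\<in>seq_space L. enat \<nu> < \<tau> \<omega>}"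
      using D by (intro emeasure_mono) (auto simp: H_def)
    also have "\<dots> = emeasure ?P {\<omega>\<in>seq_space L. enat \<nu> < \<tau> \<omega>}"
      by (rule emeasure_pre_change(1)[OF stopping_times_gt_sets[OF st]])
    finally show "(\<Sum>k\<le>n. if \<nu> < k then emeasure (Pq \<nu>) (H k) else 0) \<le> emeasure ?P {\<omega>\<in>seq_space L. enat \<nu> < \<tau> \<omega>}" .
  qed
  also have "\<dots> \<le> (\<Sum>\<nu>. emeasure ?P {\<omega>\<in>seq_space L. enat \<nu> < \<tau> \<omega>})"
    by (rule sum_le_suminf) auto
  also have "\<dots> = mean_time_false_alarm L g \<tau>"
    unfolding mean_time_false_alarm_def P_infty_def by (rule nn_integral_stopping_time[OF st, symmetric])
  finally show ?thesis .
qed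

text \<open>An infinite mean is trivial; otherwise \<tau> is almost surely finite, the probability
  of \<tau> \<le> n tends to 1, and the finite-horizon bound passes to the limit.\<close>

lemma M_CUSUM_mean_time_false_alarm:
  assumes \<gamma>: "1 < \<gamma>"
  shows "ennreal \<gamma> \<le> mean_time_false_alarm L g (M_CUSUM L m g f \<alpha>s (ln \<gamma>))"
proof (cases "mean_time_false_alarm L g (M_CUSUM L m g f \<alpha>s (ln \<gamma>)) = \<infinity>")
  case False
  interpret obs_process L "\<lambda>_. law L g0" by (rule obs_process_infty)
  define \<tau> where "\<tau> = M_CUSUM L m g f \<alpha>s (ln \<gamma>)"
  have st: "\<tau> \<in> stopping_times L" unfolding \<tau>_def by (rule M_CUSUM_stopping_time)
  let ?P = "P_infty L g" and ?A = "\<lambda>n. {\<omega>\<in>seq_space L. \<tau> \<omega> \<le> enat n}"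
  have m[measurable]: "\<tau> \<in> measurable ?P (count_space UNIV)"
    unfolding P_infty_def by (rule measurable_stopping_times[OF st])
  have A: "?A n \<in> sets ?P" for n
    using filtration_sets_P[OF stopping_times_le_sets[OF st]] by (simp add: P_infty_def)
  have sp: "space ?P = seq_space L" unfolding P_infty_def by (rule space_P)
  have "AE \<omega> in ?P. ennreal_of_enat (\<tau> \<omega>) \<noteq> \<infinity>"
    using False unfolding mean_time_false_alarm_def \<tau>_def[symmetric]
    by (intro nn_integral_PInf_AE) auto
  then have AE: "AE \<omega> in ?P. \<omega> \<in> (\<Union>n. ?A n)"
    using AE_space
  proof eventually_elim
    case (elim \<omega>)
    then obtain n where "\<tau> \<omega> = enat n" by (cases "\<tau> \<omega>") auto
    with elim sp show ?case by auto
  qed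
  have "prob_space ?P" unfolding P_infty_def by (rule prob_space_axioms)
  then have "emeasure ?P (\<Union>n. ?A n) = 1"
    using A AE by (intro prob_space.emeasure_eq_1_AE) auto
  moreover have "(SUP n. emeasure ?P (?A n)) = emeasure ?P (\<Union>n. ?A n)"
    using A by (intro SUP_emeasure_incseq) (auto simp: incseq_def intro: order_trans)
  ultimately have "ennreal \<gamma> = (SUP n. ennreal \<gamma> * emeasure ?P (?A n))"
    by (simp add: SUP_mult_left_ennreal[symmetric])
  also have "\<dots> \<le> mean_time_false_alarm L g \<tau>"
    unfolding \<tau>_def by (intro SUP_least M_CUSUM_false_alarm_finite \<gamma>)
  finally show ?thesis by (simp add: \<tau>_def)
qed simp

end

section \<open>Upper bound on the detection delay\<close>

lemma le_enat_less_trans: "i \<le> j \<Longrightarrow> enat j < x \<Longrightarrow> enat i < x"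
  by (cases x) auto

text \<open>The tail bound is constant on blocks of length \<open>t\<close>, so summing it gives
  \<open>t\<close> copies of a geometric series.\<close>

lemma suminf_geometric_blocks_le:
  fixes e :: "nat \<Rightarrow> real"
  assumes e: "\<And>n. 0 \<le> e n" "\<And>n. e n \<le> p * d ^ (n div t)" and t: "1 \<le> t" and d: "0 \<le> d" "d < 1" and p: "0 \<le> p"
  shows "(\<Sum>n. ennreal (e n)) \<le> ennreal (p * (real t / (1 - d)))"
proof (rule suminf_le_const)
  fix N
  have "(\<Sum>n<N. e n) \<le> (\<Sum>n<N * t. e n)"
    using t e(1) by (intro sum_mono2) auto
  also have "\<dots> \<le> (\<Sum>n<N * t. p * d ^ (n div t))" by (intro sum_mono e)
  also have "\<dots> = (\<Sum>k<N. \<Sum>n\<in>{k * t..<k * t + t}. p * d ^ (n div t))"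
    by (rule sum.nat_group[symmetric])
  also have "\<dots> = (\<Sum>k<N. \<Sum>n\<in>{k * t..<k * t + t}. p * d ^ k)"
  proof (intro sum.cong refl)
    fix k n assume "n \<in> {k * t..<k * t + t}"
    then have "n div t = k" by (intro div_nat_eqI) (auto simp: mult.commute)
    then show "p * d ^ (n div t) = p * d ^ k" by simp
  qed
  also have "\<dots> = p * (real t * (\<Sum>k<N. d ^ k))"
    by (simp add: sum_distrib_left mult_ac)
  also have "\<dots> \<le> p * (real t * (1 / (1 - d)))"
  proof (intro mult_left_mono p)
    show "(\<Sum>k<N. d ^ k) \<le> 1 / (1 - d)"
      using d sum_le_suminf[of "\<lambda>k. d ^ k" "{..<N}"] by (simp add: suminf_geometric summable_geometric)
  qed auto
  finally show "(\<Sum>n<N. ennreal (e n)) \<le> ennreal (p * (real t / (1 - d)))"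
    using e(1) by (simp add: sum_ennreal ennreal_leI)
qed auto

text \<open>Tested on the event where the conditional expectation exceeds \<open>C\<close>, the
  excess is nonnegative with integral 0. Finiteness of the measure makes the subtraction in
  \<open>ennreal\<close> legitimate.\<close>

lemma (in sigma_finite_subalgebra) nn_cond_exp_le_const:
  assumes [measurable]: "X \<in> borel_measurable M" and fin: "finite_measure M"
    and le: "\<And>B. B \<in> sets F \<Longrightarrow> (\<integral>\<^sup>+x. indicator B x * X x \<partial>M) \<le> ennreal C * emeasure M B"
  shows "AE x in M. nn_cond_exp M F X x \<le> ennreal C"
proof -
  interpret finite_measure M by fact
  let ?Y = "nn_cond_exp M F X"
  define B where "B = {x\<in>space F. ennreal C < ?Y x}"
  have B[measurable]: "B \<in> sets F" unfolding B_def by measurable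
  have BM[measurable]: "B \<in> sets M" using B subalg by (auto simp: subalgebra_def)
  have "(\<integral>\<^sup>+x. indicator B x * ?Y x \<partial>M) = (\<integral>\<^sup>+x. indicator B x * X x \<partial>M)"
    by (rule nn_cond_exp_intg) auto
  then have le': "(\<integral>\<^sup>+x. indicator B x * ?Y x \<partial>M) \<le> (\<integral>\<^sup>+x. ennreal C * indicator B x \<partial>M)"
    using le[OF B] by (simp add: nn_integral_cmult_indicator)
  have fin: "(\<integral>\<^sup>+x. ennreal C * indicator B x \<partial>M) \<noteq> \<infinity>"
    using BM by (simp add: nn_integral_cmult_indicator ennreal_mult_eq_top_iff emeasure_eq_measure)
  have "AE x in M. ennreal C * indicator B x \<le> indicator B x * ?Y x"
    by (intro AE_I2) (auto simp: indicator_def B_def)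
  then have "(\<integral>\<^sup>+x. indicator B x * ?Y x - ennreal C * indicator B x \<partial>M)
      = (\<integral>\<^sup>+x. indicator B x * ?Y x \<partial>M) - (\<integral>\<^sup>+x. ennreal C * indicator B x \<partial>M)"
    by (intro nn_integral_diff fin) measurable
  also have "\<dots> = 0" using le' fin by (simp add: diff_eq_0_iff_ennreal less_top)
  finally have "AE x in M. indicator B x * ?Y x - ennreal C * indicator B x = 0"
    by (subst (asm) nn_integral_0_iff_AE) auto
  then show ?thesis
    using AE_space
  proof eventually_elim
    case (elim x)
    show ?case
    proof (rule ccontr)
      assume "\<not> ?Y x \<le> ennreal C"
      then have "x \<in> B" using elim subalg by (auto simp: B_def subalgebra_def)
      then have "?Y x - ennreal C = 0" "ennreal C < ?Y x" using elim by (auto simp: B_def)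
      then show False by (auto simp: diff_eq_0_iff_ennreal)
    qed
  qed
qed

context optimal_mixture
begin

text \<open>The essential supremum is controlled by testing on past events inside \<tau> > \<nu>,
  and the normalization by the probability of \<tau> > \<nu> cancels. \<open>1 \<le> C\<close>
  covers the value 1 prescribed when that probability is 0.\<close>

lemma worst_cond_delay_le:
  assumes S: "S \<in> anomaly_paths L m" and st: "\<tau> \<in> stopping_times L" and C: "1 \<le> C"
    and le: "\<And>B. B \<in> sets (obs_filtration L (enat \<nu>)) \<Longrightarrow> B \<subseteq> {\<omega>. enat \<nu> < \<tau> \<omega>} \<Longrightarrow>
      (\<integral>\<^sup>+\<omega>. ennreal_of_enat (\<tau> \<omega> - enat \<nu>) * indicator B \<omega> \<partial>P_change L g f \<nu> S) \<le> ennreal C * emeasure (P_change L g f \<nu> S) B"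
  shows "worst_cond_delay L g f \<tau> \<nu> S \<le> ennreal C"
proof -
  interpret obs_process L "\<lambda>k. law L (if k \<le> \<nu> then g0 else pE (S k))"
    by (rule obs_process_change[OF S])
  define PP where "PP = P_change L g f \<nu> S"
  have PP: "P = PP" by (simp add: PP_def P_change_def)
  let ?F = "obs_filtration L (enat \<nu>)"
  define A where "A = {\<omega>\<in>seq_space L. enat \<nu> < \<tau> \<omega>}"
  define Q where "Q = uniform_measure PP A"
  define X where "X \<omega> = ennreal_of_enat (\<tau> \<omega> - enat \<nu>)" for \<omega>
  have sp: "space PP = seq_space L" using space_P by (simp only: PP)
  have AF: "A \<in> sets ?F" unfolding A_def by (rule stopping_times_gt_sets[OF st])
  have FP: "B \<in> sets ?F \<Longrightarrow> B \<in> sets PP" for B using filtration_sets_P[of B] by (simp only: PP)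
  have AP: "A \<in> sets PP" by (rule FP[OF AF])
  have m\<tau>: "\<tau> \<in> measurable PP (count_space UNIV)" using measurable_stopping_times[OF st] by (simp only: PP)
  have mX: "X \<in> borel_measurable PP"
    unfolding X_def[abs_def] by (rule measurable_compose[OF m\<tau>]) simp
  have wcd: "worst_cond_delay L g f \<tau> \<nu> S = (if emeasure PP A = 0 then 1 else esssup Q (nn_cond_exp Q ?F X))"
    unfolding worst_cond_delay_def Let_def PP_def[symmetric] sp A_def[symmetric] Q_def[symmetric] X_def[abs_def] ..
  show ?thesis
  proof (cases "emeasure PP A = 0")
    case True
    then show ?thesis unfolding wcd using ennreal_leI[OF C] by simp
  next
    case False
    have probPP: "prob_space PP" using prob_space_axioms by (simp only: PP)
    interpret PP: prob_space PP by (rule probPP)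
    interpret Q: prob_space Q
      unfolding Q_def using False by (intro prob_space_uniform_measure) auto
    have setsQ: "sets Q = sets PP" "space Q = space PP" by (auto simp: Q_def)
    have sub: "subalgebra Q ?F"
      using FP by (auto simp: subalgebra_def setsQ sp space_obs_filtration)
    interpret finite_measure_subalgebra Q ?F
      by standard (rule sub)
    have mXQ: "X \<in> borel_measurable Q" using mX by (simp add: Q_def)
    have "AE x in Q. nn_cond_exp Q ?F X x \<le> ennreal C"
    proof (rule nn_cond_exp_le_const[OF mXQ Q.finite_measure_axioms])
      fix B assume B: "B \<in> sets ?F"
      have AB: "A \<inter> B \<in> sets ?F" using AF B by auto
      have BP: "B \<in> sets PP" by (rule FP[OF B])
      have "(\<integral>\<^sup>+x. indicator B x * X x \<partial>Q) = (\<integral>\<^sup>+x. (indicator B x * X x) * indicator A x \<partial>PP) / emeasure PP A"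
        unfolding Q_def using mX BP AP by (intro nn_integral_uniform_measure) auto
      also have "(\<integral>\<^sup>+x. (indicator B x * X x) * indicator A x \<partial>PP) = (\<integral>\<^sup>+x. X x * indicator (A \<inter> B) x \<partial>PP)"
        by (intro nn_integral_cong) (auto simp: indicator_def)
      also have "\<dots> \<le> ennreal C * emeasure PP (A \<inter> B)"
        unfolding X_def PP_def by (rule le[OF AB]) (auto simp: A_def)
      finally have "(\<integral>\<^sup>+x. indicator B x * X x \<partial>Q) \<le> ennreal C * emeasure PP (A \<inter> B) / emeasure PP A"
        by (simp add: divide_right_mono_ennreal)
      also have "\<dots> = ennreal C * emeasure Q B"
        unfolding Q_def using AP BP by (simp add: ennreal_times_divide)
      finally show "(\<integral>\<^sup>+x. indicator B x * X x \<partial>Q) \<le> ennreal C * emeasure Q B" .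
    qed
    then show ?thesis unfolding wcd using False by (auto intro!: esssup_I)
  qed
qed

text \<open>Centring at its own mean can only lower a second moment, so \<open>V\<close> bounds all
  variances although the means differ from law to law.\<close>

lemma law_moments:
  assumes h[measurable]: "h \<in> borel_measurable (obs_space L)" and nn: "\<And>x. 0 \<le> h x"
    and one: "(\<integral>\<^sup>+x. ennreal (h x) \<partial>obs_space L) = 1"
    and i1: "integrable (obs_space L) (\<lambda>x. h x * \<phi> x)" and i2: "integrable (obs_space L) (\<lambda>x. h x * (\<phi> x)\<^sup>2)"
    and V: "(\<integral>x. h x * (\<phi> x)\<^sup>2 \<partial>obs_space L) \<le> V"
  defines "\<mu> \<equiv> (\<integral>x. h x * \<phi> x \<partial>obs_space L)"
  shows "integrable (law L h) (\<lambda>x. (\<phi> x - \<mu>)\<^sup>2)" "(\<integral>x. (\<phi> x - \<mu>)\<^sup>2 \<partial>law L h) \<le> V"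
    "(\<integral>x. \<phi> x - \<mu> \<partial>law L h) = 0"
proof -
  interpret prob_space "law L h" by (rule prob_space_law[OF h one])
  have j1: "integrable (law L h) \<phi>" "(\<integral>x. \<phi> x \<partial>law L h) = \<mu>"
    unfolding law_def \<mu>_def using nn i1 by (simp_all add: integrable_real_density integral_real_density)
  have j2: "integrable (law L h) (\<lambda>x. (\<phi> x)\<^sup>2)" "(\<integral>x. (\<phi> x)\<^sup>2 \<partial>law L h) \<le> V"
    unfolding law_def using nn i2 V by (simp_all add: integrable_real_density integral_real_density)
  have e: "(\<phi> x - \<mu>)\<^sup>2 = (\<phi> x)\<^sup>2 - 2 * \<mu> * \<phi> x + \<mu>\<^sup>2" for x
    by (simp add: power2_diff)
  show "integrable (law L h) (\<lambda>x. (\<phi> x - \<mu>)\<^sup>2)" unfolding e using j1 j2 by auto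
  have "(\<integral>x. (\<phi> x - \<mu>)\<^sup>2 \<partial>law L h) = (\<integral>x. (\<phi> x)\<^sup>2 \<partial>law L h) - \<mu>\<^sup>2"
    unfolding e using j1 j2 prob_space by (simp add: power2_eq_square)
  then show "(\<integral>x. (\<phi> x - \<mu>)\<^sup>2 \<partial>law L h) \<le> V" using j2(2) by (smt (verit) zero_le_power2)
  show "(\<integral>x. \<phi> x - \<mu> \<partial>law L h) = 0" using j1 prob_space by simp
qed

lemmas law_anom_moments = law_moments[OF measurable_p_anom p_anom_nonneg nn_integral_p_anom
  p_anom_second_moment(3,2) p_anom_second_moment_le]

lemmas law_q_moments = law_moments[OF measurable_p_mix q_nonneg nn_integral_p_mix[OF \<alpha>s_simplex]
  integrable_q_\<phi> q_second_moment, folded I_def]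

text \<open>Needed to write likelihood ratios as exponentials of sums of \<open>\<phi>\<close>:
  where \<open>q = 0\<close>, the ratio is 0 but \<open>exp (\<phi> x)\<close> is 1.\<close>

lemma AE_law_positive:
  assumes h[measurable]: "h \<in> borel_measurable (obs_space L)"
    and ac: "AE x in obs_space L. g0 x = 0 \<longrightarrow> h x = 0" "AE x in obs_space L. q x = 0 \<longrightarrow> h x = 0"
  shows "AE x in law L h. 0 < q x \<and> 0 < g0 x"
  unfolding law_def
proof (subst AE_density)
  show "AE x in obs_space L. 0 < ennreal (h x) \<longrightarrow> 0 < q x \<and> 0 < g0 x"
    using ac by eventually_elim (use q_nonneg g_joint_nonneg in \<open>auto simp: less_le\<close>)
qed auto

lemma mix_lr_eq_exp:
  assumes "\<And>j. \<nu> < j \<Longrightarrow> 0 < q (\<omega> j) \<and> 0 < g0 (\<omega> j)"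
  shows "mix_lr L m g f \<alpha>s n \<nu> \<omega> = exp (\<Sum>j\<in>{\<nu>+1..n}. \<phi> (\<omega> j))"
  unfolding mix_lr_def exp_sum[OF finite_atLeastAtMost] \<phi>_def using assms by (intro prod.cong) auto

text \<open>Each block of \<open>t\<close> observations can stop the test alone, since M-CUSUM may
  start its likelihood ratio at the start of the block. If the block does not, its log-likelihood
  lies at least \<open>t I - ln \<gamma>\<close> below its mean, which is at least
  \<open>t I\<close>; given any past, Chebyshev bounds this by the base of the power.\<close>

lemma M_CUSUM_block_tail:
  assumes S: "S \<in> anomaly_paths L m" and \<gamma>: "1 < \<gamma>" and t: "1 \<le> t" "ln \<gamma> < real t * I"
    and B: "B \<in> sets (obs_filtration L (enat \<nu>))"
  shows "measure (P_change L g f \<nu> S) (B \<inter> {\<omega>\<in>seq_space L. enat (\<nu> + k * t) < M_CUSUM L m g f \<alpha>s (ln \<gamma>) \<omega>})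
    \<le> measure (P_change L g f \<nu> S) B * (real t * V / (real t * I - ln \<gamma>)\<^sup>2) ^ k"
proof -
  interpret obs_process L "\<lambda>k. law L (if k \<le> \<nu> then g0 else pE (S k))"
    by (rule obs_process_change[OF S])
  define PP where "PP = P_change L g f \<nu> S"
  have PP: "P = PP" by (simp add: PP_def P_change_def)
  have sp: "space PP = seq_space L" using space_P by (simp only: PP)
  interpret PP: prob_space PP using prob_space_axioms by (simp only: PP)
  define \<tau> where "\<tau> = M_CUSUM L m g f \<alpha>s (ln \<gamma>)"
  have st: "\<tau> \<in> stopping_times L" unfolding \<tau>_def by (rule M_CUSUM_stopping_time)
  have SE: "S j \<in> \<E>" if "\<nu> < j" for j using S that by (auto simp: anomaly_paths_def)
  define D where "D k = B \<inter> {\<omega>\<in>seq_space L. enat (\<nu> + k * t) < \<tau> \<omega>}" for k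
  have D: "D k \<in> sets (obs_filtration L (enat (\<nu> + k * t)))" for k
    unfolding D_def using B obs_filtration_mono[of "enat \<nu>" "enat (\<nu> + k * t)" L] stopping_times_gt_sets[OF st, of "\<nu> + k * t"]
    by (intro sets.Int) auto
  have DP: "D k \<in> sets PP" for k using filtration_sets_P[OF D] by (simp only: PP)
  let ?d = "real t * V / (real t * I - ln \<gamma>)\<^sup>2"
  have d0: "0 \<le> ?d" using V_nonneg by auto
  define \<mu> where "\<mu> j = (\<integral>x. pE (S j) x * \<phi> x \<partial>obs_space L)" for j
  have pos: "AE \<omega> in PP. \<forall>j. \<nu> < j \<longrightarrow> 0 < q (\<omega> j) \<and> 0 < g0 (\<omega> j)"
  proof (subst AE_all_countable, intro allI)
    fix j show "AE \<omega> in PP. \<nu> < j \<longrightarrow> 0 < q (\<omega> j) \<and> 0 < g0 (\<omega> j)"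
    proof (cases "\<nu> < j")
      case True
      have "AE \<omega> in P. 0 < q (\<omega> j) \<and> 0 < g0 (\<omega> j)"
        using True AE_law_positive[OF measurable_p_anom p_anom_KL(1) p_anom_second_moment(1), OF SE SE SE, OF True True True]
        by (intro AE_component) auto
      then have "AE \<omega> in PP. 0 < q (\<omega> j) \<and> 0 < g0 (\<omega> j)" by (simp only: PP)
      then show ?thesis by eventually_elim simp
    qed simp
  qed
  have step: "measure PP (D (Suc k)) \<le> measure PP (D k) * ?d" for k
  proof -
    let ?J = "{\<nu> + k * t + 1..\<nu> + Suc k * t}"
    let ?G = "{\<omega>\<in>space PP. real t * I - ln \<gamma> \<le> \<bar>\<Sum>j\<in>?J. \<phi> (\<omega> j) - \<mu> j\<bar>}"
    have dev: "measure PP (D k \<inter> ?G) \<le> measure PP (D k) * (real (card ?J) * V / (real t * I - ln \<gamma>)\<^sup>2)"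
      unfolding PP[symmetric]
    proof (rule prob_block_deviation[OF D])
      fix j assume "j \<in> ?J"
      then have j: "\<nu> < j" by auto
      note mom = law_anom_moments[OF SE[OF j] SE[OF j] SE[OF j] SE[OF j] SE[OF j] SE[OF j], folded \<mu>_def]
      show "integrable (law L (if j \<le> \<nu> then g0 else pE (S j))) (\<lambda>x. (\<phi> x - \<mu> j)\<^sup>2)"
        "(\<integral>x. (\<phi> x - \<mu> j)\<^sup>2 \<partial>law L (if j \<le> \<nu> then g0 else pE (S j))) \<le> V"
        "(\<integral>x. \<phi> x - \<mu> j \<partial>law L (if j \<le> \<nu> then g0 else pE (S j))) = 0"
        using mom j by auto
    qed (use t in auto)
    have G: "?G \<in> sets PP"
    proof -
      have [measurable]: "(\<lambda>\<omega>. \<phi> (\<omega> j)) \<in> borel_measurable PP" if "j \<in> ?J" for j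
        unfolding PP[symmetric] using that
        by (intro measurable_PiM_component_rev) (auto simp: law_simps cong: measurable_cong_sets)
      show ?thesis by measurable
    qed
    have "AE \<omega> in PP. \<omega> \<in> D (Suc k) \<longrightarrow> \<omega> \<in> D k \<inter> ?G"
      using pos
    proof eventually_elim
      case (elim \<omega>)
      show ?case
      proof
        assume \<omega>: "\<omega> \<in> D (Suc k)"
        then have gt: "enat (\<nu> + Suc k * t) < \<tau> \<omega>" "\<omega> \<in> B" "\<omega> \<in> seq_space L" by (auto simp: D_def)
        have "enat (\<nu> + k * t) < \<tau> \<omega>" by (rule le_enat_less_trans[OF _ gt(1)]) simp
        then have Dk: "\<omega> \<in> D k" using gt by (simp add: D_def)
        have "\<not> \<gamma> \<le> mix_lr L m g f \<alpha>s (\<nu> + Suc k * t) (\<nu> + k * t) \<omega>"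
        proof
          assume "\<gamma> \<le> mix_lr L m g f \<alpha>s (\<nu> + Suc k * t) (\<nu> + k * t) \<omega>"
          then have "\<tau> \<omega> \<le> enat (\<nu> + Suc k * t)"
            unfolding \<tau>_def M_CUSUM_le_iff using \<gamma> t by (intro exI[of _ "\<nu> + Suc k * t"] exI[of _ "\<nu> + k * t"]) auto
          then show False using gt by simp
        qed
        then have "exp (\<Sum>j\<in>?J. \<phi> (\<omega> j)) < exp (ln \<gamma>)"
          using mix_lr_eq_exp[of "\<nu> + k * t" \<omega> "\<nu> + Suc k * t"] elim \<gamma> by auto
        then have 1: "(\<Sum>j\<in>?J. \<phi> (\<omega> j)) < ln \<gamma>" by (simp only: exp_less_cancel_iff)
        have "(\<Sum>j\<in>?J. I) \<le> (\<Sum>j\<in>?J. \<mu> j)"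
          unfolding \<mu>_def by (intro sum_mono I_le_mean_\<phi> SE) auto
        then have 2: "real t * I \<le> (\<Sum>j\<in>?J. \<mu> j)" by simp
        have "(\<Sum>j\<in>?J. \<phi> (\<omega> j) - \<mu> j) = (\<Sum>j\<in>?J. \<phi> (\<omega> j)) - (\<Sum>j\<in>?J. \<mu> j)"
          by (rule sum_subtractf)
        then have "real t * I - ln \<gamma> \<le> \<bar>\<Sum>j\<in>?J. \<phi> (\<omega> j) - \<mu> j\<bar>" using 1 2 by linarith
        then show "\<omega> \<in> D k \<inter> ?G" using Dk gt sp by blast
      qed
    qed
    then have "measure PP (D (Suc k)) \<le> measure PP (D k \<inter> ?G)"
      using DP G by (intro PP.finite_measure_mono_AE) auto
    also have "\<dots> \<le> measure PP (D k) * ?d" using dev by simp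
    finally show ?thesis .
  qed
  have "measure PP (D k) \<le> measure PP B * ?d ^ k"
  proof (induction k)
    case 0
    have "B \<in> sets PP" using filtration_sets_P[OF B] by (simp only: PP)
    then show ?case by (auto intro!: PP.finite_measure_mono simp: D_def)
  next
    case (Suc k)
    have "measure PP (D (Suc k)) \<le> (measure PP B * ?d ^ k) * ?d"
      using step[of k] mult_right_mono[OF Suc d0] by linarith
    then show ?case by (simp only: power_Suc mult_ac)
  qed
  then show ?thesis unfolding D_def PP_def \<tau>_def .
qed

text \<open>Tail sum of the delay over past events, grouped into blocks of length \<open>t\<close>.
  Allowing any \<open>d\<close> above the failure probability permits an explicit bound to be
  inserted later.\<close>

lemma WADD_M_CUSUM_le:
  assumes \<gamma>: "1 < \<gamma>" and t: "1 \<le> t" "ln \<gamma> < real t * I"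
    and d: "real t * V / (real t * I - ln \<gamma>)\<^sup>2 \<le> d" "d < 1"
  shows "WADD L m g f (M_CUSUM L m g f \<alpha>s (ln \<gamma>)) \<le> ennreal (real t / (1 - d))"
  unfolding WADD_def
proof (intro SUP_least)
  fix S \<nu> assume S: "S \<in> anomaly_paths L m"
  define \<tau> where "\<tau> = M_CUSUM L m g f \<alpha>s (ln \<gamma>)"
  have st: "\<tau> \<in> stopping_times L" unfolding \<tau>_def by (rule M_CUSUM_stopping_time)
  interpret obs_process L "\<lambda>k. law L (if k \<le> \<nu> then g0 else pE (S k))"
    by (rule obs_process_change[OF S])
  define PP where "PP = P_change L g f \<nu> S"
  have PP: "P = PP" by (simp add: PP_def P_change_def)
  have sp: "space PP = seq_space L" using space_P by (simp only: PP)
  interpret PP: prob_space PP using prob_space_axioms by (simp only: PP)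
  let ?d = "real t * V / (real t * I - ln \<gamma>)\<^sup>2"
  have d0: "0 \<le> ?d" using V_nonneg by auto
  have m\<tau>: "\<tau> \<in> measurable PP (count_space UNIV)" using measurable_stopping_times[OF st] by (simp only: PP)
  have "worst_cond_delay L g f \<tau> \<nu> S \<le> ennreal (real t / (1 - d))"
  proof (rule worst_cond_delay_le[OF S st])
    have "1 - d \<le> 1 * real t" using d d0 t by simp
    then show "1 \<le> real t / (1 - d)" using d by (simp add: field_simps)
    fix B assume B: "B \<in> sets (obs_filtration L (enat \<nu>))" "B \<subseteq> {\<omega>. enat \<nu> < \<tau> \<omega>}"
    have BP: "B \<in> sets PP" using filtration_sets_P[OF B(1)] by (simp only: PP)
    have Bsp: "B \<subseteq> space PP" using sets.sets_into_space[OF BP] .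
    \<comment> \<open>Setting the delay to 0 outside \<open>B\<close> turns the integral over
      \<open>B\<close> into the mean of one \<open>enat\<close>-valued variable, to which the
      tail-sum formula applies.\<close>
    define F where "F \<omega> = (if \<omega> \<in> B then \<tau> \<omega> - enat \<nu> else 0)" for \<omega>
    have mF: "F \<in> measurable PP (count_space UNIV)"
      unfolding F_def[abs_def] by (rule measurable_If_set[OF measurable_compose[OF m\<tau>]]) (use BP in auto)
    have gt: "enat n < F \<omega> \<longleftrightarrow> \<omega> \<in> B \<and> enat (\<nu> + n) < \<tau> \<omega>" for n \<omega>
      unfolding F_def by (cases "\<tau> \<omega>") auto
    have "(\<integral>\<^sup>+\<omega>. ennreal_of_enat (\<tau> \<omega> - enat \<nu>) * indicator B \<omega> \<partial>PP) = (\<integral>\<^sup>+\<omega>. ennreal_of_enat (F \<omega>) \<partial>PP)"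
      by (intro nn_integral_cong) (auto simp: F_def indicator_def)
    also have "\<dots> = (\<Sum>n. emeasure PP {\<omega>\<in>space PP. enat n < F \<omega>})"
      by (rule nn_integral_enat_function[OF mF])
    also have "\<dots> = (\<Sum>n. ennreal (measure PP (B \<inter> {\<omega>\<in>seq_space L. enat (\<nu> + n) < \<tau> \<omega>})))"
      unfolding gt PP.emeasure_eq_measure using Bsp
      by (intro suminf_cong arg_cong[where f = ennreal] arg_cong2[where f = measure]) (auto simp: sp)
    also have "\<dots> \<le> ennreal (measure PP B * (real t / (1 - d)))"
    proof (rule suminf_geometric_blocks_le)
      fix n
      have mono: "\<nu> + n div t * t \<le> \<nu> + n" by simp
      have G: "B \<inter> {\<omega>\<in>seq_space L. enat k < \<tau> \<omega>} \<in> sets PP" for k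
      proof -
        have "{\<omega>\<in>seq_space L. enat k < \<tau> \<omega>} \<in> sets PP"
          using filtration_sets_P[OF stopping_times_gt_sets[OF st, of k]] by (simp only: PP)
        then show ?thesis using BP by auto
      qed
      have "measure PP (B \<inter> {\<omega>\<in>seq_space L. enat (\<nu> + n) < \<tau> \<omega>}) \<le> measure PP (B \<inter> {\<omega>\<in>seq_space L. enat (\<nu> + n div t * t) < \<tau> \<omega>})"
        using G by (intro PP.finite_measure_mono) (auto intro: le_enat_less_trans[OF mono])
      also have "\<dots> \<le> measure PP B * ?d ^ (n div t)"
        unfolding PP_def \<tau>_def by (rule M_CUSUM_block_tail[OF S \<gamma> t B(1)])
      also have "\<dots> \<le> measure PP B * d ^ (n div t)"
        using d d0 by (intro mult_left_mono power_mono) auto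
      finally show "measure PP (B \<inter> {\<omega>\<in>seq_space L. enat (\<nu> + n) < \<tau> \<omega>}) \<le> measure PP B * d ^ (n div t)" .
    qed (use t d d0 in auto)
    also have "\<dots> = ennreal (real t / (1 - d)) * emeasure PP B"
      using d by (simp add: PP.emeasure_eq_measure ennreal_mult[symmetric] mult.commute)
    finally show "(\<integral>\<^sup>+\<omega>. ennreal_of_enat (\<tau> \<omega> - enat \<nu>) * indicator B \<omega> \<partial>P_change L g f \<nu> S)
      \<le> ennreal (real t / (1 - d)) * emeasure (P_change L g f \<nu> S) B"
      unfolding PP_def .
  qed
  then show "worst_cond_delay L g f (M_CUSUM L m g f \<alpha>s (ln \<gamma>)) \<nu> S \<le> ennreal (real t / (1 - d))"
    by (simp add: \<tau>_def)
qed

end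

section \<open>Lower bound on the detection delay\<close>

text \<open>If the hazard over windows of length \<open>w\<close> exceeded \<open>w/\<gamma>\<close> at every time, summing it over all times,
  where each value of the stopping time is counted at most \<open>w\<close> times, would give mean less than \<open>\<gamma>\<close>.\<close>

lemma exists_low_hazard:
  fixes s :: "nat \<Rightarrow> real"
  assumes dec: "decseq s" and nn: "\<And>n. 0 \<le> s n" and s0: "s 0 = 1" and w: "1 \<le> w" and \<gamma>: "0 < \<gamma>"
    and ge: "ennreal \<gamma> \<le> (\<Sum>n. ennreal (s n))"
  shows "\<exists>\<nu>. 0 < s \<nu> \<and> \<gamma> * (s \<nu> - s (\<nu> + w)) \<le> real w * s \<nu>"
proof (rule ccontr)
  assume neg: "\<not> ?thesis"
  have strict: "real w * s \<nu> < \<gamma> * (s \<nu> - s (\<nu> + w))" if "0 < s \<nu>" for \<nu>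
    using neg that by (meson not_le)
  have weak: "real w * s \<nu> \<le> \<gamma> * (s \<nu> - s (\<nu> + w))" for \<nu>
  proof (cases "0 < s \<nu>")
    case False
    then have "s \<nu> = 0" using nn[of \<nu>] by simp
    moreover have "s (\<nu> + w) \<le> s \<nu>" using dec by (simp add: decseq_def)
    ultimately show ?thesis using nn[of "\<nu> + w"] by simp
  qed (use strict[of \<nu>] in simp)
  \<comment> \<open>The strict inequality at time 0, where \<open>s 0 = 1\<close>, supplies a
    surplus that survives the summation; the other times contribute weak inequalities only.\<close>
  define e where "e = \<gamma> * (s 0 - s w) - real w * s 0"
  have e: "0 < e" using strict[of 0] s0 by (simp add: e_def)
  have s1: "s n \<le> 1" for n using decseqD[OF dec, of 0 n] s0 by simp
  \<comment> \<open>Telescoping with lag \<open>w\<close>: only the first and the last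
    \<open>w\<close> values survive, and the last ones are nonnegative.\<close>
  have tel: "(\<Sum>\<nu><N. s \<nu> - s (\<nu> + w)) + (\<Sum>i<w. s (N + i)) = (\<Sum>i<w. s i)" for N
  proof (induction N)
    case (Suc N)
    have "s N + (\<Sum>i<w. s (Suc N + i)) = (\<Sum>i<w. s (N + i)) + s (N + w)"
      using sum.lessThan_Suc_shift[of "\<lambda>i. s (N + i)" w] by simp
    then show ?case using Suc by simp
  qed simp
  have "(\<Sum>\<nu><N. s \<nu>) \<le> \<gamma> - e / real w" for N
  proof -
    \<comment> \<open>The sum up to \<open>Suc N\<close> contains time 0, and with it the surplus,
      even for \<open>N = 0\<close>.\<close>
    have "(\<Sum>\<nu><N. s \<nu>) \<le> (\<Sum>\<nu><Suc N. s \<nu>)" using nn[of N] by simp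
    have "real w * (\<Sum>\<nu><Suc N. s \<nu>) + e = (\<Sum>\<nu><Suc N. real w * s \<nu> + (if \<nu> = 0 then e else 0))"
      by (simp add: sum.distrib sum_distrib_left sum.delta del: sum.lessThan_Suc)
    also have "\<dots> \<le> (\<Sum>\<nu><Suc N. \<gamma> * (s \<nu> - s (\<nu> + w)))"
      by (intro sum_mono) (use weak in \<open>auto simp: e_def\<close>)
    also have "\<dots> = \<gamma> * (\<Sum>\<nu><Suc N. s \<nu> - s (\<nu> + w))" by (rule sum_distrib_left[symmetric])
    also have "\<dots> \<le> \<gamma> * (\<Sum>i<w. s i)"
      using tel[of "Suc N"] nn \<gamma> sum_nonneg[of "{..<w}" "\<lambda>i. s (Suc N + i)"] by (intro mult_left_mono) auto
    also have "\<dots> \<le> \<gamma> * real w"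
      using s1 \<gamma> sum_mono[of "{..<w}" s "\<lambda>_. 1"] by (intro mult_left_mono) auto
    finally have "(\<Sum>\<nu><Suc N. s \<nu>) \<le> \<gamma> - e / real w"
      using w by (simp add: field_simps del: sum.lessThan_Suc)
    with \<open>(\<Sum>\<nu><N. s \<nu>) \<le> (\<Sum>\<nu><Suc N. s \<nu>)\<close> show ?thesis by linarith
  qed
  then have "(\<Sum>n. ennreal (s n)) \<le> ennreal (\<gamma> - e / real w)"
    using nn by (intro suminf_le_const) (auto simp: sum_ennreal intro!: ennreal_leI)
  also have "\<dots> < ennreal \<gamma>" using e w \<gamma> by (intro ennreal_lessI) auto
  finally show False using ge by simp
qed

context optimal_mixture
begin

text \<open>The delay is at least \<open>w\<close> on \<tau> > \<nu> + w, and a mean is at most an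
  essential supremum. Clearing the denominator leaves a form that can be averaged over
  paths.\<close>

lemma worst_cond_delay_ge:
  assumes S: "S \<in> anomaly_paths L m" and st: "\<tau> \<in> stopping_times L"
    and pos: "emeasure (P_change L g f \<nu> S) {\<omega>\<in>seq_space L. enat \<nu> < \<tau> \<omega>} \<noteq> 0"
  shows "of_nat w * emeasure (P_change L g f \<nu> S) {\<omega>\<in>seq_space L. enat (\<nu> + w) < \<tau> \<omega>}
    \<le> worst_cond_delay L g f \<tau> \<nu> S * emeasure (P_change L g f \<nu> S) {\<omega>\<in>seq_space L. enat \<nu> < \<tau> \<omega>}"
proof -
  interpret obs_process L "\<lambda>k. law L (if k \<le> \<nu> then g0 else pE (S k))"
    by (rule obs_process_change[OF S])
  define PP where "PP = P_change L g f \<nu> S"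
  have PP: "P = PP" by (simp add: PP_def P_change_def)
  let ?F = "obs_filtration L (enat \<nu>)"
  define A where "A = {\<omega>\<in>seq_space L. enat \<nu> < \<tau> \<omega>}"
  define D where "D = {\<omega>\<in>seq_space L. enat (\<nu> + w) < \<tau> \<omega>}"
  define Q where "Q = uniform_measure PP A"
  define X where "X \<omega> = ennreal_of_enat (\<tau> \<omega> - enat \<nu>)" for \<omega>
  have sp: "space PP = seq_space L" using space_P by (simp only: PP)
  have FP: "B \<in> sets (obs_filtration L k) \<Longrightarrow> B \<in> sets PP" for B k using filtration_sets_P[of B] by (simp only: PP)
  have AP: "A \<in> sets PP" unfolding A_def by (rule FP[OF stopping_times_gt_sets[OF st]])
  have DP: "D \<in> sets PP" unfolding D_def by (rule FP[OF stopping_times_gt_sets[OF st]])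
  have m\<tau>: "\<tau> \<in> measurable PP (count_space UNIV)" using measurable_stopping_times[OF st] by (simp only: PP)
  have mX: "X \<in> borel_measurable PP"
    unfolding X_def[abs_def] by (rule measurable_compose[OF m\<tau>]) simp
  have pos': "emeasure PP A \<noteq> 0" using pos by (simp add: PP_def A_def)
  have wcd: "worst_cond_delay L g f \<tau> \<nu> S = esssup Q (nn_cond_exp Q ?F X)"
    unfolding worst_cond_delay_def Let_def PP_def[symmetric] sp A_def[symmetric] Q_def[symmetric] X_def[abs_def]
    using pos' by simp
  have probPP: "prob_space PP" using prob_space_axioms by (simp only: PP)
  interpret PP: prob_space PP by (rule probPP)
  interpret Q: prob_space Q
    unfolding Q_def using pos' by (intro prob_space_uniform_measure) auto
  have setsQ: "sets Q = sets PP" "space Q = space PP" by (auto simp: Q_def)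
  have sub: "subalgebra Q ?F"
    using FP by (auto simp: subalgebra_def setsQ sp space_obs_filtration)
  interpret finite_measure_subalgebra Q ?F
    by standard (rule sub)
  have mXQ: "X \<in> borel_measurable Q" using mX by (simp add: Q_def)
  have "of_nat w * emeasure PP D = (\<integral>\<^sup>+\<omega>. of_nat w * indicator D \<omega> \<partial>PP)"
    using DP by (simp add: nn_integral_cmult)
  also have "\<dots> \<le> (\<integral>\<^sup>+\<omega>. X \<omega> * indicator A \<omega> \<partial>PP)"
  proof (rule nn_integral_mono)
    fix \<omega>
    show "of_nat w * indicator D \<omega> \<le> X \<omega> * indicator A \<omega>"
    proof (cases "\<omega> \<in> D")
      case True
      then have gt: "enat (\<nu> + w) < \<tau> \<omega>" "\<omega> \<in> seq_space L" by (auto simp: D_def)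
      have "enat \<nu> < \<tau> \<omega>" by (rule le_enat_less_trans[OF _ gt(1)]) simp
      then have "\<omega> \<in> A" using gt by (simp add: A_def)
      moreover have "of_nat w \<le> X \<omega>" unfolding X_def
        using gt by (cases "\<tau> \<omega>") auto
      ultimately show ?thesis using True by simp
    qed simp
  qed
  finally have "of_nat w * emeasure PP D / emeasure PP A \<le> (\<integral>\<^sup>+\<omega>. X \<omega> * indicator A \<omega> \<partial>PP) / emeasure PP A"
    by (rule divide_right_mono_ennreal)
  also have "\<dots> = (\<integral>\<^sup>+\<omega>. X \<omega> \<partial>Q)"
    unfolding Q_def by (rule nn_integral_uniform_measure[OF mX AP, symmetric])
  also have "\<dots> = (\<integral>\<^sup>+\<omega>. nn_cond_exp Q ?F X \<omega> \<partial>Q)"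
    using nn_cond_exp_intg[of "\<lambda>_. 1" X] mXQ by simp
  also have "\<dots> \<le> (\<integral>\<^sup>+\<omega>. esssup Q (nn_cond_exp Q ?F X) \<partial>Q)"
    by (intro nn_integral_mono_AE esssup_AE)
  also have "\<dots> = worst_cond_delay L g f \<tau> \<nu> S"
    unfolding wcd by (simp add: Q.emeasure_space_1)
  finally have "of_nat w * emeasure PP D / emeasure PP A * emeasure PP A \<le> worst_cond_delay L g f \<tau> \<nu> S * emeasure PP A"
    by (rule mult_right_mono) simp
  moreover have "of_nat w * emeasure PP D / emeasure PP A * emeasure PP A = of_nat w * emeasure PP D"
    using pos' by (simp add: ennreal_divide_times PP.emeasure_eq_measure ennreal_divide_self less_top[symmetric])
  ultimately show ?thesis by (simp add: PP_def A_def D_def)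
qed

text \<open>Independent positions drawn from \<open>\<alpha>s\<close> turn the anomaly into an i.i.d. sequence of density \<open>q\<close>, so
  \<open>Pq\<close> is an average of the measures of the anomaly paths.\<close>

lemma Pq_le_of_paths:
  assumes D: "D \<in> sets (obs_filtration L (enat n))"
    and le: "\<And>S. S \<in> anomaly_paths L m \<Longrightarrow> c * emeasure (P_change L g f \<nu> S) D \<le> M"
  shows "c * emeasure (Pq \<nu>) D \<le> M"
proof -
  let ?J = "{\<nu>+1..n}"
  let ?\<Pi> = "?J \<rightarrow>\<^sub>E \<E>"
  obtain E0 where E0: "E0 \<in> \<E>" using anomaly_sets_nonempty by blast
  \<comment> \<open>Outside the window the position is arbitrary: \<open>D\<close> does not see
    times after \<open>n\<close>, and up to \<nu> nothing is anomalous.\<close>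
  define ext where "ext S j = (if j \<in> ?J then S j else E0)" for S :: "nat \<Rightarrow> nat set" and j
  have ext: "ext S \<in> anomaly_paths L m" if "S \<in> ?\<Pi>" for S
    using that E0 unfolding anomaly_paths_def ext_def by auto
  have fin: "finite ?\<Pi>" using finite_anomaly_sets by (intro finite_PiE) auto
  define c' where "c' S = (\<Prod>j\<in>?J. \<alpha>s (S j))" for S
  define r where "r S \<omega> = (\<Prod>j\<in>?J. pE (S j) (\<omega> j) / g0 (\<omega> j))" for S \<omega>
  have c'0: "0 \<le> c' S" if "S \<in> ?\<Pi>" for S
    unfolding c'_def using that by (auto simp: PiE_iff intro!: prod_nonneg simplex_nonneg[OF \<alpha>s_simplex])
  have r0: "0 \<le> r S \<omega>" if "S \<in> ?\<Pi>" for S \<omega>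
    unfolding r_def using that
    by (auto simp: PiE_iff intro!: prod_nonneg divide_nonneg_nonneg p_anom_nonneg g_joint_nonneg)
  have "mix_lr L m g f \<alpha>s n \<nu> \<omega> = (\<Prod>j\<in>?J. \<Sum>E\<in>\<E>. \<alpha>s E * (pE E (\<omega> j) / g0 (\<omega> j)))" for \<omega>
    unfolding mix_lr_def p_mix_def by (simp add: sum_divide_distrib)
  \<comment> \<open>Expanding the product of sums yields one term per path on the window;
    \<open>c'\<close> is the probability that independent draws from \<open>\<alpha>s\<close>
    produce that path.\<close>
  also have "\<dots> \<omega> = (\<Sum>S\<in>?\<Pi>. \<Prod>j\<in>?J. \<alpha>s (S j) * (pE (S j) (\<omega> j) / g0 (\<omega> j)))" for \<omega>
    by (rule prod_sum_PiE) (auto simp: finite_anomaly_sets)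
  finally have lr: "mix_lr L m g f \<alpha>s n \<nu> \<omega> = (\<Sum>S\<in>?\<Pi>. c' S * r S \<omega>)" for \<omega>
    unfolding c'_def r_def by (simp only: prod.distrib)
  have sum1: "(\<Sum>S\<in>?\<Pi>. c' S) = 1"
  proof -
    have "(\<Sum>S\<in>?\<Pi>. c' S) = (\<Prod>j\<in>?J. \<Sum>E\<in>\<E>. \<alpha>s E)"
      unfolding c'_def by (rule prod_sum_PiE[symmetric]) (auto simp: finite_anomaly_sets)
    then show ?thesis using \<alpha>s_simplex by (simp add: mixing_simplex_def)
  qed
  have mr: "r S \<in> borel_measurable (P_infty L g)" if "S \<in> ?\<Pi>" for S
    unfolding r_def P_infty_def using that
    by (intro borel_measurable_prod borel_measurable_divide measurable_PiM_component_rev)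
      (auto simp: law_def PiE_iff intro!: measurable_p_anom)
  have DP: "D \<in> sets (P_infty L g)"
    unfolding P_infty_def by (rule obs_process.filtration_sets_P[OF obs_process_infty D])
  have PS: "emeasure (P_change L g f \<nu> (ext S)) D = (\<integral>\<^sup>+\<omega>. ennreal (r S \<omega>) * indicator D \<omega> \<partial>P_infty L g)" if "S \<in> ?\<Pi>" for S
    unfolding emeasure_P_change[OF ext[OF that] D] r_def
    by (intro nn_integral_cong arg_cong2[where f = "(*)"] arg_cong[where f = ennreal] prod.cong refl) (simp add: ext_def)
  have "emeasure (Pq \<nu>) D = (\<integral>\<^sup>+\<omega>. (\<Sum>S\<in>?\<Pi>. ennreal (c' S) * (ennreal (r S \<omega>) * indicator D \<omega>)) \<partial>P_infty L g)"
    unfolding emeasure_Pq[OF D] lr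
  proof (intro nn_integral_cong)
    fix \<omega>
    have "ennreal (\<Sum>S\<in>?\<Pi>. c' S * r S \<omega>) = (\<Sum>S\<in>?\<Pi>. ennreal (c' S * r S \<omega>))"
      using c'0 r0 by (intro sum_ennreal[symmetric] mult_nonneg_nonneg) auto
    also have "\<dots> = (\<Sum>S\<in>?\<Pi>. ennreal (c' S) * ennreal (r S \<omega>))"
      using c'0 r0 by (intro sum.cong refl ennreal_mult) auto
    finally show "ennreal (\<Sum>S\<in>?\<Pi>. c' S * r S \<omega>) * indicator D \<omega> = (\<Sum>S\<in>?\<Pi>. ennreal (c' S) * (ennreal (r S \<omega>) * indicator D \<omega>))"
      by (simp only: sum_distrib_right mult.assoc)
  qed
  also have "\<dots> = (\<Sum>S\<in>?\<Pi>. ennreal (c' S) * emeasure (P_change L g f \<nu> (ext S)) D)"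
    using mr DP by (subst nn_integral_sum) (auto simp: PS nn_integral_cmult intro!: sum.cong)
  finally have "c * emeasure (Pq \<nu>) D = (\<Sum>S\<in>?\<Pi>. ennreal (c' S) * (c * emeasure (P_change L g f \<nu> (ext S)) D))"
    by (simp add: sum_distrib_left mult_ac)
  also have "\<dots> \<le> (\<Sum>S\<in>?\<Pi>. ennreal (c' S) * M)"
    using le ext by (intro sum_mono mult_left_mono) auto
  also have "\<dots> = ennreal (\<Sum>S\<in>?\<Pi>. c' S) * M"
    using c'0 by (simp only: sum_distrib_right[symmetric] sum_ennreal)
  finally show ?thesis by (simp only: sum1 ennreal_1 mult_1)
qed

text \<open>Split at the level \<open>exp a\<close> of the likelihood ratio. Below it, the change of
  measure costs at most the factor \<open>exp a\<close>; above it, a sum of \<open>w\<close> terms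
  of mean \<open>I\<close> exceeds \<open>a\<close>, which Chebyshev bounds given \<tau> > \<nu>.
  The ratio at the end of the window can be used throughout because the event is decided by
  then.\<close>

lemma Pq_window_le:
  assumes st: "\<tau> \<in> stopping_times L" and w: "1 \<le> w" and a: "real w * I < a"
  shows "measure (Pq \<nu>) {\<omega>\<in>seq_space L. enat \<nu> < \<tau> \<omega> \<and> \<tau> \<omega> \<le> enat (\<nu> + w)}
    \<le> exp a * measure (P_infty L g) {\<omega>\<in>seq_space L. enat \<nu> < \<tau> \<omega> \<and> \<tau> \<omega> \<le> enat (\<nu> + w)}
      + measure (P_infty L g) {\<omega>\<in>seq_space L. enat \<nu> < \<tau> \<omega>} * (real w * V / (a - real w * I)\<^sup>2)"
proof -
  interpret obs_process L "\<lambda>k. law L (if k \<le> \<nu> then g0 else q)" by (rule obs_process_q)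
  have PP: "P = Pq \<nu>" by (simp add: Pq_def)
  have sp: "space (Pq \<nu>) = seq_space L" using space_P by (simp only: PP)
  interpret PP: prob_space "Pq \<nu>" using prob_space_axioms by (simp only: PP)
  interpret inf: prob_space "P_infty L g"
    unfolding P_infty_def by (intro prob_space_PiM prob_space_law_g)
  let ?n = "\<nu> + w" and ?J = "{\<nu>+1..\<nu>+w}"
  let ?lr = "mix_lr L m g f \<alpha>s ?n \<nu>"
  define A where "A = {\<omega>\<in>seq_space L. enat \<nu> < \<tau> \<omega>}"
  define W where "W = {\<omega>\<in>seq_space L. enat \<nu> < \<tau> \<omega> \<and> \<tau> \<omega> \<le> enat ?n}"
  define G where "G = {\<omega>\<in>seq_space L. exp a < ?lr \<omega>}"
  have AF: "A \<in> sets (obs_filtration L (enat \<nu>))" unfolding A_def by (rule stopping_times_gt_sets[OF st])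
  have WF: "W \<in> sets (obs_filtration L (enat ?n))"
  proof -
    have "W = A \<inter> {\<omega>\<in>seq_space L. \<tau> \<omega> \<le> enat ?n}" by (auto simp: W_def A_def)
    moreover have "A \<in> sets (obs_filtration L (enat ?n))"
      using AF obs_filtration_mono[of "enat \<nu>" "enat ?n" L] by auto
    ultimately show ?thesis using stopping_times_le_sets[OF st, of ?n] by auto
  qed
  have GF: "G \<in> sets (obs_filtration L (enat ?n))"
  proof -
    note measurable_mix_lr[OF order_refl, of \<alpha>s ?n \<nu>, measurable]
    have "{\<omega>\<in>space (obs_filtration L (enat ?n)). exp a < ?lr \<omega>} \<in> sets (obs_filtration L (enat ?n))" by measurable
    then show ?thesis by (simp add: G_def space_obs_filtration)
  qed
  have WG: "W \<inter> G \<in> sets (obs_filtration L (enat ?n))" using WF GF by auto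
  have infP: "B \<in> sets (obs_filtration L k) \<Longrightarrow> B \<in> sets (P_infty L g)" for B k
    unfolding P_infty_def by (rule obs_process.filtration_sets_P[OF obs_process_infty])
  have mlr: "?lr \<in> borel_measurable (P_infty L g)"
    unfolding mix_lr_def P_infty_def
    by (intro borel_measurable_prod borel_measurable_divide measurable_PiM_component_rev)
      (auto simp: law_def)
  have "emeasure (Pq \<nu>) W \<le> ennreal (exp a) * emeasure (P_infty L g) W + emeasure (Pq \<nu>) (W \<inter> G)"
  proof -
    have "emeasure (Pq \<nu>) W \<le> (\<integral>\<^sup>+\<omega>. ennreal (exp a) * indicator W \<omega> + ennreal (?lr \<omega>) * indicator (W \<inter> G) \<omega> \<partial>P_infty L g)"
      unfolding emeasure_Pq[OF WF]
    proof (rule nn_integral_mono)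
      fix \<omega>
      show "ennreal (?lr \<omega>) * indicator W \<omega> \<le> ennreal (exp a) * indicator W \<omega> + ennreal (?lr \<omega>) * indicator (W \<inter> G) \<omega>"
        by (cases "\<omega> \<in> W"; cases "\<omega> \<in> G") (auto simp: G_def W_def intro!: ennreal_leI)
    qed
    also have "\<dots> = ennreal (exp a) * emeasure (P_infty L g) W + emeasure (Pq \<nu>) (W \<inter> G)"
      unfolding emeasure_Pq[OF WG] using infP[OF WF] infP[OF WG] mlr by (simp add: nn_integral_add nn_integral_cmult)
    finally show ?thesis .
  qed
  also have "\<dots> = ennreal (exp a * measure (P_infty L g) W + measure (Pq \<nu>) (W \<inter> G))"
    by (simp add: PP.emeasure_eq_measure inf.emeasure_eq_measure ennreal_mult' ennreal_plus)
  finally have 1: "measure (Pq \<nu>) W \<le> exp a * measure (P_infty L g) W + measure (Pq \<nu>) (W \<inter> G)"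
    by (simp add: PP.emeasure_eq_measure del: ennreal_plus)
  let ?H = "{\<omega>\<in>space (Pq \<nu>). a - real w * I \<le> \<bar>\<Sum>j\<in>?J. \<phi> (\<omega> j) - I\<bar>}"
  have dev: "measure (Pq \<nu>) (A \<inter> ?H) \<le> measure (Pq \<nu>) A * (real (card ?J) * V / (a - real w * I)\<^sup>2)"
    unfolding PP[symmetric]
  proof (rule prob_block_deviation[OF AF])
    fix j assume "j \<in> ?J"
    then have j: "\<nu> < j" by auto
    show "integrable (law L (if j \<le> \<nu> then g0 else q)) (\<lambda>x. (\<phi> x - I)\<^sup>2)"
      "(\<integral>x. (\<phi> x - I)\<^sup>2 \<partial>law L (if j \<le> \<nu> then g0 else q)) \<le> V"
      "(\<integral>x. \<phi> x - I \<partial>law L (if j \<le> \<nu> then g0 else q)) = 0"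
      using law_q_moments j by auto
  qed (use w a in auto)
  have H: "?H \<in> sets (Pq \<nu>)"
  proof -
    have [measurable]: "(\<lambda>\<omega>. \<phi> (\<omega> j)) \<in> borel_measurable (Pq \<nu>)" if "j \<in> ?J" for j
      unfolding PP[symmetric] using that
      by (intro measurable_PiM_component_rev) (auto simp: law_simps cong: measurable_cong_sets)
    show ?thesis by measurable
  qed
  have pos: "AE \<omega> in Pq \<nu>. \<forall>j. \<nu> < j \<longrightarrow> 0 < q (\<omega> j) \<and> 0 < g0 (\<omega> j)"
  proof (subst AE_all_countable, intro allI)
    fix j show "AE \<omega> in Pq \<nu>. \<nu> < j \<longrightarrow> 0 < q (\<omega> j) \<and> 0 < g0 (\<omega> j)"
    proof (cases "\<nu> < j")
      case True
      have "AE \<omega> in P. 0 < q (\<omega> j) \<and> 0 < g0 (\<omega> j)"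
        using True AE_law_positive[OF measurable_p_mix q_ac] by (intro AE_component) auto
      then have "AE \<omega> in Pq \<nu>. 0 < q (\<omega> j) \<and> 0 < g0 (\<omega> j)" by (simp only: PP)
      then show ?thesis by eventually_elim simp
    qed simp
  qed
  have "AE \<omega> in Pq \<nu>. \<omega> \<in> W \<inter> G \<longrightarrow> \<omega> \<in> A \<inter> ?H"
    using pos
  proof eventually_elim
    case (elim \<omega>)
    show ?case
    proof
      assume \<omega>: "\<omega> \<in> W \<inter> G"
      then have "exp a < exp (\<Sum>j\<in>?J. \<phi> (\<omega> j))"
        using mix_lr_eq_exp[of \<nu> \<omega> ?n] elim by (auto simp: G_def)
      then have "a < (\<Sum>j\<in>?J. \<phi> (\<omega> j))" by (simp only: exp_less_cancel_iff)
      moreover have "(\<Sum>j\<in>?J. \<phi> (\<omega> j) - I) = (\<Sum>j\<in>?J. \<phi> (\<omega> j)) - real w * I"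
        by (simp add: sum_subtractf)
      ultimately have "a - real w * I \<le> \<bar>\<Sum>j\<in>?J. \<phi> (\<omega> j) - I\<bar>" by linarith
      then show "\<omega> \<in> A \<inter> ?H" using \<omega> sp by (auto simp: W_def A_def)
    qed
  qed
  then have "measure (Pq \<nu>) (W \<inter> G) \<le> measure (Pq \<nu>) (A \<inter> ?H)"
    using H filtration_sets_P[OF AF, unfolded PP] by (intro PP.finite_measure_mono_AE) auto
  also have "\<dots> \<le> measure (Pq \<nu>) A * (real w * V / (a - real w * I)\<^sup>2)" using dev by simp
  also have "measure (Pq \<nu>) A = measure (P_infty L g) A"
    using emeasure_pre_change(1)[OF AF] by (simp add: measure_def)
  finally show ?thesis using 1 unfolding W_def A_def by linarith
qed

text \<open>The changepoint is chosen for the rule by the hazard bound, which the supremum in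
  \<open>WADD\<close> permits. Of the two losses, \<open>exp a * real w / \<gamma>\<close> is the
  hazard \<open>w / \<gamma>\<close> under \<open>P_infty\<close> transported at cost
  \<open>exp a\<close>; the other is the Chebyshev term.\<close>

lemma WADD_ge:
  assumes \<tau>: "\<tau> \<in> C_class L g \<gamma>" and \<gamma>: "0 < \<gamma>" and w: "1 \<le> w" and a: "real w * I < a"
  shows "ennreal (real w * (1 - exp a * real w / \<gamma> - real w * V / (a - real w * I)\<^sup>2)) \<le> WADD L m g f \<tau>"
proof -
  interpret obs_process L "\<lambda>_. law L g0" by (rule obs_process_infty)
  have PP: "P = P_infty L g" by (simp add: P_infty_def)
  interpret inf: prob_space "P_infty L g" using prob_space_axioms by (simp only: PP)
  have sp: "space (P_infty L g) = seq_space L" using space_P by (simp only: PP)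
  have st: "\<tau> \<in> stopping_times L" and mean: "ennreal \<gamma> \<le> mean_time_false_alarm L g \<tau>"
    using \<tau> by (auto simp: C_class_def)
  let ?A = "\<lambda>n. {\<omega>\<in>seq_space L. enat n < \<tau> \<omega>}"
  define s where "s n = measure (P_infty L g) (?A n)" for n
  have AP: "?A n \<in> sets (P_infty L g)" for n
    using filtration_sets_P[OF stopping_times_gt_sets[OF st]] by (simp only: PP)
  have "\<exists>\<nu>. 0 < s \<nu> \<and> \<gamma> * (s \<nu> - s (\<nu> + w)) \<le> real w * s \<nu>"
  proof (rule exists_low_hazard[OF _ _ _ w \<gamma>])
    show "decseq s"
      unfolding decseq_def s_def using AP by (auto intro!: inf.finite_measure_mono intro: le_enat_less_trans)
    \<comment> \<open>Stopping times are positive, so no mass is lost at time 0.\<close>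
    have "?A 0 = space (P_infty L g)" using st by (auto simp: sp stopping_times_def zero_enat_def)
    then show "s 0 = 1" unfolding s_def by (simp add: inf.prob_space)
    have "mean_time_false_alarm L g \<tau> = (\<Sum>n. ennreal (s n))"
      unfolding mean_time_false_alarm_def s_def inf.emeasure_eq_measure[symmetric]
      using nn_integral_stopping_time[OF st] by (simp only: PP)
    then show "ennreal \<gamma> \<le> (\<Sum>n. ennreal (s n))" using mean by simp
  qed (simp add: s_def)
  then obtain \<nu> where \<nu>: "0 < s \<nu>" "\<gamma> * (s \<nu> - s (\<nu> + w)) \<le> real w * s \<nu>" by blast
  let ?W = "{\<omega>\<in>seq_space L. enat \<nu> < \<tau> \<omega> \<and> \<tau> \<omega> \<le> enat (\<nu> + w)}"
  have W_eq: "?W = ?A \<nu> - ?A (\<nu> + w)" by (auto simp: not_less)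
  have sub: "?A (\<nu> + w) \<subseteq> ?A \<nu>" by (auto intro: le_enat_less_trans[of \<nu> "\<nu> + w"])
  have QP: "Pq \<nu> = PiM {1..} (\<lambda>k. law L (if k \<le> \<nu> then g0 else q))" by (rule Pq_def)
  interpret Q: prob_space "Pq \<nu>"
    unfolding QP using prob_space_law_g prob_space_law_q by (intro prob_space_PiM) auto
  have AQ: "?A n \<in> sets (Pq \<nu>)" for n
    unfolding QP by (rule obs_process.filtration_sets_P[OF obs_process_q stopping_times_gt_sets[OF st]])
  have Q\<nu>: "measure (Pq \<nu>) (?A \<nu>) = s \<nu>"
    using emeasure_pre_change(1)[OF stopping_times_gt_sets[OF st]] by (simp add: measure_def s_def)
  have Winf: "measure (P_infty L g) ?W = s \<nu> - s (\<nu> + w)"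
    unfolding W_eq s_def using AP sub by (intro inf.finite_measure_Diff) auto
  have WQ: "measure (Pq \<nu>) ?W = s \<nu> - measure (Pq \<nu>) (?A (\<nu> + w))"
    unfolding W_eq Q\<nu>[symmetric] using AQ sub by (intro Q.finite_measure_Diff) auto
  have "s \<nu> - s (\<nu> + w) \<le> real w * s \<nu> / \<gamma>" using \<nu>(2) \<gamma> by (simp add: field_simps)
  then have "exp a * (s \<nu> - s (\<nu> + w)) \<le> exp a * (real w * s \<nu> / \<gamma>)" by (intro mult_left_mono) auto
  then have "measure (Pq \<nu>) ?W \<le> exp a * (real w * s \<nu> / \<gamma>) + s \<nu> * (real w * V / (a - real w * I)\<^sup>2)"
    using Pq_window_le[OF st w a, of \<nu>] unfolding Winf s_def[symmetric] by linarith
  then have x: "s \<nu> * (1 - exp a * real w / \<gamma> - real w * V / (a - real w * I)\<^sup>2) \<le> measure (Pq \<nu>) (?A (\<nu> + w))"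
    unfolding WQ by (simp add: algebra_simps)
  \<comment> \<open>The right-hand side is the same for every path, as averaging requires: \<tau> >
    \<nu> has probability \<open>s \<nu>\<close> under each of them.\<close>
  have "of_nat w * emeasure (Pq \<nu>) (?A (\<nu> + w)) \<le> WADD L m g f \<tau> * ennreal (s \<nu>)"
  proof (rule Pq_le_of_paths[OF stopping_times_gt_sets[OF st]])
    fix S assume S: "S \<in> anomaly_paths L m"
    have e: "emeasure (P_change L g f \<nu> S) (?A \<nu>) = ennreal (s \<nu>)"
      using emeasure_pre_change(2)[OF stopping_times_gt_sets[OF st] S] by (simp add: s_def inf.emeasure_eq_measure)
    have "of_nat w * emeasure (P_change L g f \<nu> S) (?A (\<nu> + w)) \<le> worst_cond_delay L g f \<tau> \<nu> S * emeasure (P_change L g f \<nu> S) (?A \<nu>)"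
      using e \<nu>(1) by (intro worst_cond_delay_ge[OF S st]) simp
    also have "\<dots> \<le> WADD L m g f \<tau> * ennreal (s \<nu>)"
      unfolding e WADD_def using S by (intro mult_right_mono SUP_upper2[OF S] SUP_upper) auto
    finally show "of_nat w * emeasure (P_change L g f \<nu> S) (?A (\<nu> + w)) \<le> WADD L m g f \<tau> * ennreal (s \<nu>)" .
  qed
  then have le: "ennreal (real w * measure (Pq \<nu>) (?A (\<nu> + w))) \<le> WADD L m g f \<tau> * ennreal (s \<nu>)"
    by (simp add: Q.emeasure_eq_measure ennreal_mult' ennreal_of_nat_eq_real_of_nat)
  show ?thesis
  proof (cases "WADD L m g f \<tau>")
    case (real W)
    have "real w * measure (Pq \<nu>) (?A (\<nu> + w)) \<le> W * s \<nu>"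
      using le real \<nu>(1) by (simp add: ennreal_mult[symmetric])
    moreover have "real w * (s \<nu> * (1 - exp a * real w / \<gamma> - real w * V / (a - real w * I)\<^sup>2)) \<le> real w * measure (Pq \<nu>) (?A (\<nu> + w))"
      using x by (intro mult_left_mono) auto
    ultimately have "s \<nu> * (real w * (1 - exp a * real w / \<gamma> - real w * V / (a - real w * I)\<^sup>2)) \<le> s \<nu> * W"
      by (simp add: mult_ac)
    then have "real w * (1 - exp a * real w / \<gamma> - real w * V / (a - real w * I)\<^sup>2) \<le> W"
      using \<nu>(1) by simp
    then show ?thesis using real by (simp add: ennreal_leI)
  qed simp
qed

end

section \<open>Asymptotic optimality\<close>

text \<open>Both functions lie between \<open>(1 - e) s\<close> and \<open>(1 + e) s\<close>, so
  their ratio tends to 1. The case \<open>e = 1/2\<close> makes both eventually finite and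
  \<open>u\<close> positive, hence the ratio can be formed in the reals and the required identity is
  exact.\<close>

lemma ext_asymp_equiv_squeeze:
  fixes u v :: "real \<Rightarrow> ennreal" and s :: "real \<Rightarrow> real"
  assumes s: "\<forall>\<^sub>F x in at_top. 0 < s x"
    and u: "\<And>e. 0 < e \<Longrightarrow> e < 1 \<Longrightarrow> \<forall>\<^sub>F x in at_top. ennreal ((1 - e) * s x) \<le> u x \<and> u x \<le> ennreal ((1 + e) * s x)"
    and v: "\<And>e. 0 < e \<Longrightarrow> e < 1 \<Longrightarrow> \<forall>\<^sub>F x in at_top. ennreal ((1 - e) * s x) \<le> v x \<and> v x \<le> ennreal ((1 + e) * s x)"
  shows "ext_asymp_equiv u v"
proof -
  have real_bounds: "\<exists>r. z = ennreal r \<and> (1 - e) * t \<le> r \<and> r \<le> (1 + e) * t"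
    if "ennreal ((1 - e) * t) \<le> z" "z \<le> ennreal ((1 + e) * t)" "0 < t" "0 < e" "e < 1" for z e t
  proof (cases z)
    case (real r)
    have "0 \<le> (1 + e) * t" using that by simp
    with real that have "r \<le> (1 + e) * t" "(1 - e) * t \<le> r" by (auto simp: ennreal_le_iff)
    with real show ?thesis by auto
  next
    case top
    with that show ?thesis by (simp add: top_unique)
  qed
  have lim: "((\<lambda>x. enn2real (w x) / s x) \<longlongrightarrow> 1) at_top"
    if w: "\<And>e. 0 < e \<Longrightarrow> e < 1 \<Longrightarrow> \<forall>\<^sub>F x in at_top. ennreal ((1 - e) * s x) \<le> w x \<and> w x \<le> ennreal ((1 + e) * s x)"
    for w :: "real \<Rightarrow> ennreal"
  proof (rule tendstoI)
    fix d :: real assume "0 < d"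
    define e where "e = min (d / 2) (1 / 2)"
    have e: "0 < e" "e < 1" "e < d" using \<open>0 < d\<close> by (auto simp: e_def min_def)
    show "\<forall>\<^sub>F x in at_top. dist (enn2real (w x) / s x) 1 < d"
      using w[OF e(1,2)] s
    proof eventually_elim
      case (elim x)
      then obtain r where r: "w x = ennreal r" "(1 - e) * s x \<le> r" "r \<le> (1 + e) * s x"
        using real_bounds[of e "s x" "w x"] e by auto
      have "0 \<le> (1 - e) * s x" using e elim by simp
      then have "0 \<le> r" using r by linarith
      have "1 - e \<le> r / s x" "r / s x \<le> 1 + e"
        using r elim by (simp_all add: pos_le_divide_eq pos_divide_le_eq)
      then show ?case using r \<open>0 \<le> r\<close> e by (simp add: dist_real_def abs_if)
    qed
  qed
  have half: "(0::real) < 1/2" "1/2 < (1::real)" by auto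
  let ?\<epsilon> = "\<lambda>x. enn2real (v x) / enn2real (u x) - 1"
  have "((\<lambda>x. (enn2real (v x) / s x) / (enn2real (u x) / s x) - 1) \<longlongrightarrow> 1 / 1 - 1) at_top"
    by (intro tendsto_intros lim u v) auto
  then have "((\<lambda>x. (enn2real (v x) / s x) / (enn2real (u x) / s x) - 1) \<longlongrightarrow> 0) at_top"
    by simp
  moreover have "\<forall>\<^sub>F x in at_top. (enn2real (v x) / s x) / (enn2real (u x) / s x) - 1 = ?\<epsilon> x"
    using s by eventually_elim simp
  ultimately have "(?\<epsilon> \<longlongrightarrow> 0) at_top" by (rule Lim_transform_eventually)
  moreover have "\<forall>\<^sub>F x in at_top. v x = u x * ennreal (1 + ?\<epsilon> x)"
    using u[OF half] v[OF half] s
  proof eventually_elim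
    case (elim x)
    from elim obtain r where r: "u x = ennreal r" "(1 - 1/2) * s x \<le> r" using real_bounds[of "1/2" "s x" "u x"] by auto
    from elim obtain r' where r': "v x = ennreal r'" "(1 - 1/2) * s x \<le> r'" using real_bounds[of "1/2" "s x" "v x"] by auto
    have "0 < r" "0 \<le> r'" using r r' elim by auto
    then show ?case unfolding r r' by (simp add: ennreal_mult[symmetric])
  qed
  ultimately show ?thesis unfolding ext_asymp_equiv_def by blast
qed

lemma inverse_ln_tendsto_0: "((\<lambda>x::real. inverse (ln x)) \<longlongrightarrow> 0) at_top"
  by (rule tendsto_inverse_0_at_top[OF ln_at_top])

context optimal_mixture
begin

lemma eventually_WADD_M_CUSUM_le:
  assumes e: "0 < e" "e < 1"
  shows "\<forall>\<^sub>F \<gamma> in at_top. WADD L m g f (M_CUSUM L m g f \<alpha>s (ln \<gamma>)) \<le> ennreal ((1 + e) * (ln \<gamma> / I))"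
proof -
  let ?y = "\<lambda>\<gamma>. inverse (ln \<gamma>)"
  \<comment> \<open>Block length about \<open>(1 + e/3) ln \<gamma> / I\<close>: its mean
    log-likelihood exceeds \<open>ln \<gamma>\<close> by at least \<open>e/3 * ln \<gamma>\<close>,
    while \<open>B < (1 + e) / I\<close> leaves room for rounding up and for the factor
    \<open>1 / (1 - d)\<close>.\<close>
  define B where "B = (1 + e / 3) / I"
  \<comment> \<open>The Chebyshev bound in terms of \<open>y = 1 / ln \<gamma>\<close>;
    \<open>B + y\<close> bounds the rounded block length divided by
    \<open>ln \<gamma>\<close>.\<close>
  define d where "d y = V * 9 / e\<^sup>2 * (B * y + y\<^sup>2)" for y
  have B: "0 < B" using e I_pos by (simp add: B_def)
  have d_lim: "((\<lambda>\<gamma>. d (?y \<gamma>)) \<longlongrightarrow> V * 9 / e\<^sup>2 * (B * 0 + 0\<^sup>2)) at_top"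
    unfolding d_def by (intro tendsto_intros inverse_ln_tendsto_0)
  then have d0: "((\<lambda>\<gamma>. d (?y \<gamma>)) \<longlongrightarrow> 0) at_top" by simp
  have "((\<lambda>\<gamma>. (B + ?y \<gamma>) / (1 - d (?y \<gamma>))) \<longlongrightarrow> (B + 0) / (1 - 0)) at_top"
    by (intro tendsto_intros inverse_ln_tendsto_0 d0) simp
  moreover have "(B + 0) / (1 - 0) < (1 + e) / I"
    using e I_pos by (simp add: B_def divide_strict_right_mono)
  ultimately have ev1: "\<forall>\<^sub>F \<gamma> in at_top. (B + ?y \<gamma>) / (1 - d (?y \<gamma>)) < (1 + e) / I"
    by (rule order_tendstoD(2))
  have ev2: "\<forall>\<^sub>F \<gamma> in at_top. d (?y \<gamma>) < 1" by (rule order_tendstoD(2)[OF d0]) simp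
  show ?thesis
    using ev1 ev2 eventually_gt_at_top[of 1]
  proof eventually_elim
    case (elim \<gamma>)
    define x where "x = ln \<gamma>"
    have x: "0 < x" using elim by (simp add: x_def)
    define t where "t = nat \<lceil>B * x\<rceil>"
    have "0 < B * x" using B x by simp
    then have t: "B * x \<le> real t" "real t \<le> B * x + 1" "1 \<le> t"
      unfolding t_def by linarith+
    have "real t * I \<ge> B * x * I" using t I_pos by (intro mult_right_mono) auto
    moreover have "B * x * I = (1 + e / 3) * x" using I_pos by (simp add: B_def)
    ultimately have tI: "e / 3 * x \<le> real t * I - x" by (simp add: algebra_simps)
    have e3: "0 < e / 3 * x" using e x by simp
    have "real t * V / (real t * I - x)\<^sup>2 \<le> (B * x + 1) * V / (e / 3 * x)\<^sup>2"
      using t tI e3 V_nonneg B x by (intro frac_le mult_right_mono power_mono) auto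
    also have "\<dots> = d (inverse x)"
      using x e by (simp add: d_def field_simps power2_eq_square)
    finally have del: "real t * V / (real t * I - ln \<gamma>)\<^sup>2 \<le> d (inverse (ln \<gamma>))" unfolding x_def .
    have "WADD L m g f (M_CUSUM L m g f \<alpha>s (ln \<gamma>)) \<le> ennreal (real t / (1 - d (inverse (ln \<gamma>))))"
      using elim t tI e3 del by (intro WADD_M_CUSUM_le) (auto simp: x_def)
    also have "\<dots> \<le> ennreal ((1 + e) * (ln \<gamma> / I))"
    proof (rule ennreal_leI)
      have "real t / (1 - d (inverse x)) \<le> (B * x + 1) / (1 - d (inverse x))"
        using t elim by (intro divide_right_mono) (auto simp: x_def)
      also have "B * x + 1 = x * (B + inverse x)"
        using x by (simp add: distrib_left)
      also have "x * (B + inverse x) / (1 - d (inverse x)) = x * ((B + inverse x) / (1 - d (inverse x)))"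
        by simp
      also have "\<dots> \<le> x * ((1 + e) / I)"
        using x elim by (intro mult_left_mono) (auto simp: x_def)
      finally show "real t / (1 - d (inverse (ln \<gamma>))) \<le> (1 + e) * (ln \<gamma> / I)"
        by (simp add: x_def mult.commute)
    qed
    finally show ?case .
  qed
qed

lemma eventually_WADD_ge:
  assumes e: "0 < e" "e < 1"
  shows "\<forall>\<^sub>F \<gamma> in at_top. \<forall>\<tau>\<in>C_class L g \<gamma>. ennreal ((1 - e) * (ln \<gamma> / I)) \<le> WADD L m g f \<tau>"
proof -
  let ?y = "\<lambda>\<gamma>. inverse (ln \<gamma>)"
  \<comment> \<open>Window length about \<open>(1 - e/2) ln \<gamma> / I\<close>. The level
    \<open>a = (1 - e/4) ln \<gamma>\<close> lies between \<open>w I\<close> and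
    \<open>ln \<gamma>\<close> with a gap of at least \<open>e/4 * ln \<gamma>\<close> on either
    side: the lower gap feeds Chebyshev, the upper one beats the false-alarm term.\<close>
  define B where "B = (1 - e / 2) / I"
  \<comment> \<open>Total loss in terms of \<open>y = 1 / ln \<gamma>\<close>: 32 comes from the
    false-alarm term and \<open>16 * V\<close> from Chebyshev.\<close>
  define h where "h y = (32 + 16 * V) / (I * e\<^sup>2) * y" for y
  have B: "0 < B" using e I_pos by (simp add: B_def)
  have "((\<lambda>\<gamma>. h (?y \<gamma>)) \<longlongrightarrow> (32 + 16 * V) / (I * e\<^sup>2) * 0) at_top"
    unfolding h_def by (intro tendsto_intros inverse_ln_tendsto_0)
  then have h0: "((\<lambda>\<gamma>. h (?y \<gamma>)) \<longlongrightarrow> 0) at_top" by simp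
  have "((\<lambda>\<gamma>. (B - ?y \<gamma>) * (1 - h (?y \<gamma>))) \<longlongrightarrow> (B - 0) * (1 - 0)) at_top"
    by (intro tendsto_intros inverse_ln_tendsto_0 h0)
  moreover have "(1 - e) / I < (B - 0) * (1 - 0)"
    using e I_pos by (simp add: B_def divide_strict_right_mono)
  ultimately have ev1: "\<forall>\<^sub>F \<gamma> in at_top. (1 - e) / I < (B - ?y \<gamma>) * (1 - h (?y \<gamma>))"
    by (rule order_tendstoD(1))
  have ev2: "\<forall>\<^sub>F \<gamma> in at_top. h (?y \<gamma>) < 1" by (rule order_tendstoD(2)[OF h0]) simp
  \<comment> \<open>Ensures \<open>B * ln \<gamma> > 2\<close>, so that rounding down still leaves a
    window of length at least 1.\<close>
  have ev3: "\<forall>\<^sub>F \<gamma> in at_top. ?y \<gamma> < B / 2" by (rule order_tendstoD(2)[OF inverse_ln_tendsto_0]) (use B in simp)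
  show ?thesis
    using ev1 ev2 ev3 eventually_gt_at_top[of 1]
  proof eventually_elim
    case (elim \<gamma>)
    define x where "x = ln \<gamma>"
    have x: "0 < x" "exp x = \<gamma>" using elim by (simp_all add: x_def)
    define w where "w = nat \<lfloor>B * x\<rfloor>"
    have "2 < B * x" using elim(3) x by (simp add: x_def[symmetric] field_simps)
    then have w: "real w \<le> B * x" "B * x - 1 \<le> real w" "1 \<le> w"
      unfolding w_def by linarith+
    define a where "a = (1 - e / 4) * x"
    have "real w * I \<le> B * x * I" using w I_pos by (intro mult_right_mono) auto
    moreover have "B * x * I = (1 - e / 2) * x" using I_pos by (simp add: B_def)
    ultimately have aI: "e / 4 * x \<le> a - real w * I" by (simp add: a_def algebra_simps)
    have e4: "0 < e / 4 * x" using e x by simp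
    have "B * x \<le> x / I" using e x I_pos by (simp add: B_def field_simps)
    then have wx: "real w \<le> x / I" using w by linarith
    have "real w * V / (a - real w * I)\<^sup>2 \<le> x / I * V / (e / 4 * x)\<^sup>2"
      using wx aI e4 V_nonneg x I_pos by (intro frac_le mult_right_mono power_mono) auto
    also have "\<dots> = 16 * V / (I * e\<^sup>2) * inverse x"
      using x e I_pos by (simp add: field_simps power2_eq_square)
    finally have h1: "real w * V / (a - real w * I)\<^sup>2 \<le> 16 * V / (I * e\<^sup>2) * inverse x" .
    \<comment> \<open>\<open>w\<close> grows linearly in \<open>x\<close>, so the quadratic term of
      the exponential already makes the false-alarm loss of order \<open>1 / x\<close>.\<close>
    have "(e / 4 * x)\<^sup>2 / 2 \<le> exp (e / 4 * x)"
      using exp_lower_Taylor_quadratic[of "e / 4 * x"] e4 by linarith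
    then have "real w / exp (e / 4 * x) \<le> x / I / ((e / 4 * x)\<^sup>2 / 2)"
      using wx e4 x I_pos by (intro frac_le) auto
    also have "\<dots> = 32 / (I * e\<^sup>2) * inverse x"
      using x e I_pos by (simp add: field_simps power2_eq_square)
    also have "real w / exp (e / 4 * x) = exp a * real w / \<gamma>"
      unfolding x(2)[symmetric] a_def by (simp add: left_diff_distrib exp_diff)
    finally have h2: "exp a * real w / \<gamma> \<le> 32 / (I * e\<^sup>2) * inverse x" .
    have hx: "h (inverse x) = 32 / (I * e\<^sup>2) * inverse x + 16 * V / (I * e\<^sup>2) * inverse x"
      by (simp add: h_def add_divide_distrib distrib_right)
    have "(1 - e) * (x / I) = x * ((1 - e) / I)" by simp
    also have "\<dots> \<le> x * ((B - inverse x) * (1 - h (inverse x)))"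
      using x elim by (intro mult_left_mono) (auto simp: x_def)
    also have "\<dots> = (B * x - 1) * (1 - h (inverse x))"
      using x by (simp add: field_simps)
    also have "\<dots> \<le> real w * (1 - h (inverse x))"
      using w elim by (intro mult_right_mono) (auto simp: x_def)
    also have "\<dots> \<le> real w * (1 - exp a * real w / \<gamma> - real w * V / (a - real w * I)\<^sup>2)"
      using h1 h2 hx by (intro mult_left_mono) auto
    finally have le: "(1 - e) * (ln \<gamma> / I) \<le> real w * (1 - exp a * real w / \<gamma> - real w * V / (a - real w * I)\<^sup>2)"
      unfolding x_def .
    show ?case
    proof
      fix \<tau> assume \<tau>: "\<tau> \<in> C_class L g \<gamma>"
      have "ennreal (real w * (1 - exp a * real w / \<gamma> - real w * V / (a - real w * I)\<^sup>2)) \<le> WADD L m g f \<tau>"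
        using aI e4 w elim by (intro WADD_ge \<tau>) auto
      then show "ennreal ((1 - e) * (ln \<gamma> / I)) \<le> WADD L m g f \<tau>"
        using ennreal_leI[OF le] by (rule order_trans[rotated])
    qed
  qed
qed

lemma M_CUSUM_in_C_class: "1 < \<gamma> \<Longrightarrow> M_CUSUM L m g f \<alpha>s (ln \<gamma>) \<in> C_class L g \<gamma>"
  using M_CUSUM_stopping_time M_CUSUM_mean_time_false_alarm by (simp add: C_class_def)

text \<open>The test belongs to the class it is compared with, so the infimum is caught between the
  universal lower bound and the delay of the test, and both have the first-order term
  \<open>ln \<gamma> / I\<close>.\<close>

lemma M_CUSUM_asymptotically_optimal:
  shows "ext_asymp_equiv (\<lambda>\<gamma>. INF \<tau>\<in>C_class L g \<gamma>. WADD L m g f \<tau>)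
      (\<lambda>\<gamma>. WADD L m g f (M_CUSUM L m g f \<alpha>s (ln \<gamma>)))"
    and "ext_asymp_equiv (\<lambda>\<gamma>. WADD L m g f (M_CUSUM L m g f \<alpha>s (ln \<gamma>)))
      (\<lambda>\<gamma>. e2ennreal (ereal (ln \<gamma>) / KL_number L m g f \<alpha>s))"
proof -
  let ?s = "\<lambda>\<gamma>. ln \<gamma> / I" and ?W = "\<lambda>\<gamma>. WADD L m g f (M_CUSUM L m g f \<alpha>s (ln \<gamma>))"
  have s: "\<forall>\<^sub>F \<gamma> in at_top. 0 < ?s \<gamma>"
    using eventually_gt_at_top[of 1] by eventually_elim (use I_pos in simp)
  have inf: "\<forall>\<^sub>F \<gamma> in at_top. ennreal ((1 - e) * ?s \<gamma>) \<le> (INF \<tau>\<in>C_class L g \<gamma>. WADD L m g f \<tau>) \<and>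
      (INF \<tau>\<in>C_class L g \<gamma>. WADD L m g f \<tau>) \<le> ennreal ((1 + e) * ?s \<gamma>)"
    and W: "\<forall>\<^sub>F \<gamma> in at_top. ennreal ((1 - e) * ?s \<gamma>) \<le> ?W \<gamma> \<and> ?W \<gamma> \<le> ennreal ((1 + e) * ?s \<gamma>)"
    if e: "0 < e" "e < 1" for e
  proof -
    have "\<forall>\<^sub>F \<gamma> in at_top. ennreal ((1 - e) * ?s \<gamma>) \<le> (INF \<tau>\<in>C_class L g \<gamma>. WADD L m g f \<tau>) \<and>
      (INF \<tau>\<in>C_class L g \<gamma>. WADD L m g f \<tau>) \<le> ?W \<gamma> \<and> ?W \<gamma> \<le> ennreal ((1 + e) * ?s \<gamma>)"
      using eventually_WADD_ge[OF e] eventually_WADD_M_CUSUM_le[OF e] eventually_gt_at_top[of 1]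
    proof eventually_elim
      case (elim \<gamma>)
      then show ?case
        using INF_lower[OF M_CUSUM_in_C_class, of \<gamma> "WADD L m g f"] by (auto intro!: INF_greatest)
    qed
    then show "\<forall>\<^sub>F \<gamma> in at_top. ennreal ((1 - e) * ?s \<gamma>) \<le> (INF \<tau>\<in>C_class L g \<gamma>. WADD L m g f \<tau>) \<and>
      (INF \<tau>\<in>C_class L g \<gamma>. WADD L m g f \<tau>) \<le> ennreal ((1 + e) * ?s \<gamma>)"
      "\<forall>\<^sub>F \<gamma> in at_top. ennreal ((1 - e) * ?s \<gamma>) \<le> ?W \<gamma> \<and> ?W \<gamma> \<le> ennreal ((1 + e) * ?s \<gamma>)"
      by (auto elim!: eventually_mono intro: order_trans)
  qed
  have v: "\<forall>\<^sub>F \<gamma> in at_top. ennreal ((1 - e) * ?s \<gamma>) \<le> e2ennreal (ereal (ln \<gamma>) / KL_number L m g f \<alpha>s) \<and>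
      e2ennreal (ereal (ln \<gamma>) / KL_number L m g f \<alpha>s) \<le> ennreal ((1 + e) * ?s \<gamma>)" if e: "0 < e" "e < 1" for e
    using s
  proof eventually_elim
    case (elim \<gamma>)
    have "e2ennreal (ereal (ln \<gamma>) / KL_number L m g f \<alpha>s) = ennreal (?s \<gamma>)"
      using I_pos by (simp add: KL_eq_I)
    moreover have "(1 - e) * ?s \<gamma> \<le> ?s \<gamma>" "?s \<gamma> \<le> (1 + e) * ?s \<gamma>"
      using e elim by (simp_all add: mult_le_cancel_right1 mult_le_cancel_right2 del: times_divide_eq_right)
    ultimately show ?case by (auto intro!: ennreal_leI simp del: times_divide_eq_right)
  qed
  show "ext_asymp_equiv (\<lambda>\<gamma>. INF \<tau>\<in>C_class L g \<gamma>. WADD L m g f \<tau>) ?W"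
    by (rule ext_asymp_equiv_squeeze[OF s inf W])
  show "ext_asymp_equiv ?W (\<lambda>\<gamma>. e2ennreal (ereal (ln \<gamma>) / KL_number L m g f \<alpha>s))"
    by (rule ext_asymp_equiv_squeeze[OF s W v])
qed

end

theorem theorem5:
  fixes L m :: nat
    and g f :: "nat \<Rightarrow> real \<Rightarrow> real"
    and \<alpha>s :: "nat set \<Rightarrow> real"
  assumes "1 \<le> L" and "1 \<le> m" and "m \<le> L"
    and "\<And>l. l \<in> {1..L} \<Longrightarrow> pdf (g l)"
    and "\<And>l. l \<in> {1..L} \<Longrightarrow> pdf (f l)"
    and "\<And>l. l \<in> {1..L} \<Longrightarrow>
           density lborel (\<lambda>x. ennreal (g l x)) \<noteq> density lborel (\<lambda>x. ennreal (f l x))"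
    and "\<And>\<alpha>. \<alpha> \<in> mixing_simplex L m \<Longrightarrow> KL_number L m g f \<alpha> < \<infinity>"
    and "is_arg_min (KL_number L m g f) (\<lambda>\<alpha>. \<alpha> \<in> mixing_simplex L m) \<alpha>s"
    and "Max (log_ratio_second_moment L m g f \<alpha>s ` anomaly_sets L m) < \<infinity>"
  shows "(\<forall>\<gamma>>1. ennreal \<gamma> \<le> mean_time_false_alarm L g (M_CUSUM L m g f \<alpha>s (ln \<gamma>))) \<and>
    ext_asymp_equiv
      (\<lambda>\<gamma>. INF \<tau>\<in>C_class L g \<gamma>. WADD L m g f \<tau>)
      (\<lambda>\<gamma>. WADD L m g f (M_CUSUM L m g f \<alpha>s (ln \<gamma>))) \<and>
    ext_asymp_equiv
      (\<lambda>\<gamma>. WADD L m g f (M_CUSUM L m g f \<alpha>s (ln \<gamma>)))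
      (\<lambda>\<gamma>. e2ennreal (ereal (ln \<gamma>) / KL_number L m g f \<alpha>s))"
proof -
  interpret sensor_network L m g f
    using assms(2-5) by unfold_locales
  have "log_ratio_second_moment L m g f \<alpha>s E < \<infinity>" if "E \<in> anomaly_sets L m" for E
    using Max_ge[OF finite_imageI[OF finite_anomaly_sets] imageI[OF that], of "log_ratio_second_moment L m g f \<alpha>s"] assms(9)
    by (rule le_less_trans)
  then interpret optimal_mixture L m g f \<alpha>s
    using assms(6-8) by unfold_locales
  show ?thesis
    using M_CUSUM_mean_time_false_alarm M_CUSUM_asymptotically_optimal by blast
qed

end
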